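(* Let $\Omega=\mathrm{Q}_N=(0,1)^N$, $N\ge1$, let $p\in[2,\infty)$ and let $p'$ be its conjugate exponent. Let $s:\mathrm{Q}_N\to\mathbb{R}$ be measurable with $s(x)\in[0,1]$ for almost all $x$ and $|\{x\in\mathrm{Q}_N:s(x)=0\}|=0$. Let $\mathrm{G}_s:\mathrm{Q}_N\to\mathbb{R}$ be a weight with $\mathrm{G}_s^{-1/(p-1)}\in L^1_{\mathrm{loc}}(\mathrm{Q}_N)$ such that, if $s(\cdot)=s\in(0,1)$ is constant, then $\mathrm{G}_s(x)=2^{2s-1}\Gamma(s)/\Gamma(1-s)$ for all $x$. Assume moreover that for every $i=1,\dots,N$, for almost every $x_j\in(0,1)$, $j\ne i$, and almost every $z\in(0,1)$, $$\int_0^1\left(\mathrm{G}_s(x)|x_i-z|^{1-2s(x)}\right)^{1-p'}dx_i<\infty,\qquad x=(x_1,\dots,x_N).$$ Then there exists a unique bounded linear operator $$\mathrm{tr}_{\mathrm{Q}_N}:\mathscr{H}_{0,L}^{1,p}(\mathcal{C},w)\to\mathbb{W}^{s(\cdot),p}(\mathrm{Q}_N,\tilde w,w_1,\dots,w_N)$$ that satisfies $\mathrm{tr}_{\mathrm{Q}_N}u=u(\cdot,0)$ for all $u\in\mathscr{H}_{0,L}^{1,p}(\mathcal{C},w)\cap C_c^\infty(\mathcal{C}_{\mathrm{Q}_N})$. The same statement is true if $\mathscr{H}_{0,L}^{1,p}(\mathcal{C},w)$ is replaced by $\mathscr{H}_{0,L}^{1,p}(\mathcal{C}^\tau,w)$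 (with $C_c^\infty(\mathcal{C}_{\mathrm{Q}_N})$ replaced by $C_c^\infty(\mathcal{C}^\tau_{\mathrm{Q}_N})$), for every $\tau\ge1$.
   Context: A weight is a measurable function that is positive and finite almost everywhere. With $\Omega=\mathrm{Q}_N$: $\mathcal{C}=\Omega\times(0,\infty)$, $\partial_L\mathcal{C}=\partial\Omega\times[0,\infty)$, $\mathcal{C}_{\Omega}=\mathcal{C}\cup(\Omega\times\{0\})$; for $\tau>0$, $\mathcal{C}^\tau=\Omega\times(0,\tau)$ and $\mathcal{C}^\tau_\Omega=\mathcal{C}^\tau\cup(\Omega\times\{0\})$. The weight on $\mathcal{C}$ (and its restriction to $\mathcal{C}^\tau$) is $w(x,y)=\mathrm{G}_s(x)y^{1-2s(x)}$. For an open set $U$ and a weight $\rho$ on $U$, $L^p(U,\rho)$ is the space of measurable $u$ with $\|u\|_{L^p(U,\rho)}=(\int_U|u|^p\rho\,dx)^{1/p}<\infty$; if $\rho^{-1/(p-1)}\in L^1_{\mathrm{loc}}(U)$, $W^{1,p}(U,\rho)$ is the Banach space of $u\in L^p(U,\rho)$ with weak gradient satisfying $|\nabla u|\in L^p(U,\rho)$, normed by $(\int_U|u|^p\rho+\int_U|\nabla u|^p\rho)^{1/p}$. $C_c^\infty(\mathcal{C}_\Omega)$ is the set of $u\in C^\infty(\overline{\mathcal{C}})$ with compact support in $\mathcal{C}_\Omega$ (so the support does not meet $\partial_L\mathcal{C}$, while $u$ need not vanish on $\Omega\times\{0\}$); $C_c^\infty(\mathcal{C}^\tau_\Omega)$ is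 defined analogously. $\mathscr{H}_{0,L}^{1,p}(\mathcal{C},w)$ is the closure of $C_c^\infty(\mathcal{C}_\Omega)\cap W^{1,p}(\mathcal{C},w)$ in $W^{1,p}(\mathcal{C},w)$; $\mathscr{H}_{0,L}^{1,p}(\mathcal{C}^\tau,w)$ is the closure of $C_c^\infty(\mathcal{C}^\tau_\Omega)\cap W^{1,p}(\mathcal{C}^\tau,w)$ in $W^{1,p}(\mathcal{C}^\tau,w)$. Weights on the cube. $\tilde w(x)=\mathrm{G}_s(x)(p-2+2s(x))^p$ for $x\in\mathrm{Q}_N$. For $x\in\mathrm{Q}_N$ and $a\in(0,1)$, $x_a^i=(x_1,\dots,x_{i-1},a,x_{i+1},\dots,x_N)$. For $i=1,\dots,N$ and $(x,\tau)\in\mathrm{Q}_{N+1}=\mathrm{Q}_N\times(0,1)$ set $\Phi_i(x,\tau)=\mathrm{G}_s(x)|x_i-\tau|^{1-2s(x)}$, $$\varphi_i(x,\tau)=\Phi_i(x,\tau)^{1-p'}\left(\int_{\min\{x_i,\tau\}}^{\max\{x_i,\tau\}}\Phi_i(x_{t'}^i,\tau)^{1-p'}dt'\right)^{-p},$$ $$\psi_i(x,\tau)=\Phi_i(x,\tau)^{1-p'}\left(\int_{\min\{x_i,\tau\}}^{\max\{x_i,\tau\}}\Phi_i(x,\tau')^{1-p'}d\tau'\right)^{-p},$$ and $w_i=\min\{\varphi_i,\psi_i\}$. The space $\mathbb{W}^{s(\cdot),p}(\mathrm{Q}_N,\tilde w,w_1,\dots,w_N)$ is the set of $v\in L^p(\mathrm{Q}_N,\tilde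 w)$ with $A_i(v)<\infty$ for all $i=1,\dots,N$, with norm $\left(\|v\|^p_{L^p(\mathrm{Q}_N,\tilde w)}+\sum_{i=1}^NA_i(v)\right)^{1/p}$, where $$A_i(v)=\int_0^1\!\!\cdots\!\int_0^1\left(\int_0^1\!\int_0^1w_i(x_t^i,\tau)|v(x_t^i)-v(x_\tau^i)|^p\,d\tau\,dt\right)dx_1\cdots dx_{i-1}\,dx_{i+1}\cdots dx_N$$ (the outer integral is $(N-1)$-fold, and absent if $N=1$). *)

theory Defs
  imports "HOL-Analysis.Analysis"
begin

text \<open>Elements of weighted Lebesgue and Sobolev spaces are represented by functions on the
  whole type, of which only the restriction to the domain \<open>U\<close> matters, up to equality
  almost everywhere in \<open>U\<close>.\<close>

primrec iter_deriv :: "'a list \<Rightarrow> ('a::euclidean_space \<Rightarrow> real) \<Rightarrow> 'a \<Rightarrow> real" where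
  "iter_deriv [] f = f"
| "iter_deriv (b # bs) f = (\<lambda>x. frechet_derivative (iter_deriv bs f) (at x) b)"

text \<open>\<open>C\<^sup>\<infinity>\<close> on the closure of an open set \<open>U\<close>: all iterated partial derivatives
  exist in \<open>U\<close> and have continuous extensions to the closure. Continuity of \<open>f\<close>
  on the closure makes its boundary values meaningful.\<close>

definition smooth_upto :: "'a::euclidean_space set \<Rightarrow> ('a \<Rightarrow> real) \<Rightarrow> bool" where
  "smooth_upto U f \<longleftrightarrow> continuous_on (closure U) f \<and>
    (\<forall>bs. set bs \<subseteq> Basis \<longrightarrow>
      (\<forall>x\<in>U. iter_deriv bs f differentiable (at x)) \<and>
      (\<exists>g. continuous_on (closure U) g \<and> (\<forall>x\<in>U. g x = iter_deriv bs f x)))"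

text \<open>Functions that are smooth up to the boundary of \<open>U\<close> and have compact support in
  \<open>V\<close>, where \<open>U \<subseteq> V \<subseteq> closure U\<close>. The case \<open>V = U\<close> gives
  the usual test functions on \<open>U\<close>.\<close>

definition Cc_smooth :: "'a::euclidean_space set \<Rightarrow> 'a set \<Rightarrow> ('a \<Rightarrow> real) set" where
  "Cc_smooth U V = {f. smooth_upto U f \<and>
     (let K = closure {x \<in> closure U. f x \<noteq> 0} in compact K \<and> K \<subseteq> V)}"

definition is_weight :: "'a::euclidean_space set \<Rightarrow> ('a \<Rightarrow> real) \<Rightarrow> bool" where
  "is_weight U \<rho> \<longleftrightarrow> \<rho> \<in> borel_measurable (lebesgue_on U) \<and> (AE x in lebesgue_on U. 0 < \<rho> x)"

definition L1_loc ::
  "'a::euclidean_space set \<Rightarrow> ('a \<Rightarrow> 'b::{banach, second_countable_topology}) \<Rightarrow> bool" where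
  "L1_loc U f \<longleftrightarrow> f \<in> borel_measurable (lebesgue_on U) \<and>
     (\<forall>K. compact K \<and> K \<subseteq> U \<longrightarrow> set_integrable lebesgue K f)"

definition Lp_pow ::
  "real \<Rightarrow> 'a::euclidean_space set \<Rightarrow> ('a \<Rightarrow> real) \<Rightarrow> ('a \<Rightarrow> 'b::real_normed_vector) \<Rightarrow> ennreal" where
  "Lp_pow p U \<rho> u = (\<integral>\<^sup>+ x. ennreal (norm (u x) powr p * \<rho> x) \<partial>lebesgue_on U)"

definition weighted_Lp ::
  "real \<Rightarrow> 'a::euclidean_space set \<Rightarrow> ('a \<Rightarrow> real) \<Rightarrow> ('a \<Rightarrow> 'b::real_normed_vector) set" where
  "weighted_Lp p U \<rho> = {u \<in> borel_measurable (lebesgue_on U). Lp_pow p U \<rho> u < \<infinity>}"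

definition is_weak_gradient ::
  "'a::euclidean_space set \<Rightarrow> ('a \<Rightarrow> real) \<Rightarrow> ('a \<Rightarrow> 'a) \<Rightarrow> bool" where
  "is_weak_gradient U u g \<longleftrightarrow> L1_loc U u \<and> L1_loc U g \<and>
    (\<forall>f \<in> Cc_smooth U U. \<forall>b \<in> Basis.
      (LINT x|lebesgue_on U. u x * frechet_derivative f (at x) b) =
      - (LINT x|lebesgue_on U. (g x \<bullet> b) * f x))"

text \<open>The weak gradient is unique up to a null set of \<open>U\<close>, so the choice does not
  affect the norm below.\<close>

definition weak_gradient :: "'a::euclidean_space set \<Rightarrow> ('a \<Rightarrow> real) \<Rightarrow> 'a \<Rightarrow> 'a" where
  "weak_gradient U u = (SOME g. is_weak_gradient U u g)"

definition W1p :: "real \<Rightarrow> 'a::euclidean_space set \<Rightarrow> ('a \<Rightarrow> real) \<Rightarrow> ('a \<Rightarrow> real) set" where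
  "W1p p U \<rho> = {u \<in> weighted_Lp p U \<rho>. \<exists>g. is_weak_gradient U u g \<and> g \<in> weighted_Lp p U \<rho>}"

definition W1p_norm :: "real \<Rightarrow> 'a::euclidean_space set \<Rightarrow> ('a \<Rightarrow> real) \<Rightarrow> ('a \<Rightarrow> real) \<Rightarrow> real" where
  "W1p_norm p U \<rho> u =
     enn2real (Lp_pow p U \<rho> u + Lp_pow p U \<rho> (weak_gradient U u)) powr (1 / p)"

definition H1p :: "real \<Rightarrow> 'a::euclidean_space set \<Rightarrow> 'a set \<Rightarrow> ('a \<Rightarrow> real) \<Rightarrow> ('a \<Rightarrow> real) set" where
  "H1p p U V \<rho> = {u \<in> W1p p U \<rho>. \<forall>\<epsilon>>0. \<exists>f \<in> Cc_smooth U V \<inter> W1p p U \<rho>.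
     W1p_norm p U \<rho> (\<lambda>z. u z - f z) < \<epsilon>}"

definition cube :: "(real^'n) set" where
  "cube = {x. \<forall>i. 0 < x $ i \<and> x $ i < 1}"

definition cyl :: "((real^'n) \<times> real) set" where
  "cyl = cube \<times> {0<..}"

definition cyl_base :: "((real^'n) \<times> real) set" where
  "cyl_base = cyl \<union> cube \<times> {0}"

definition tcyl :: "real \<Rightarrow> ((real^'n) \<times> real) set" where
  "tcyl \<tau> = cube \<times> {0<..<\<tau>}"

definition tcyl_base :: "real \<Rightarrow> ((real^'n) \<times> real) set" where
  "tcyl_base \<tau> = tcyl \<tau> \<union> cube \<times> {0}"

definition conj_exp :: "real \<Rightarrow> real" where
  "conj_exp p = p / (p - 1)"

definition subst_coord :: "real^'n \<Rightarrow> 'n \<Rightarrow> real \<Rightarrow> real^'n" where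
  "subst_coord x i a = (\<chi> j. if j = i then a else x $ j)"

definition cyl_weight :: "(real^'n \<Rightarrow> real) \<Rightarrow> (real^'n \<Rightarrow> real) \<Rightarrow> (real^'n) \<times> real \<Rightarrow> real" where
  "cyl_weight s G = (\<lambda>(x, y). G x * y powr (1 - 2 * s x))"

definition base_weight :: "real \<Rightarrow> (real^'n \<Rightarrow> real) \<Rightarrow> (real^'n \<Rightarrow> real) \<Rightarrow> real^'n \<Rightarrow> real" where
  "base_weight p s G x = G x * (p - 2 + 2 * s x) powr p"

definition Phi :: "(real^'n \<Rightarrow> real) \<Rightarrow> (real^'n \<Rightarrow> real) \<Rightarrow> 'n \<Rightarrow> real^'n \<Rightarrow> real \<Rightarrow> real" where
  "Phi s G i x \<tau> = G x * \<bar>x $ i - \<tau>\<bar> powr (1 - 2 * s x)"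

text \<open>A divergent inner integral below has Bochner value \<open>0\<close>, and \<open>0 powr (-p) = 0\<close>,
  in agreement with the convention that \<open>\<infinity>\<close> to the power \<open>-p\<close> is \<open>0\<close>. The
  inner integrals are positive for almost all \<open>(x, \<tau>)\<close>.\<close>

definition phi_weight ::
  "real \<Rightarrow> (real^'n \<Rightarrow> real) \<Rightarrow> (real^'n \<Rightarrow> real) \<Rightarrow> 'n \<Rightarrow> real^'n \<Rightarrow> real \<Rightarrow> real" where
  "phi_weight p s G i x \<tau> = Phi s G i x \<tau> powr (1 - conj_exp p) *
     (LINT t:{min (x $ i) \<tau>..max (x $ i) \<tau>}|lebesgue.
        Phi s G i (subst_coord x i t) \<tau> powr (1 - conj_exp p)) powr (-p)"

definition psi_weight ::
  "real \<Rightarrow> (real^'n \<Rightarrow> real) \<Rightarrow> (real^'n \<Rightarrow> real) \<Rightarrow> 'n \<Rightarrow> real^'n \<Rightarrow> real \<Rightarrow> real" where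
  "psi_weight p s G i x \<tau> = Phi s G i x \<tau> powr (1 - conj_exp p) *
     (LINT t:{min (x $ i) \<tau>..max (x $ i) \<tau>}|lebesgue.
        Phi s G i x t powr (1 - conj_exp p)) powr (-p)"

definition dir_weight ::
  "real \<Rightarrow> (real^'n \<Rightarrow> real) \<Rightarrow> (real^'n \<Rightarrow> real) \<Rightarrow> 'n \<Rightarrow> real^'n \<Rightarrow> real \<Rightarrow> real" where
  "dir_weight p s G i x \<tau> = min (phi_weight p s G i x \<tau>) (psi_weight p s G i x \<tau>)"

text \<open>The double integral over \<open>(t, \<tau>)\<close> does not depend on \<open>x $ i\<close>, and \<open>x $ i\<close> ranges over
  \<open>(0,1)\<close>, which has measure one. The integral over the whole cube is therefore the
  \<open>(N-1)\<close>-fold integral over the coordinates other than \<open>i\<close>.\<close>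

definition seminorm_pow :: "real \<Rightarrow> ('n::finite \<Rightarrow> real^'n \<Rightarrow> real \<Rightarrow> real) \<Rightarrow> 'n \<Rightarrow> (real^'n \<Rightarrow> real) \<Rightarrow> ennreal" where
  "seminorm_pow p w i v =
    (\<integral>\<^sup>+ x. (\<integral>\<^sup>+ t. (\<integral>\<^sup>+ \<tau>.
        ennreal (w i (subst_coord x i t) \<tau> *
          \<bar>v (subst_coord x i t) - v (subst_coord x i \<tau>)\<bar> powr p)
      \<partial>lebesgue_on {0<..<1}) \<partial>lebesgue_on {0<..<1}) \<partial>lebesgue_on cube)"

definition trace_space ::
  "real \<Rightarrow> (real^'n \<Rightarrow> real) \<Rightarrow> ('n::finite \<Rightarrow> real^'n \<Rightarrow> real \<Rightarrow> real) \<Rightarrow> (real^'n \<Rightarrow> real) set" where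
  "trace_space p \<omega> w = {v \<in> weighted_Lp p cube \<omega>. \<forall>i. seminorm_pow p w i v < \<infinity>}"

definition trace_space_norm ::
  "real \<Rightarrow> (real^'n \<Rightarrow> real) \<Rightarrow> ('n::finite \<Rightarrow> real^'n \<Rightarrow> real \<Rightarrow> real) \<Rightarrow> (real^'n \<Rightarrow> real) \<Rightarrow> real" where
  "trace_space_norm p \<omega> w v =
     enn2real (Lp_pow p cube \<omega> v + (\<Sum>i\<in>UNIV. seminorm_pow p w i v)) powr (1 / p)"

text \<open>Bounded linear operators between spaces of functions modulo equality almost everywhere
  with respect to \<open>M\<close> and \<open>N\<close>, given on representatives.\<close>

definition bounded_linear_op ::
  "'a measure \<Rightarrow> ('a \<Rightarrow> real) set \<Rightarrow> (('a \<Rightarrow> real) \<Rightarrow> real) \<Rightarrow>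
   'b measure \<Rightarrow> ('b \<Rightarrow> real) set \<Rightarrow> (('b \<Rightarrow> real) \<Rightarrow> real) \<Rightarrow>
   (('a \<Rightarrow> real) \<Rightarrow> ('b \<Rightarrow> real)) \<Rightarrow> bool" where
  "bounded_linear_op M X nX N Y nY T \<longleftrightarrow>
     (\<forall>u\<in>X. T u \<in> Y) \<and>
     (\<forall>u\<in>X. \<forall>v\<in>X. (AE z in M. u z = v z) \<longrightarrow> (AE x in N. T u x = T v x)) \<and>
     (\<forall>u\<in>X. \<forall>v\<in>X. AE x in N. T (\<lambda>z. u z + v z) x = T u x + T v x) \<and>
     (\<forall>c. \<forall>u\<in>X. AE x in N. T (\<lambda>z. c * u z) x = c * T u x) \<and>
     (\<exists>K. \<forall>u\<in>X. nY (T u) \<le> K * nX u)"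

definition is_trace_operator ::
  "real \<Rightarrow> (real^'n::finite \<Rightarrow> real) \<Rightarrow> (real^'n \<Rightarrow> real) \<Rightarrow>
   ((real^'n) \<times> real) set \<Rightarrow> ((real^'n) \<times> real) set \<Rightarrow>
   (((real^'n) \<times> real \<Rightarrow> real) \<Rightarrow> (real^'n \<Rightarrow> real)) \<Rightarrow> bool" where
  "is_trace_operator p s G U V T \<longleftrightarrow>
     bounded_linear_op
       (lebesgue_on U) (H1p p U V (cyl_weight s G)) (W1p_norm p U (cyl_weight s G))
       (lebesgue_on cube) (trace_space p (base_weight p s G) (dir_weight p s G))
       (trace_space_norm p (base_weight p s G) (dir_weight p s G)) T \<and>
     (\<forall>u \<in> H1p p U V (cyl_weight s G) \<inter> Cc_smooth U V.
        AE x in lebesgue_on cube. T u x = u (x, 0))"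

text \<open>Uniqueness is equality of operators modulo equality almost everywhere.\<close>

definition exists_unique_trace ::
  "real \<Rightarrow> (real^'n::finite \<Rightarrow> real) \<Rightarrow> (real^'n \<Rightarrow> real) \<Rightarrow>
   ((real^'n) \<times> real) set \<Rightarrow> ((real^'n) \<times> real) set \<Rightarrow> bool" where
  "exists_unique_trace p s G U V \<longleftrightarrow>
     (\<exists>T. is_trace_operator p s G U V T \<and>
       (\<forall>T'. is_trace_operator p s G U V T' \<longrightarrow>
         (\<forall>u \<in> H1p p U V (cyl_weight s G). AE x in lebesgue_on cube. T' u x = T u x)))"

end

theory Submission
  imports Defs
begin

text \<open>Write \<open>w(x,y) = G(x) y\<^sup>1\<^sup>-\<^sup>2\<^sup>s\<^sup>(\<^sup>x\<^sup>)\<close>. By definition, test functions are dense in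
the space on which the trace acts, so a bounded trace operator is determined by its values on them, and it exists as soon as
\[ \|f(\cdot,0)\|^p \le C \|f\|^p \]
holds for all functions that are smooth up to the boundary, with the norm of the trace space on the
left and the norm of the weighted Sobolev space on the right. This is \<open>trace_estimate\<close>. All
paths in its proof stay below height one, and so it holds for every cylinder of height at least one.

The \<open>L\<^sup>p\<close> part of the estimate is one-dimensional. On a vertical line,
\<open>f(x,0)\<close> differs from \<open>f(x,y)\<close> by at most the integral of \<open>\<bar>\<partial>f/\<partial>y\<bar>\<close>, and
the Hoelder inequality with weight \<open>y\<^sup>1\<^sup>-\<^sup>2\<^sup>s\<close> bounds this integral at the price of a negative power of
\<open>p - 2 + 2s\<close>, which the factor \<open>(p - 2 + 2s)\<^sup>p\<close> of the base weight absorbs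
(\<open>boundary_value_estimate\<close>).

For the seminorm in direction \<open>i\<close>, the difference of the boundary values at \<open>x\<close> and at
the point \<open>x'\<close> with \<open>i\<close>-th coordinate \<open>\<tau>\<close> is split at the point
\<open>(x, \<bar>x\<^sub>i - \<tau>\<bar>)\<close>: a vertical segment leads from there to \<open>(x,0)\<close> and a diagonal one
to \<open>(x',0)\<close>. On each of the two segments the restriction of \<open>w\<close> is \<open>\<Phi>\<^sub>i\<close>, and
\<open>\<psi>\<^sub>i\<close> and \<open>\<phi>\<^sub>i\<close> are precisely the weights for which the Hardy inequality
\[ \int \omega \Big(\int_c^r \omega\Big)^{-p} |h(r) - h(c)|^p\, dr \le C \int |h'|^p\, \omega^{1-p}\, dr,
   \qquad \omega = \Phi_i^{1-p'}, \]
holds (\<open>Hardy_inequality\<close>). The measure-preserving map \<open>swap_coord\<close>, which exchanges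
\<open>x\<^sub>i\<close> and \<open>\<tau>\<close>, turns the sum of these one-dimensional inequalities into integrals over
the slab of height one.

For a rapidly converging sequence of test functions the boundary values converge almost everywhere,
and Fatou's lemma carries the estimate over to their limit (\<open>is_trace_exists\<close>). The norm of the
Sobolev space refers to an arbitrarily chosen weak gradient. That it is the classical gradient for a smooth function, and that it is
additive, follows from the uniqueness of weak gradients (\<open>is_weak_gradient_unique\<close>), whose proof
needs enough test functions; they are built explicitly from \<open>exp (-c/y)\<close>. Finally, \<open>s\<close>
and \<open>G\<close> may be changed on a null set into Borel functions without affecting any of the spaces
(\<open>exists_unique_trace_cong_weights\<close>), which gives access to Tonelli's theorem.\<close>

section \<open>Smooth bump functions\<close>

text \<open>The powers \<open>y\<^sup>-\<^sup>k\<close> are included so that the family is closed under differentiation up to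
linear combinations. The parameter \<open>c\<close> tends to \<open>0\<close> later, which turns products of such
functions into indicators of boxes.\<close>

definition flat_bump :: "real \<Rightarrow> nat \<Rightarrow> real \<Rightarrow> real" where
  "flat_bump c k y = (if 0 < y then exp (- c / y) / y ^ k else 0)"

text \<open>With \<open>z = c/y\<close> this is the decay of \<open>z\<^sup>k exp (-z)\<close> at infinity.\<close>

lemma tendsto_exp_neg_inverse_div_power:
  assumes "0 < c"
  shows "((\<lambda>y. exp (- c / y) / y ^ k) \<longlongrightarrow> 0) (at_right (0::real))"
proof -
  have 1: "((\<lambda>z::real. z ^ k / exp z) \<longlongrightarrow> 0) at_top"
    by (rule tendsto_power_div_exp_0)
  have 2: "filterlim (\<lambda>y::real. c / y) at_top (at_right 0)"
    unfolding divide_inverse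
    by (intro filterlim_tendsto_pos_mult_at_top[OF tendsto_const assms] filterlim_inverse_at_top_right)
  have "((\<lambda>y. (c / y) ^ k / exp (c / y)) \<longlongrightarrow> 0) (at_right (0::real))"
    using filterlim_compose[OF 1 2] .
  then have "((\<lambda>y. (1 / c ^ k) * ((c / y) ^ k / exp (c / y))) \<longlongrightarrow> (1 / c ^ k) * 0) (at_right (0::real))"
    by (intro tendsto_intros)
  moreover have "(1 / c ^ k) * ((c / y) ^ k / exp (c / y)) = exp (- c / y) / y ^ k" for y
    using assms by (simp add: power_divide exp_minus field_simps)
  ultimately show ?thesis by simp
qed

lemma flat_bump_has_real_derivative:
  assumes "0 < c"
  shows "(flat_bump c k has_real_derivative c * flat_bump c (k + 2) y - k * flat_bump c (k + 1) y) (at y)"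
proof -
  consider "y < 0" | "y = 0" | "0 < y" by linarith
  then show ?thesis
  proof cases
    case 1
    have "((\<lambda>_. 0) has_real_derivative 0) (at y)" by simp
    then have "(flat_bump c k has_real_derivative 0) (at y)"
      by (rule DERIV_cong_ev[THEN iffD1, OF refl _ refl, rotated])
         (use 1 in \<open>auto intro!: eventually_mono[OF eventually_nhds_in_open[of "{..<0}"]] simp: flat_bump_def\<close>)
    then show ?thesis using 1 by (simp add: flat_bump_def)
  next
    case 2
    have "(\<lambda>h. flat_bump c k h / h) \<midarrow>0\<rightarrow> 0"
    proof (rule filterlim_split_at_real)
      have "((\<lambda>h. 0) \<longlongrightarrow> (0::real)) (at_left 0)" by simp
      then show "((\<lambda>h. flat_bump c k h / h) \<longlongrightarrow> 0) (at_left 0)"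
        by (rule Lim_transform_eventually)
           (auto simp: flat_bump_def eventually_at_left[of "-1"] intro!: exI[of _ "-1"])
      show "((\<lambda>h. flat_bump c k h / h) \<longlongrightarrow> 0) (at_right 0)"
        by (rule Lim_transform_eventually[OF tendsto_exp_neg_inverse_div_power[OF assms, of "k + 1"]])
           (auto simp: flat_bump_def eventually_at_right[of _ 1] field_simps intro!: exI[of _ "1"])
    qed
    then show ?thesis
      using 2 by (simp add: has_field_derivative_iff flat_bump_def)
  next
    case 3
    have "((\<lambda>y. exp (- c / y) / y ^ k) has_real_derivative
        (exp (- c / y) * (c / y\<^sup>2) * y ^ k - exp (- c / y) * (k * y ^ (k - 1))) / (y ^ k * y ^ k)) (at y)"
      using 3 by (auto intro!: derivative_eq_intros simp: power2_eq_square)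
    also have "(exp (- c / y) * (c / y\<^sup>2) * y ^ k - exp (- c / y) * (k * y ^ (k - 1))) / (y ^ k * y ^ k)
        = c * (exp (- c / y) / y ^ (k + 2)) - k * (exp (- c / y) / y ^ (k + 1))"
      using 3 by (cases k) (auto simp: field_simps power2_eq_square)
    finally have "((\<lambda>y. exp (- c / y) / y ^ k) has_real_derivative
        c * (exp (- c / y) / y ^ (k + 2)) - k * (exp (- c / y) / y ^ (k + 1))) (at y)" .
    then have "(flat_bump c k has_real_derivative
        c * (exp (- c / y) / y ^ (k + 2)) - k * (exp (- c / y) / y ^ (k + 1))) (at y)"
      by (rule DERIV_cong_ev[THEN iffD1, OF refl _ refl, rotated])
         (use 3 in \<open>auto intro!: eventually_mono[OF eventually_nhds_in_open[of "{0<..}"]] simp: flat_bump_def\<close>)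
    then show ?thesis using 3 by (simp add: flat_bump_def)
  qed
qed

text \<open>The algebra generated by the functions \<open>flat_bump\<close> of one affine coordinate. Partial derivatives
do not leave it, and so each of its elements is smooth.\<close>

inductive bump_alg :: "('a::euclidean_space \<Rightarrow> real) \<Rightarrow> bool" where
  const: "bump_alg (\<lambda>x. c)"
| bump: "0 < c \<Longrightarrow> bump_alg (\<lambda>x. flat_bump c k (x \<bullet> v + a))"
| add: "bump_alg f \<Longrightarrow> bump_alg g \<Longrightarrow> bump_alg (\<lambda>x. f x + g x)"
| mult: "bump_alg f \<Longrightarrow> bump_alg g \<Longrightarrow> bump_alg (\<lambda>x. f x * g x)"

lemma bump_alg_derivative:
  assumes "bump_alg f"
  shows "\<exists>D. (\<forall>x. (f has_derivative D x) (at x)) \<and> (\<forall>b. bump_alg (\<lambda>x. D x b))"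
  using assms
proof induction
  case (const c)
  then show ?case by (intro exI[of _ "\<lambda>_ _. 0"]) (simp add: bump_alg.const)
next
  case (bump c k v a)
  let ?d = "\<lambda>y. c * flat_bump c (k + 2) y - k * flat_bump c (k + 1) y"
  let ?D = "\<lambda>x b. (b \<bullet> v) * ?d (x \<bullet> v + a)"
  show ?case
  proof (intro exI[of _ ?D] conjI allI)
    fix x :: 'a
    have "((flat_bump c k \<circ> (\<lambda>x. x \<bullet> v + a)) has_derivative (*) (?d (x \<bullet> v + a)) \<circ> (\<lambda>b. b \<bullet> v)) (at x)"
      using flat_bump_has_real_derivative[OF bump, of k "x \<bullet> v + a"]
      by (intro diff_chain_at) (auto intro!: derivative_eq_intros simp: has_field_derivative_def)
    then show "((\<lambda>x. flat_bump c k (x \<bullet> v + a)) has_derivative ?D x) (at x)"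
      by (simp add: o_def mult.commute)
    fix b :: 'a
    have "bump_alg (\<lambda>x. (b \<bullet> v) * (c * flat_bump c (k + 2) (x \<bullet> v + a)
        + (- real k) * flat_bump c (k + 1) (x \<bullet> v + a)))"
      by (intro bump_alg.intros bump)
    then show "bump_alg (\<lambda>x. ?D x b)" by simp
  qed
next
  case (add f g)
  then obtain D E where "\<And>x. (f has_derivative D x) (at x)" "\<And>b. bump_alg (\<lambda>x. D x b)"
    "\<And>x. (g has_derivative E x) (at x)" "\<And>b. bump_alg (\<lambda>x. E x b)" by blast
  then show ?case
    by (intro exI[of _ "\<lambda>x b. D x b + E x b"] conjI allI has_derivative_add bump_alg.add)
next
  case (mult f g)
  then obtain D E where "\<And>x. (f has_derivative D x) (at x)" "\<And>b. bump_alg (\<lambda>x. D x b)"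
    "\<And>x. (g has_derivative E x) (at x)" "\<And>b. bump_alg (\<lambda>x. E x b)" by blast
  then show ?case
    by (intro exI[of _ "\<lambda>x b. f x * E x b + D x b * g x"] conjI allI has_derivative_mult
        bump_alg.add bump_alg.mult mult.hyps)
qed

lemma bump_alg_iter_deriv: "bump_alg f \<Longrightarrow> bump_alg (iter_deriv bs f)"
proof (induction bs)
  case (Cons b bs)
  then have 1: "bump_alg (iter_deriv bs f)" by simp
  then obtain D where D: "\<And>x. (iter_deriv bs f has_derivative D x) (at x)" "bump_alg (\<lambda>x. D x b)"
    using bump_alg_derivative by blast
  have "frechet_derivative (iter_deriv bs f) (at x) = D x" for x
    by (rule frechet_derivative_at[symmetric, OF D(1)])
  then show ?case using D by simp
qed simp

lemma bump_alg_differentiable: "bump_alg f \<Longrightarrow> f differentiable (at x)"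
  using bump_alg_derivative differentiable_def by blast

lemma bump_alg_continuous_on: "bump_alg f \<Longrightarrow> continuous_on A f"
  by (meson bump_alg_differentiable continuous_at_imp_continuous_on differentiable_imp_continuous_within)

lemma bump_alg_smooth_upto: "bump_alg f \<Longrightarrow> smooth_upto U f"
  unfolding smooth_upto_def
proof (intro conjI allI impI)
  assume f: "bump_alg f"
  then show "continuous_on (closure U) f" by (rule bump_alg_continuous_on)
  fix bs :: "'a list"
  have "bump_alg (iter_deriv bs f)" using f by (rule bump_alg_iter_deriv)
  then show "\<forall>x\<in>U. iter_deriv bs f differentiable at x"
    "\<exists>g. continuous_on (closure U) g \<and> (\<forall>x\<in>U. g x = iter_deriv bs f x)"
    using bump_alg_differentiable bump_alg_continuous_on by (auto intro!: exI[of _ "iter_deriv bs f"])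
qed

lemma bump_alg_prod:
  "finite A \<Longrightarrow> (\<And>a. a \<in> A \<Longrightarrow> bump_alg (f a)) \<Longrightarrow> bump_alg (\<lambda>x. \<Prod>a\<in>A. f a x)"
  by (induction A rule: finite_induct) (auto intro: bump_alg.intros)

text \<open>A product over the coordinates, positive exactly on the open box.\<close>

definition box_bump :: "'a::euclidean_space \<Rightarrow> 'a \<Rightarrow> nat \<Rightarrow> 'a \<Rightarrow> real" where
  "box_bump l u n x = (\<Prod>b\<in>Basis. flat_bump (1 / Suc n) 0 (x \<bullet> b - l \<bullet> b) * flat_bump (1 / Suc n) 0 (u \<bullet> b - x \<bullet> b))"

lemma box_bump_smooth: "smooth_upto U (box_bump l u n)"
proof -
  have "bump_alg (\<lambda>x. \<Prod>b\<in>Basis. flat_bump (1 / Suc n) 0 (x \<bullet> b + - (l \<bullet> b)) * flat_bump (1 / Suc n) 0 (x \<bullet> (- b) + u \<bullet> b))"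
    by (intro bump_alg_prod bump_alg.intros) auto
  then show ?thesis
    by (intro bump_alg_smooth_upto) (simp add: box_bump_def[abs_def])
qed

lemma flat_bump_nonneg: "0 \<le> flat_bump c k y" by (simp add: flat_bump_def)
lemma flat_bump_le_one: "0 < c \<Longrightarrow> flat_bump c 0 y \<le> 1" by (simp add: flat_bump_def)

lemma box_bump_bounds: "0 \<le> box_bump l u n x" "box_bump l u n x \<le> 1"
  unfolding box_bump_def
  by (auto intro!: prod_nonneg prod_le_1 mult_nonneg_nonneg mult_le_one flat_bump_nonneg flat_bump_le_one)

lemma box_bump_eq_0: "x \<notin> box l u \<Longrightarrow> box_bump l u n x = 0"
proof -
  assume "x \<notin> box l u"
  then obtain b where "b \<in> Basis" "\<not> (l \<bullet> b < x \<bullet> b \<and> x \<bullet> b < u \<bullet> b)"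
    by (auto simp: mem_box)
  then show ?thesis
    unfolding box_bump_def by (intro prod_zero) (auto simp: flat_bump_def intro!: bexI[of _ b])
qed

text \<open>On the box every factor is \<open>exp (-1/((n+1) y))\<close> with a fixed \<open>y > 0\<close>, and off the box
some factor vanishes.\<close>

lemma box_bump_tendsto: "(\<lambda>n. box_bump l u n x) \<longlonglongrightarrow> indicator (box l u) x"
proof (cases "x \<in> box l u")
  case True
  have "(\<lambda>n. flat_bump (1 / Suc n) 0 y) \<longlonglongrightarrow> 1" if "0 < y" for y
  proof -
    have "(\<lambda>n. exp (- ((1 / real (Suc n)) / y))) \<longlonglongrightarrow> exp (- (0 / y))"
      by (intro tendsto_intros LIMSEQ_Suc[OF lim_1_over_n] ) (use that in auto)
    then show ?thesis using that by (simp add: flat_bump_def)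
  qed
  then have "(\<lambda>n. box_bump l u n x) \<longlonglongrightarrow> (\<Prod>b\<in>(Basis::'a set). 1 * 1)"
    unfolding box_bump_def using True by (intro tendsto_intros) (auto simp: mem_box)
  then show ?thesis using True by simp
qed (simp add: box_bump_eq_0)

lemma box_bump_test_function:
  assumes "cbox l u \<subseteq> U"
  shows "box_bump l u n \<in> Cc_smooth U U"
proof -
  have "closure {x \<in> closure U. box_bump l u n x \<noteq> 0} \<subseteq> cbox l u"
  proof (rule closure_minimal)
    show "{x \<in> closure U. box_bump l u n x \<noteq> 0} \<subseteq> cbox l u"
      using box_bump_eq_0[of _ l u n] box_subset_cbox[of l u] by auto
  qed (rule closed_cbox)
  moreover from this have "compact (closure {x \<in> closure U. box_bump l u n x \<noteq> 0})"
    by (meson bounded_cbox bounded_subset closed_closure compact_eq_bounded_closed)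
  ultimately show ?thesis
    using assms by (auto simp: Cc_smooth_def box_bump_smooth Let_def)
qed

text \<open>Boxes form an intersection-stable generator of the Borel sets, so the integral of \<open>h\<close> over
every Borel set vanishes.\<close>

lemma AE_zero_of_box_integrals:
  fixes h :: "'a::euclidean_space \<Rightarrow> real"
  assumes h: "integrable lebesgue h"
    and box: "\<And>l u. (LINT x|lebesgue. indicator (box l u) x *\<^sub>R h x) = 0"
  shows "AE x in lebesgue. h x = 0"
proof -
  have "set_lebesgue_integral lborel A h' = 0" if h': "integrable lborel h'" and A: "A \<in> sets lborel"
     and box': "\<And>l u. (LINT x|lborel. indicator (box l u) x *\<^sub>R h' x) = 0"
    for A and h' :: "'a \<Rightarrow> real"
  proof -
    have [measurable]: "h' \<in> borel_measurable borel" using h' by auto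
    have int: "set_integrable lborel B h'" if "B \<in> sets borel" for B
      using h' that integrable_mult_indicator[of B lborel h'] by (simp add: set_integrable_def)
    have total: "(LINT x:UNIV|lborel. h' x) = 0"
    proof -
      let ?A = "\<lambda>n::nat. box (- (real n *\<^sub>R One)) (real n *\<^sub>R One) :: 'a set"
      have "(\<lambda>n. LINT x:?A n|lborel. h' x) \<longlonglongrightarrow> (LINT x:(\<Union>i. ?A i)|lborel. h' x)"
        by (intro set_integral_cont_up incseq_SucI subset_box_imp)
           (auto intro: int simp: inner_sum_left_Basis)
      then show ?thesis
        unfolding UN_box_eq_UNIV using box' by (simp add: set_lebesgue_integral_def LIMSEQ_const_iff)
    qed
    have "Int_stable (range (\<lambda>(a, b). box a b :: 'a set))"
      by (auto simp: Int_stable_def box_Int_box)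
    moreover have "(range (\<lambda>(a, b). box a b :: 'a set)) \<subseteq> Pow UNIV" by auto
    moreover have "A \<in> sigma_sets UNIV (range (\<lambda>(a, b). box a b :: 'a set))"
      using A unfolding sets_lborel borel_eq_box by simp
    ultimately show ?thesis
    proof (induction rule: sigma_sets_induct_disjoint)
      case (basic A)
      then show ?case using box' by (auto simp: set_lebesgue_integral_def)
    next
      case empty then show ?case by (simp add: set_lebesgue_integral_def)
    next
      case (compl A)
      then have [measurable]: "A \<in> sets borel" by (simp add: borel_eq_box)
      have "(LINT x:UNIV|lborel. h' x) = (LINT x:A \<union> (UNIV - A)|lborel. h' x)" by simp
      also have "\<dots> = (LINT x:A|lborel. h' x) + (LINT x:UNIV - A|lborel. h' x)"
        by (intro set_integral_Un int) auto
      finally show ?case using compl total by simp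
    next
      case (union F)
      then have [measurable]: "\<And>i. F i \<in> sets borel" by (simp add: borel_eq_box subset_eq)
      have "(LINT x:(\<Union>i. F i)|lborel. h' x) = (\<Sum>i. (LINT x:F i|lborel. h' x))"
        using union by (intro lebesgue_integral_countable_add int) (auto simp: disjoint_family_on_def)
      then show ?case using union by simp
    qed
  qed note * = this
  have hm: "h \<in> borel_measurable (completion lborel)" using h by (rule borel_measurable_integrable)
  from completion_ex_borel_measurable_real[OF hm] obtain h' where
    h'[measurable]: "h' \<in> borel_measurable lborel" and ae: "AE x in lborel. h x = h' x" by blast
  have ae': "AE x in lebesgue. h x = h' x" using ae by (rule AE_completion)
  have "integrable lebesgue h'"
    using h integrable_cong_AE[OF _ _ ae'] hm measurable_completion[OF h'] by simp
  then have i: "integrable lborel h'" by (simp add: integrable_completion)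
  have "AE x in lborel. h' x = 0"
  proof (rule density_unique_real[OF i integrable_zero])
    fix A :: "'a set" assume A: "A \<in> sets lborel"
    have "set_lebesgue_integral lborel A h' = 0"
    proof (rule *[OF i A])
      fix l u :: 'a
      have "(LINT x|lborel. indicator (box l u) x *\<^sub>R h' x) = (LINT x|lebesgue. indicator (box l u) x *\<^sub>R h' x)"
        by (intro integral_completion[symmetric]) auto
      also have "\<dots> = (LINT x|lebesgue. indicator (box l u) x *\<^sub>R h x)"
        by (intro integral_cong_AE borel_measurable_scaleR borel_measurable_indicator)
           (use ae' hm measurable_completion[OF h'] in \<open>auto elim: eventually_mono\<close>)
      finally show "(LINT x|lborel. indicator (box l u) x *\<^sub>R h' x) = 0" using box by simp
    qed
    then show "(LINT x:A|lborel. h' x) = (LINT x:A|lborel. 0)"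
      by (simp add: set_lebesgue_integral_def)
  qed
  then have "AE x in lebesgue. h' x = 0" by (rule AE_completion)
  with ae' show ?thesis by eventually_elim simp
qed

section \<open>Weak gradients\<close>

text \<open>The bump functions of a box are test functions with values in \<open>[0,1]\<close> that converge pointwise to
its indicator, so dominated convergence applies.\<close>

lemma L1_loc_box_integral_zero:
  fixes h :: "'a::euclidean_space \<Rightarrow> real"
  assumes U: "open U" and h: "L1_loc U h"
    and test: "\<And>f. f \<in> Cc_smooth U U \<Longrightarrow> (LINT x|lebesgue_on U. h x * f x) = 0"
    and sub: "cbox l u \<subseteq> U"
  shows "(LINT x|lebesgue. indicator (box l u) x *\<^sub>R h x) = 0"
proof -
  let ?k = "\<lambda>x. indicator (cbox l u) x *\<^sub>R h x"
  have k: "integrable lebesgue ?k"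
    using h sub by (auto simp: L1_loc_def set_integrable_def)
  have Um: "U \<inter> space lebesgue \<in> sets lebesgue" using U by auto
  have bm: "box_bump l u n \<in> borel_measurable lebesgue" for n
    using box_bump_smooth[of UNIV l u n]
    by (intro measurable_completion) (simp add: smooth_upto_def borel_measurable_continuous_onI)
  have "(LINT x|lebesgue. ?k x * box_bump l u n x) = 0" for n
  proof -
    have "(LINT x|lebesgue. ?k x * box_bump l u n x)
        = (LINT x|lebesgue. indicator U x *\<^sub>R (h x * box_bump l u n x))"
      using sub box_subset_cbox[of l u]
      by (intro Bochner_Integration.integral_cong refl) (auto simp: indicator_def intro!: box_bump_eq_0)
    also have "\<dots> = 0"
      using test[OF box_bump_test_function[OF sub]] integral_restrict_space[OF Um] by metis
    finally show ?thesis .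
  qed
  moreover have "(\<lambda>n. LINT x|lebesgue. ?k x * box_bump l u n x) \<longlonglongrightarrow>
      (LINT x|lebesgue. indicator (box l u) x *\<^sub>R h x)"
  proof (rule integral_dominated_convergence[where w = "\<lambda>x. norm (?k x)"])
    have "(\<lambda>x. indicator (box l u) x *\<^sub>R ?k x) \<in> borel_measurable lebesgue"
      by (intro borel_measurable_scaleR borel_measurable_indicator borel_measurable_integrable[OF k]) auto
    also have "(\<lambda>x. indicator (box l u) x *\<^sub>R ?k x) = (\<lambda>x. indicator (box l u) x *\<^sub>R h x)"
      using box_subset_cbox[of l u] by (auto simp: fun_eq_iff indicator_def)
    finally show "(\<lambda>x. indicator (box l u) x *\<^sub>R h x) \<in> borel_measurable lebesgue" .
    show "(\<lambda>x. ?k x * box_bump l u n x) \<in> borel_measurable lebesgue" for n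
      by (intro borel_measurable_times borel_measurable_integrable[OF k] bm)
    show "integrable lebesgue (\<lambda>x. norm (?k x))" using k by simp
    show "AE x in lebesgue. (\<lambda>n. ?k x * box_bump l u n x) \<longlonglongrightarrow> indicator (box l u) x *\<^sub>R h x"
    proof (rule AE_I2)
      fix x
      have "(\<lambda>n. ?k x * box_bump l u n x) \<longlonglongrightarrow> ?k x * indicator (box l u) x"
        by (intro tendsto_intros box_bump_tendsto)
      then show "(\<lambda>n. ?k x * box_bump l u n x) \<longlonglongrightarrow> indicator (box l u) x *\<^sub>R h x"
        using box_subset_cbox[of l u] by (auto simp: indicator_def split: if_splits)
    qed
    show "AE x in lebesgue. norm (?k x * box_bump l u n x) \<le> norm (?k x)" for n
      using box_bump_bounds[of l u n]
      by (intro AE_I2) (auto simp: abs_mult intro!: mult_left_le)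
  qed
  ultimately show ?thesis by (simp add: LIMSEQ_const_iff)
qed

text \<open>The fundamental lemma of the calculus of variations. The set \<open>U\<close> is covered by countably many
closed boxes; on each of them the previous lemma determines all integrals over subboxes.\<close>

lemma L1_loc_AE_zero:
  fixes h :: "'a::euclidean_space \<Rightarrow> real"
  assumes U: "open U" and h: "L1_loc U h"
    and test: "\<And>f. f \<in> Cc_smooth U U \<Longrightarrow> (LINT x|lebesgue_on U. h x * f x) = 0"
  shows "AE x in lebesgue_on U. h x = 0"
proof -
  have loc: "AE x in lebesgue. x \<in> cbox l u \<longrightarrow> h x = 0" if sub: "cbox l u \<subseteq> U" for l u
  proof -
    let ?k = "\<lambda>x. indicator (box l u) x *\<^sub>R h x"
    have "integrable lebesgue (\<lambda>x. indicator (cbox l u) x *\<^sub>R h x)"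
      using h sub by (auto simp: L1_loc_def set_integrable_def)
    then have "integrable lebesgue (\<lambda>x. indicator (box l u) x *\<^sub>R indicator (cbox l u) x *\<^sub>R h x)"
      by (rule integrable_mult_indicator[rotated]) auto
    also have "(\<lambda>x. indicator (box l u) x *\<^sub>R indicator (cbox l u) x *\<^sub>R h x) = ?k"
      using box_subset_cbox[of l u] by (auto simp: fun_eq_iff indicator_def)
    finally have "integrable lebesgue ?k" .
    then have "AE x in lebesgue. ?k x = 0"
    proof (rule AE_zero_of_box_integrals)
      fix l' u' :: 'a
      obtain a b where ab: "box l' u' \<inter> box l u = box a b"
        using box_Int_box[of l' u' l u] by blast
      have "(LINT x|lebesgue. indicator (box l' u') x *\<^sub>R ?k x) = (LINT x|lebesgue. indicator (box a b) x *\<^sub>R h x)"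
        unfolding ab[symmetric] by (intro Bochner_Integration.integral_cong) (auto simp: indicator_def)
      also have "\<dots> = 0"
      proof (cases "box a b = {}")
        case False
        have "cbox a b = closure (box a b)" using False by simp
        also have "\<dots> \<subseteq> cbox l u"
          using ab box_subset_cbox[of l u] by (intro closure_minimal) auto
        finally have "cbox a b \<subseteq> U" using sub by blast
        then show ?thesis by (intro L1_loc_box_integral_zero[OF U h test])
      qed simp
      finally show "(LINT x|lebesgue. indicator (box l' u') x *\<^sub>R ?k x) = 0" .
    qed
    moreover have "AE x in lebesgue. x \<notin> cbox l u - box l u"
      using negligible_frontier_interval negligible_iff_null_sets AE_not_in by blast
    ultimately show ?thesis by eventually_elim auto
  qed
  obtain \<D> where D: "countable \<D>" "\<D> \<subseteq> Pow U" "\<And>X. X \<in> \<D> \<Longrightarrow> \<exists>a b. X = cbox a b" "\<Union>\<D> = U"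
    using open_countable_Union_open_cbox[OF U] by metis
  have "AE x in lebesgue. \<forall>X\<in>\<D>. x \<in> X \<longrightarrow> h x = 0"
    using D(1)
  proof (rule AE_ball_countable'[rotated])
    fix X assume X: "X \<in> \<D>"
    then obtain a b where "X = cbox a b" using D(3) by blast
    with X D(2) loc[of a b] show "AE x in lebesgue. x \<in> X \<longrightarrow> h x = 0" by blast
  qed
  then have "AE x in lebesgue. x \<in> U \<longrightarrow> h x = 0"
    using D(4) by (auto elim: eventually_mono)
  then show ?thesis
    using U by (subst AE_restrict_space_iff) auto
qed

text \<open>A test function is unconstrained off the closure of \<open>U\<close>. Therefore all statements about its
support are restricted to \<open>U\<close>.\<close>

lemma test_function_support:
  fixes f :: "'a::euclidean_space \<Rightarrow> real"
  assumes U: "open U" and f: "f \<in> Cc_smooth U U"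
  obtains K where "compact K" "K \<subseteq> U" "\<And>x. x \<in> U - K \<Longrightarrow> f x = 0"
    "\<And>x b. x \<in> U - K \<Longrightarrow> frechet_derivative f (at x) b = 0"
proof -
  define K where "K = closure {x \<in> closure U. f x \<noteq> 0}"
  have K: "compact K" "K \<subseteq> U" using f by (auto simp: Cc_smooth_def K_def Let_def)
  have z: "f x = 0" if "x \<in> U - K" for x
    using that closure_subset[of "{x \<in> closure U. f x \<noteq> 0}"] closure_subset[of U]
    unfolding K_def by auto
  have "frechet_derivative f (at x) b = 0" if x: "x \<in> U - K" for x b
  proof -
    have o: "open (U - K)" using U K by (simp add: compact_imp_closed open_Diff)
    have "((\<lambda>_. 0) has_derivative (\<lambda>_. 0)) (at x)" by simp
    then have "(f has_derivative (\<lambda>_. 0)) (at x)"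
      by (rule has_derivative_transform_within_open[OF _ o x]) (simp add: z)
    then show ?thesis by (simp only: frechet_derivative_at[symmetric])
  qed
  with K z that show ?thesis by blast
qed

lemma smooth_upto_differentiable:
  assumes "smooth_upto U f" "x \<in> U" shows "f differentiable (at x)"
  using assms(1)[unfolded smooth_upto_def, THEN conjunct2, THEN spec[of _ "[]"]] assms(2) by simp

lemma smooth_upto_continuous_on: "smooth_upto U f \<Longrightarrow> continuous_on U f"
  by (meson closure_subset continuous_on_subset smooth_upto_def)

lemma smooth_upto_continuous_partial:
  assumes f: "smooth_upto U f" and b: "b \<in> Basis"
  shows "continuous_on U (\<lambda>x. frechet_derivative f (at x) b)"
proof -
  obtain g where "continuous_on (closure U) g" "\<forall>x\<in>U. g x = frechet_derivative f (at x) b"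
    using f[unfolded smooth_upto_def, THEN conjunct2, THEN spec[of _ "[b]"]] b by auto
  then show ?thesis
    using continuous_on_subset[OF _ closure_subset, of U g] by (simp cong: continuous_on_cong)
qed

lemma L1_loc_mult_integrable:
  fixes h F :: "'a::euclidean_space \<Rightarrow> real"
  assumes U: "open U" and h: "L1_loc U h" and F: "continuous_on U F"
    and K: "compact K" "K \<subseteq> U" and 0: "\<And>x. x \<in> U - K \<Longrightarrow> F x = 0"
  shows "integrable (lebesgue_on U) (\<lambda>x. h x * F x)"
proof -
  have cK: "continuous_on K F" using F K(2) by (rule continuous_on_subset)
  then have "bounded (F ` K)" using K(1) by (intro compact_imp_bounded compact_continuous_image)
  then obtain B where B: "\<And>x. x \<in> K \<Longrightarrow> \<bar>F x\<bar> \<le> B" by (auto simp: bounded_iff)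
  have k: "integrable lebesgue (\<lambda>x. indicator K x *\<^sub>R h x)"
    using h K by (auto simp: L1_loc_def set_integrable_def)
  have m: "(\<lambda>x. indicator K x *\<^sub>R F x) \<in> borel_measurable lebesgue"
    using K(1) borel_measurable_continuous_on_indicator[OF _ cK]
    by (intro measurable_completion) (simp add: compact_imp_closed)
  have "integrable lebesgue (\<lambda>x. indicator K x *\<^sub>R h x * (indicator K x *\<^sub>R F x))"
  proof (rule Bochner_Integration.integrable_bound[OF integrable_mult_right[OF k, of B]])
    show "(\<lambda>x. indicator K x *\<^sub>R h x * (indicator K x *\<^sub>R F x)) \<in> borel_measurable lebesgue"
      by (intro borel_measurable_times m borel_measurable_integrable[OF k])
    have "\<bar>h x\<bar> * \<bar>F x\<bar> \<le> \<bar>B\<bar> * \<bar>h x\<bar>" if "x \<in> K" for x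
      using B[OF that] mult_right_mono[of "\<bar>F x\<bar>" "\<bar>B\<bar>" "\<bar>h x\<bar>"] by (simp add: mult.commute)
    then show "AE x in lebesgue. norm (indicator K x *\<^sub>R h x * (indicator K x *\<^sub>R F x)) \<le> norm (B * (indicator K x *\<^sub>R h x))"
      by (intro AE_I2) (auto simp: indicator_def abs_mult)
  qed
  also have "(\<lambda>x. indicator K x *\<^sub>R h x * (indicator K x *\<^sub>R F x)) = (\<lambda>x. indicator U x *\<^sub>R (h x * F x))"
    using K(2) 0 by (auto simp: fun_eq_iff indicator_def)
  finally show ?thesis
    using U by (subst integrable_restrict_space) auto
qed

lemma L1_loc_inner:
  assumes "L1_loc U g" shows "L1_loc U (\<lambda>x. g x \<bullet> b)"
proof -
  have "set_integrable lebesgue K (\<lambda>x. g x \<bullet> b)" if "set_integrable lebesgue K g" for K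
    using integrable_inner_left[OF that[unfolded set_integrable_def], of b] by (auto simp: set_integrable_def)
  then show ?thesis using assms unfolding L1_loc_def by (auto intro: borel_measurable_inner)
qed

lemma L1_loc_add: "L1_loc U f \<Longrightarrow> L1_loc U g \<Longrightarrow> L1_loc U (\<lambda>x. f x + g x)"
  unfolding L1_loc_def by (auto intro: set_integral_add)

lemma L1_loc_scaleR: "L1_loc U f \<Longrightarrow> L1_loc U (\<lambda>x. c *\<^sub>R f x)"
  unfolding L1_loc_def by (auto intro!: borel_measurable_scaleR set_integrable_scaleR_right)

lemma L1_loc_continuous_on:
  fixes f :: "'a::euclidean_space \<Rightarrow> 'b::euclidean_space"
  assumes "open U" "continuous_on U f" shows "L1_loc U f"
  unfolding L1_loc_def
proof (intro conjI allI impI)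
  show "f \<in> borel_measurable (lebesgue_on U)"
    using assms by (intro continuous_imp_measurable_on_sets_lebesgue) auto
  fix K assume "compact K \<and> K \<subseteq> U"
  then have "integrable lborel (\<lambda>x. indicator K x *\<^sub>R f x)"
    using assms by (intro borel_integrable_compact) (auto intro: continuous_on_subset)
  then show "set_integrable lebesgue K f"
    unfolding set_integrable_def using integrable_completion[of "\<lambda>x. indicator K x *\<^sub>R f x" lborel] by auto
qed

lemma test_function_integrable:
  assumes U: "open U" and f: "f \<in> Cc_smooth U U" and h: "L1_loc U (h :: 'a::euclidean_space \<Rightarrow> real)"
  shows "integrable (lebesgue_on U) (\<lambda>x. h x * f x)"
    and "b \<in> Basis \<Longrightarrow> integrable (lebesgue_on U) (\<lambda>x. h x * frechet_derivative f (at x) b)"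
proof -
  have sm: "smooth_upto U f" using f by (simp add: Cc_smooth_def)
  obtain K where K: "compact K" "K \<subseteq> U" "\<And>x. x \<in> U - K \<Longrightarrow> f x = 0"
    "\<And>x b. x \<in> U - K \<Longrightarrow> frechet_derivative f (at x) b = 0"
    using test_function_support[OF U f] by metis
  show "integrable (lebesgue_on U) (\<lambda>x. h x * f x)"
    using K by (intro L1_loc_mult_integrable[OF U h smooth_upto_continuous_on[OF sm], of K]) auto
  show "integrable (lebesgue_on U) (\<lambda>x. h x * frechet_derivative f (at x) b)" if "b \<in> Basis"
    using K by (intro L1_loc_mult_integrable[OF U h smooth_upto_continuous_partial[OF sm that], of K]) auto
qed

lemma is_weak_gradient_lincomb:
  assumes U: "open U" and u: "is_weak_gradient U u g" and v: "is_weak_gradient U v h"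
  shows "is_weak_gradient U (\<lambda>x. u x + c * v x) (\<lambda>x. g x + c *\<^sub>R h x)"
  unfolding is_weak_gradient_def
proof (intro conjI ballI)
  have L: "L1_loc U u" "L1_loc U v" "L1_loc U g" "L1_loc U h"
    using u v by (auto simp: is_weak_gradient_def)
  show "L1_loc U (\<lambda>x. u x + c * v x)" "L1_loc U (\<lambda>x. g x + c *\<^sub>R h x)"
    using L1_loc_add[OF L(1) L1_loc_scaleR[OF L(2), of c]] L1_loc_add[OF L(3) L1_loc_scaleR[OF L(4), of c]] by simp_all
  fix f b assume f: "f \<in> Cc_smooth U U" and b: "b \<in> (Basis :: 'a set)"
  let ?d = "\<lambda>x. frechet_derivative f (at x) b"
  have "(LINT x|lebesgue_on U. (u x + c * v x) * ?d x) =
      (LINT x|lebesgue_on U. u x * ?d x) + c * (LINT x|lebesgue_on U. v x * ?d x)"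
    using test_function_integrable(2)[OF U f L(1) b] test_function_integrable(2)[OF U f L(2) b]
    by (simp add: distrib_right mult.assoc)
  also have "\<dots> = - ((LINT x|lebesgue_on U. (g x \<bullet> b) * f x) + c * (LINT x|lebesgue_on U. (h x \<bullet> b) * f x))"
    using u v f b by (simp add: is_weak_gradient_def)
  also have "\<dots> = - (LINT x|lebesgue_on U. ((g x + c *\<^sub>R h x) \<bullet> b) * f x)"
    using test_function_integrable(1)[OF U f L1_loc_inner[OF L(3), of b]] test_function_integrable(1)[OF U f L1_loc_inner[OF L(4), of b]]
    by (simp add: inner_add_left distrib_right mult.assoc)
  finally show "(LINT x|lebesgue_on U. (u x + c * v x) * ?d x) = - (LINT x|lebesgue_on U. ((g x + c *\<^sub>R h x) \<bullet> b) * f x)" .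
qed

text \<open>Apply the fundamental lemma to the components of the difference, which is a weak gradient of \<open>0\<close>.\<close>

lemma is_weak_gradient_unique:
  assumes U: "open U" and g: "is_weak_gradient U u g" and h: "is_weak_gradient U u h"
  shows "AE x in lebesgue_on U. g x = h x"
proof -
  have w: "is_weak_gradient U (\<lambda>x. u x + (-1) * u x) (\<lambda>x. g x + (-1) *\<^sub>R h x)"
    by (rule is_weak_gradient_lincomb[OF U g h])
  have "AE x in lebesgue_on U. (g x + (-1) *\<^sub>R h x) \<bullet> b = 0" if b: "b \<in> Basis" for b
  proof (rule L1_loc_AE_zero[OF U])
    show "L1_loc U (\<lambda>x. (g x + (-1) *\<^sub>R h x) \<bullet> b)"
      using w by (intro L1_loc_inner) (auto simp: is_weak_gradient_def)
    fix f assume "f \<in> Cc_smooth U U"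
    with w b have "(LINT x|lebesgue_on U. (u x + (-1) * u x) * frechet_derivative f (at x) b) =
       - (LINT x|lebesgue_on U. ((g x + (-1) *\<^sub>R h x) \<bullet> b) * f x)"
      unfolding is_weak_gradient_def by blast
    then show "(LINT x|lebesgue_on U. ((g x + (-1) *\<^sub>R h x) \<bullet> b) * f x) = 0" by simp
  qed
  then have "AE x in lebesgue_on U. \<forall>b\<in>Basis. (g x + (-1) *\<^sub>R h x) \<bullet> b = 0"
    by (intro AE_finite_allI) auto
  then show ?thesis
    by eventually_elim (auto simp: euclidean_eq_iff[of "g _"] inner_diff_left)
qed

lemma is_weak_gradient_cong_AE:
  assumes v: "L1_loc U v" and eq: "AE x in lebesgue_on U. u x = v x" and u: "is_weak_gradient U u g"
    and U: "open U"
  shows "is_weak_gradient U v g"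
  unfolding is_weak_gradient_def
proof (intro conjI ballI)
  have Lu: "L1_loc U u" using u by (simp add: is_weak_gradient_def)
  show "L1_loc U v" "L1_loc U g" using u v by (auto simp: is_weak_gradient_def)
  fix f b assume f: "f \<in> Cc_smooth U U" and b: "b \<in> (Basis :: 'a set)"
  have "(LINT x|lebesgue_on U. v x * frechet_derivative f (at x) b) = (LINT x|lebesgue_on U. u x * frechet_derivative f (at x) b)"
    using eq
    by (intro integral_cong_AE borel_measurable_integrable[OF test_function_integrable(2)[OF U f v b]]
        borel_measurable_integrable[OF test_function_integrable(2)[OF U f Lu b]]) (auto elim: eventually_mono)
  then show "(LINT x|lebesgue_on U. v x * frechet_derivative f (at x) b) = - (LINT x|lebesgue_on U. (g x \<bullet> b) * f x)"
    using u f b by (simp add: is_weak_gradient_def)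
qed

text \<open>Translation invariance makes the integral of each difference quotient of \<open>h\<close> vanish. The
quotients are bounded by the mean value theorem and have a common bounded support, so dominated
convergence gives the derivative.\<close>

lemma integral_directional_derivative_zero:
  fixes h H :: "'a::euclidean_space \<Rightarrow> real"
  assumes d: "\<And>x. (h has_derivative D x) (at x)" and H: "\<And>x. H x = D x b"
    and K: "bounded K" and h0: "\<And>x. x \<notin> K \<Longrightarrow> h x = 0"
    and B: "\<And>x. \<bar>H x\<bar> \<le> B"
  shows "(LINT x|lborel. H x) = 0"
proof -
  define t where "t n = 1 / real (Suc n)" for n
  have t: "0 < t n" "t n \<le> 1" "t \<longlonglongrightarrow> 0" for n
    using LIMSEQ_Suc[OF lim_1_over_n] by (auto simp: t_def[abs_def])
  define q where "q n x = (h (t n *\<^sub>R b + x) - h x) / t n" for n x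
  have hc: "continuous_on A h" for A
    using has_derivative_continuous[OF d] by (simp add: continuous_at_imp_continuous_on)
  then have [measurable]: "h \<in> borel_measurable borel" by (intro borel_measurable_continuous_onI)
  have dt: "((\<lambda>s. h (x + s *\<^sub>R b)) has_real_derivative H (x + s *\<^sub>R b)) (at s)" for x s
  proof -
    have "((h \<circ> (\<lambda>s. x + s *\<^sub>R b)) has_derivative D (x + s *\<^sub>R b) \<circ> (\<lambda>s. s *\<^sub>R b)) (at s)"
      using d by (intro diff_chain_at) (auto intro!: derivative_eq_intros)
    moreover have "D (x + s *\<^sub>R b) \<circ> (\<lambda>s. s *\<^sub>R b) = (*) (H (x + s *\<^sub>R b))"
      using has_derivative_linear[OF d] by (auto simp: fun_eq_iff H linear_cmul)
    ultimately show ?thesis by (simp add: has_field_derivative_def o_def)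
  qed
  have lim: "(\<lambda>n. q n x) \<longlonglongrightarrow> H x" for x
  proof -
    have "((\<lambda>s. (h (x + s *\<^sub>R b) - h x) / s) \<longlongrightarrow> H x) (at 0)"
      using dt[of x 0] by (simp add: has_field_derivative_iff)
    moreover have "filterlim t (at 0) sequentially"
      using t(3) by (auto simp: filterlim_at t_def)
    ultimately have "((\<lambda>n. (h (x + t n *\<^sub>R b) - h x) / t n) \<longlonglongrightarrow> H x)"
      by (rule filterlim_compose)
    then show ?thesis by (simp add: q_def add.commute)
  qed
  have qB: "\<bar>q n x\<bar> \<le> B" for n x
  proof -
    obtain z where "h (x + t n *\<^sub>R b) - h (x + 0 *\<^sub>R b) = (t n - 0) * H (x + z *\<^sub>R b)"
      using MVT2[of 0 "t n" "\<lambda>s. h (x + s *\<^sub>R b)" "\<lambda>s. H (x + s *\<^sub>R b)"] dt t(1) by blast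
    then have "q n x = H (x + z *\<^sub>R b)" using t(1)[of n] by (simp add: q_def add.commute)
    then show ?thesis using B by simp
  qed
  obtain R where R: "\<And>x. x \<in> K \<Longrightarrow> norm x \<le> R" using K by (auto simp: bounded_iff)
  define C where "C = cball (0::'a) (R + norm b)"
  have q0: "q n x = 0" if "x \<notin> C" for n x
  proof -
    have x: "R + norm b < norm x" using that by (simp add: C_def)
    have "norm x \<le> norm (t n *\<^sub>R b + x) + norm (t n *\<^sub>R b)"
      using norm_triangle_ineq4[of "t n *\<^sub>R b + x" "t n *\<^sub>R b"] by simp
    also have "norm (t n *\<^sub>R b) \<le> norm b" using t(1,2)[of n] by (simp add: mult_left_le_one_le)
    finally have "\<not> norm (t n *\<^sub>R b + x) \<le> R" "\<not> norm x \<le> R" using x norm_ge_zero[of b] by linarith+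
    then have "t n *\<^sub>R b + x \<notin> K" "x \<notin> K" using R by blast+
    then show ?thesis by (simp add: q_def h0)
  qed
  have hi: "integrable lborel h"
  proof -
    have "h = (\<lambda>x. indicator (cball 0 R) x *\<^sub>R h x)" using R h0 by (auto simp: fun_eq_iff indicator_def)
    moreover have "integrable lborel (\<lambda>x. indicator (cball 0 R) x *\<^sub>R h x)"
      using hc by (intro borel_integrable_compact) auto
    ultimately show ?thesis by simp
  qed
  have "(LINT x|lborel. q n x) = 0" for n
  proof -
    have "(LINT x|lborel. h x) = (LINT x|distr lborel borel ((+) (t n *\<^sub>R b)). h x)"
      by (simp add: lborel_distr_plus)
    also have "\<dots> = (LINT x|lborel. h (t n *\<^sub>R b + x))" by (subst integral_distr) auto
    finally have 1: "(LINT x|lborel. h (t n *\<^sub>R b + x)) = (LINT x|lborel. h x)" ..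
    have "integrable (distr lborel borel ((+) (t n *\<^sub>R b))) h" using hi by (simp add: lborel_distr_plus)
    then have "integrable lborel (\<lambda>x. h (t n *\<^sub>R b + x))" by (subst (asm) integrable_distr_eq) auto
    then show ?thesis using hi 1 by (simp add: q_def)
  qed
  moreover have "(\<lambda>n. LINT x|lborel. q n x) \<longlonglongrightarrow> (LINT x|lborel. H x)"
  proof (rule integral_dominated_convergence[where w = "\<lambda>x. indicator C x *\<^sub>R B"])
    show "q n \<in> borel_measurable lborel" for n unfolding q_def[abs_def] by measurable
    then show "H \<in> borel_measurable lborel" using lim by (intro borel_measurable_LIMSEQ_real[of lborel q H]) auto
    show "integrable lborel (\<lambda>x. indicator C x *\<^sub>R B)"
      unfolding C_def by (intro borel_integrable_compact) auto
    show "AE x in lborel. norm (q n x) \<le> indicator C x *\<^sub>R B" for n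
      using qB q0 by (intro AE_I2) (auto simp: indicator_def)
  qed (use lim in auto)
  ultimately show ?thesis by (simp add: LIMSEQ_const_iff)
qed

definition classical_gradient :: "('a::euclidean_space \<Rightarrow> real) \<Rightarrow> 'a \<Rightarrow> 'a" where
  "classical_gradient f x = (\<Sum>b\<in>Basis. frechet_derivative f (at x) b *\<^sub>R b)"

lemma classical_gradient_inner_Basis:
  "b \<in> Basis \<Longrightarrow> classical_gradient f x \<bullet> b = frechet_derivative f (at x) b"
  by (simp add: classical_gradient_def inner_sum_left inner_Basis if_distrib cong: if_cong)

lemma classical_gradient_inner:
  assumes "f differentiable (at x)"
  shows "frechet_derivative f (at x) v = classical_gradient f x \<bullet> v"
proof -
  have "linear (frechet_derivative f (at x))" using assms by (rule linear_frechet_derivative)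
  then have "frechet_derivative f (at x) (\<Sum>b\<in>Basis. (v \<bullet> b) *\<^sub>R b) = (\<Sum>b\<in>Basis. (v \<bullet> b) * frechet_derivative f (at x) b)"
    by (simp add: linear_sum linear_cmul)
  also have "\<dots> = classical_gradient f x \<bullet> v"
    unfolding classical_gradient_def inner_sum_left
    by (intro sum.cong) (simp_all add: inner_commute mult.commute)
  finally show ?thesis by (simp add: euclidean_representation)
qed

lemma classical_gradient_continuous_on:
  "smooth_upto U f \<Longrightarrow> continuous_on U (classical_gradient f)"
  unfolding classical_gradient_def[abs_def]
  by (intro continuous_intros smooth_upto_continuous_partial)

text \<open>Integration by parts: \<open>f g\<close>, extended by zero, is differentiable on the whole space because
the support of \<open>g\<close> in \<open>U\<close> is compact, and the integral of each of its partial derivatives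
is zero.\<close>

lemma is_weak_gradient_classical:
  assumes U: "open U" and f: "smooth_upto U f"
  shows "is_weak_gradient U f (classical_gradient f)"
  unfolding is_weak_gradient_def
proof (intro conjI ballI)
  show Lf: "L1_loc U f" using smooth_upto_continuous_on[OF f] U by (rule L1_loc_continuous_on[rotated])
  show Lg: "L1_loc U (classical_gradient f)"
    using classical_gradient_continuous_on[OF f] U by (rule L1_loc_continuous_on[rotated])
  fix g b assume g: "g \<in> Cc_smooth U U" and b: "b \<in> (Basis :: 'a set)"
  have sg: "smooth_upto U g" using g by (simp add: Cc_smooth_def)
  obtain K where K: "compact K" "K \<subseteq> U" "\<And>x. x \<in> U - K \<Longrightarrow> g x = 0"
    "\<And>x b. x \<in> U - K \<Longrightarrow> frechet_derivative g (at x) b = 0"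
    using test_function_support[OF U g] by metis
  define h where "h x = (if x \<in> U then f x * g x else 0)" for x
  define D where "D x v = (if x \<in> U then f x * frechet_derivative g (at x) v + frechet_derivative f (at x) v * g x else 0)" for x v
  define H where "H x = D x b" for x
  have hd: "(h has_derivative D x) (at x)" for x
  proof (cases "x \<in> U")
    case True
    have "((\<lambda>x. f x * g x) has_derivative (\<lambda>v. f x * frechet_derivative g (at x) v + frechet_derivative f (at x) v * g x)) (at x)"
      using smooth_upto_differentiable[OF f True] smooth_upto_differentiable[OF sg True]
      by (intro has_derivative_mult) (auto simp: frechet_derivative_works)
    then have "(h has_derivative (\<lambda>v. f x * frechet_derivative g (at x) v + frechet_derivative f (at x) v * g x)) (at x)"
      by (rule has_derivative_transform_within_open[OF _ U True]) (simp add: h_def)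
    then show ?thesis using True by (simp add: D_def[abs_def])
  next
    case False
    have "((\<lambda>_. 0) has_derivative (\<lambda>_. 0)) (at x)" by simp
    moreover have "open (- K)" using K(1) by (simp add: compact_imp_closed open_Compl)
    ultimately have "(h has_derivative (\<lambda>_. 0)) (at x)"
      by (rule has_derivative_transform_within_open) (use False K(2,3) in \<open>auto simp: h_def\<close>)
    then show ?thesis using False by (simp add: D_def[abs_def])
  qed
  have H0: "H x = 0" if "x \<notin> K" for x using that K(3,4) by (auto simp: H_def D_def)
  have cH: "continuous_on K H"
  proof -
    have "continuous_on U (\<lambda>x. f x * frechet_derivative g (at x) b + frechet_derivative f (at x) b * g x)"
      using b f sg by (intro continuous_intros smooth_upto_continuous_partial smooth_upto_continuous_on)
    then have "continuous_on U H" by (simp add: H_def D_def cong: continuous_on_cong)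
    then show ?thesis using K(2) by (rule continuous_on_subset)
  qed
  then have "bounded (H ` K)" using K(1) by (intro compact_imp_bounded compact_continuous_image)
  then obtain B where B: "\<And>x. x \<in> K \<Longrightarrow> \<bar>H x\<bar> \<le> B" by (auto simp: bounded_iff)
  have "(LINT x|lborel. H x) = 0"
  proof (rule integral_directional_derivative_zero[OF hd, of H b K "\<bar>B\<bar>"])
    show "\<bar>H x\<bar> \<le> \<bar>B\<bar>" for x using B[of x] H0[of x] by (cases "x \<in> K") auto
    show "h x = 0" if "x \<notin> K" for x using that K(3) by (auto simp: h_def)
  qed (use K(1) in \<open>auto simp: H_def compact_imp_bounded\<close>)
  moreover have "H \<in> borel_measurable borel"
  proof -
    have "(\<lambda>x. indicator K x *\<^sub>R H x) \<in> borel_measurable borel"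
      using K(1) borel_measurable_continuous_on_indicator[OF _ cH] by (simp add: compact_imp_closed)
    also have "(\<lambda>x. indicator K x *\<^sub>R H x) = H" using H0 by (auto simp: fun_eq_iff indicator_def)
    finally show ?thesis .
  qed
  ultimately have "(LINT x|lebesgue. H x) = 0" by (simp add: integral_completion)
  moreover have "(LINT x|lebesgue. H x) = (LINT x|lebesgue_on U. f x * frechet_derivative g (at x) b + (classical_gradient f x \<bullet> b) * g x)"
    using U by (subst integral_restrict_space)
      (auto intro!: Bochner_Integration.integral_cong simp: H_def D_def indicator_def classical_gradient_inner_Basis b)
  moreover have "\<dots> = (LINT x|lebesgue_on U. f x * frechet_derivative g (at x) b) + (LINT x|lebesgue_on U. (classical_gradient f x \<bullet> b) * g x)"
    by (intro Bochner_Integration.integral_add test_function_integrable(2)[OF U g Lf b]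
        test_function_integrable(1)[OF U g L1_loc_inner[OF Lg, of b]])
  ultimately show "(LINT x|lebesgue_on U. f x * frechet_derivative g (at x) b) = - (LINT x|lebesgue_on U. (classical_gradient f x \<bullet> b) * g x)"
    by simp
qed

section \<open>The weighted Sobolev space\<close>

text \<open>The two claims are proved together, since the formula for one more derivative needs the derivative
of the previous formula.\<close>

lemma iter_deriv_lincomb:
  assumes U: "open U" and f: "smooth_upto U f" and g: "smooth_upto U g" and bs: "set bs \<subseteq> Basis"
  shows "x \<in> U \<Longrightarrow> iter_deriv bs (\<lambda>x. f x + c * g x) x = iter_deriv bs f x + c * iter_deriv bs g x"
    and "x \<in> U \<Longrightarrow> iter_deriv bs (\<lambda>x. f x + c * g x) differentiable (at x)"
proof -
  have df: "iter_deriv bs f differentiable (at x)" and dg: "iter_deriv bs g differentiable (at x)"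
    if "x \<in> U" "set bs \<subseteq> Basis" for x bs
    using f g that unfolding smooth_upto_def by blast+
  have eq: "\<forall>x\<in>U. iter_deriv bs (\<lambda>x. f x + c * g x) x = iter_deriv bs f x + c * iter_deriv bs g x"
    and der: "\<forall>x\<in>U. (iter_deriv bs (\<lambda>x. f x + c * g x) has_derivative
      (\<lambda>v. frechet_derivative (iter_deriv bs f) (at x) v + c * frechet_derivative (iter_deriv bs g) (at x) v)) (at x)"
    using bs
  proof (induction bs)
    case Nil
    { case 1 show ?case by simp }
    { case 2
      show ?case
      proof
        fix x assume "x \<in> U"
        with df[of x "[]"] dg[of x "[]"]
        show "(iter_deriv [] (\<lambda>x. f x + c * g x) has_derivative
          (\<lambda>v. frechet_derivative (iter_deriv [] f) (at x) v + c * frechet_derivative (iter_deriv [] g) (at x) v)) (at x)"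
          by (auto intro!: has_derivative_add has_derivative_mult_right simp: frechet_derivative_works)
      qed }
  next
    case (Cons b bs)
    have eqc: "\<forall>x\<in>U. iter_deriv (b # bs) (\<lambda>x. f x + c * g x) x = iter_deriv (b # bs) f x + c * iter_deriv (b # bs) g x"
      if 1: "set (b # bs) \<subseteq> Basis"
    proof
      fix x assume x: "x \<in> U"
      have "frechet_derivative (iter_deriv bs (\<lambda>x. f x + c * g x)) (at x) =
        (\<lambda>v. frechet_derivative (iter_deriv bs f) (at x) v + c * frechet_derivative (iter_deriv bs g) (at x) v)"
        using Cons.IH(2) 1 x by (intro frechet_derivative_at[symmetric]) auto
      then show "iter_deriv (b # bs) (\<lambda>x. f x + c * g x) x = iter_deriv (b # bs) f x + c * iter_deriv (b # bs) g x"
        by simp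
    qed
    { case 1 then show ?case by (rule eqc) }
    { case 2
      show ?case
      proof
        fix x assume x: "x \<in> U"
        have "((\<lambda>x. iter_deriv (b # bs) f x + c * iter_deriv (b # bs) g x) has_derivative
          (\<lambda>v. frechet_derivative (iter_deriv (b # bs) f) (at x) v + c * frechet_derivative (iter_deriv (b # bs) g) (at x) v)) (at x)"
          using df[OF x 2] dg[OF x 2]
          by (intro has_derivative_add has_derivative_mult_right) (simp_all only: frechet_derivative_works)
        then show "(iter_deriv (b # bs) (\<lambda>x. f x + c * g x) has_derivative
          (\<lambda>v. frechet_derivative (iter_deriv (b # bs) f) (at x) v + c * frechet_derivative (iter_deriv (b # bs) g) (at x) v)) (at x)"
          by (rule has_derivative_transform_within_open[OF _ U x]) (use eqc[OF 2] in auto)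
      qed }
  qed
  show "x \<in> U \<Longrightarrow> iter_deriv bs (\<lambda>x. f x + c * g x) x = iter_deriv bs f x + c * iter_deriv bs g x"
    using eq by blast
  show "x \<in> U \<Longrightarrow> iter_deriv bs (\<lambda>x. f x + c * g x) differentiable (at x)"
    using der differentiableI by blast
qed

lemma smooth_upto_lincomb:
  assumes U: "open U" and f: "smooth_upto U f" and g: "smooth_upto U g"
  shows "smooth_upto U (\<lambda>x. f x + c * g x)"
  unfolding smooth_upto_def
proof (intro conjI allI impI)
  show "continuous_on (closure U) (\<lambda>x. f x + c * g x)"
    using f g by (auto simp: smooth_upto_def intro!: continuous_intros)
  fix bs assume bs: "set bs \<subseteq> (Basis :: 'a set)"
  show "\<forall>x\<in>U. iter_deriv bs (\<lambda>x. f x + c * g x) differentiable at x"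
    using iter_deriv_lincomb(2)[OF U f g bs] by blast
  obtain F G where "continuous_on (closure U) F" "\<forall>x\<in>U. F x = iter_deriv bs f x"
    "continuous_on (closure U) G" "\<forall>x\<in>U. G x = iter_deriv bs g x"
    using f g bs unfolding smooth_upto_def by blast
  then show "\<exists>h. continuous_on (closure U) h \<and> (\<forall>x\<in>U. h x = iter_deriv bs (\<lambda>x. f x + c * g x) x)"
    using iter_deriv_lincomb(1)[OF U f g bs]
    by (intro exI[of _ "\<lambda>x. F x + c * G x"]) (auto intro!: continuous_intros)
qed

lemma Cc_smooth_lincomb:
  assumes U: "open U" and f: "f \<in> Cc_smooth U V" and g: "g \<in> Cc_smooth U V"
  shows "(\<lambda>x. f x + c * g x) \<in> Cc_smooth U V"
proof -
  let ?K = "\<lambda>f :: 'a \<Rightarrow> real. closure {x \<in> closure U. f x \<noteq> 0}"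
  have K: "compact (?K f \<union> ?K g)" "?K f \<union> ?K g \<subseteq> V"
    using f g by (auto simp: Cc_smooth_def Let_def)
  have sub: "?K (\<lambda>x. f x + c * g x) \<subseteq> ?K f \<union> ?K g"
    unfolding closure_Un[symmetric] by (intro closure_mono) auto
  have "compact (?K (\<lambda>x. f x + c * g x))"
    using K(1) sub by (meson bounded_subset closed_closure compact_eq_bounded_closed)
  moreover have "?K (\<lambda>x. f x + c * g x) \<subseteq> V" using sub K(2) by blast
  moreover have "smooth_upto U (\<lambda>x. f x + c * g x)"
    using f g by (intro smooth_upto_lincomb[OF U]) (auto simp: Cc_smooth_def)
  ultimately show ?thesis by (simp add: Cc_smooth_def Let_def)
qed

lemma zero_in_Cc_smooth: "(\<lambda>x. 0) \<in> Cc_smooth U V"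
  using bump_alg_smooth_upto[OF bump_alg.const, of U 0] by (simp add: Cc_smooth_def)

lemma powr_norm_add_le:
  fixes a b :: "'b::real_normed_vector"
  assumes "0 < p"
  shows "norm (a + b) powr p \<le> 2 powr p * (norm a powr p + norm b powr p)"
proof -
  have "norm (a + b) powr p \<le> (2 * max (norm a) (norm b)) powr p"
    using assms norm_triangle_ineq[of a b] by (intro powr_mono2) auto
  also have "\<dots> = 2 powr p * max (norm a) (norm b) powr p" by (simp add: powr_mult)
  also have "max (norm a) (norm b) powr p \<le> norm a powr p + norm b powr p" by (simp add: max_def)
  finally show ?thesis by simp
qed

text \<open>The constant comes from \<open>\<bar>a + b\<bar> \<le> 2 max \<bar>a\<bar> \<bar>b\<bar>\<close>.\<close>

lemma Lp_pow_lincomb_le: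
  fixes u v :: "'a::euclidean_space \<Rightarrow> 'b::{real_normed_vector}"
  assumes p: "0 < p" and [measurable]: "\<rho> \<in> borel_measurable (lebesgue_on U)"
    "u \<in> borel_measurable (lebesgue_on U)" "v \<in> borel_measurable (lebesgue_on U)"
  shows "Lp_pow p U \<rho> (\<lambda>x. u x + c *\<^sub>R v x) \<le>
    ennreal (2 powr p) * (Lp_pow p U \<rho> u + ennreal (\<bar>c\<bar> powr p) * Lp_pow p U \<rho> v)"
proof -
  have "ennreal (norm (u x + c *\<^sub>R v x) powr p * \<rho> x) \<le> ennreal (2 powr p) *
     (ennreal (norm (u x) powr p * \<rho> x) + ennreal (\<bar>c\<bar> powr p) * ennreal (norm (v x) powr p * \<rho> x))" for x
  proof -
    have "norm (u x + c *\<^sub>R v x) powr p \<le> 2 powr p * (norm (u x) powr p + norm (c *\<^sub>R v x) powr p)"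
      by (rule powr_norm_add_le[OF p])
    also have "norm (c *\<^sub>R v x) powr p = \<bar>c\<bar> powr p * norm (v x) powr p" by (simp add: powr_mult)
    finally have "ennreal (norm (u x + c *\<^sub>R v x) powr p) * ennreal (\<rho> x) \<le>
      ennreal (2 powr p * (norm (u x) powr p + \<bar>c\<bar> powr p * norm (v x) powr p)) * ennreal (\<rho> x)"
      by (intro mult_right_mono ennreal_leI) auto
    also have "\<dots> = ennreal (2 powr p) *
     (ennreal (norm (u x) powr p) * ennreal (\<rho> x) + ennreal (\<bar>c\<bar> powr p) * (ennreal (norm (v x) powr p) * ennreal (\<rho> x)))"
      by (simp add: ennreal_mult' ennreal_plus distrib_right mult.assoc)
    finally show ?thesis by (simp add: ennreal_mult')
  qed
  then have "Lp_pow p U \<rho> (\<lambda>x. u x + c *\<^sub>R v x) \<le> (\<integral>\<^sup>+x. ennreal (2 powr p) *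
     (ennreal (norm (u x) powr p * \<rho> x) + ennreal (\<bar>c\<bar> powr p) * ennreal (norm (v x) powr p * \<rho> x)) \<partial>lebesgue_on U)"
    unfolding Lp_pow_def by (intro nn_integral_mono)
  also have "\<dots> = ennreal (2 powr p) * (Lp_pow p U \<rho> u + ennreal (\<bar>c\<bar> powr p) * Lp_pow p U \<rho> v)"
    unfolding Lp_pow_def by (simp add: nn_integral_cmult nn_integral_add)
  finally show ?thesis .
qed

lemma Lp_pow_cong_AE:
  "(AE x in lebesgue_on U. u x = v x) \<Longrightarrow> Lp_pow p U \<rho> u = Lp_pow p U \<rho> v"
  unfolding Lp_pow_def by (rule nn_integral_cong_AE) (auto elim: eventually_mono)

lemma weighted_Lp_lincomb:
  fixes u v :: "'a::euclidean_space \<Rightarrow> 'b::{real_normed_vector, second_countable_topology}"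
  assumes p: "0 < p" and r: "\<rho> \<in> borel_measurable (lebesgue_on U)"
    and u: "u \<in> weighted_Lp p U \<rho>" and v: "v \<in> weighted_Lp p U \<rho>"
  shows "(\<lambda>x. u x + c *\<^sub>R v x) \<in> weighted_Lp p U \<rho>"
proof -
  have m: "u \<in> borel_measurable (lebesgue_on U)" "v \<in> borel_measurable (lebesgue_on U)"
    and fin: "Lp_pow p U \<rho> u < \<infinity>" "Lp_pow p U \<rho> v < \<infinity>"
    using u v by (auto simp: weighted_Lp_def)
  have "Lp_pow p U \<rho> (\<lambda>x. u x + c *\<^sub>R v x) < \<infinity>"
    using Lp_pow_lincomb_le[OF p r m, of c] fin
    by (auto simp: ennreal_mult_less_top intro!: le_less_trans[OF Lp_pow_lincomb_le[OF p r m, of c]])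
  with m show ?thesis by (auto simp: weighted_Lp_def)
qed

definition W1p_pow :: "real \<Rightarrow> 'a::euclidean_space set \<Rightarrow> ('a \<Rightarrow> real) \<Rightarrow> ('a \<Rightarrow> real) \<Rightarrow> ennreal" where
  "W1p_pow p U \<rho> u = Lp_pow p U \<rho> u + Lp_pow p U \<rho> (weak_gradient U u)"

lemma weak_gradient_eq_AE:
  assumes U: "open U" and g: "is_weak_gradient U u g"
  shows "is_weak_gradient U u (weak_gradient U u)" "AE x in lebesgue_on U. weak_gradient U u x = g x"
proof -
  show 1: "is_weak_gradient U u (weak_gradient U u)"
    unfolding weak_gradient_def using g by (rule someI[of "is_weak_gradient U u"])
  show "AE x in lebesgue_on U. weak_gradient U u x = g x"
    by (rule is_weak_gradient_unique[OF U 1 g])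
qed

lemma W1p_pow_eq:
  assumes "open U" "is_weak_gradient U u g"
  shows "W1p_pow p U \<rho> u = Lp_pow p U \<rho> u + Lp_pow p U \<rho> g"
  unfolding W1p_pow_def using Lp_pow_cong_AE[OF weak_gradient_eq_AE(2)[OF assms]] by metis

lemma W1p_pow_finite:
  assumes "open U" "u \<in> W1p p U \<rho>"
  shows "W1p_pow p U \<rho> u < \<infinity>"
proof -
  obtain g where g: "is_weak_gradient U u g" "g \<in> weighted_Lp p U \<rho>" "u \<in> weighted_Lp p U \<rho>"
    using assms(2) by (auto simp: W1p_def)
  then show ?thesis by (simp add: W1p_pow_eq[OF assms(1) g(1)] weighted_Lp_def)
qed

lemma W1p_lincomb:
  assumes U: "open U" and p: "0 < p" and r: "\<rho> \<in> borel_measurable (lebesgue_on U)"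
    and u: "u \<in> W1p p U \<rho>" and v: "v \<in> W1p p U \<rho>"
  shows "(\<lambda>x. u x + c * v x) \<in> W1p p U \<rho>"
    and "W1p_pow p U \<rho> (\<lambda>x. u x + c * v x) \<le>
      ennreal (2 powr p) * (W1p_pow p U \<rho> u + ennreal (\<bar>c\<bar> powr p) * W1p_pow p U \<rho> v)"
proof -
  obtain g h where g: "is_weak_gradient U u g" "g \<in> weighted_Lp p U \<rho>" "u \<in> weighted_Lp p U \<rho>"
    and h: "is_weak_gradient U v h" "h \<in> weighted_Lp p U \<rho>" "v \<in> weighted_Lp p U \<rho>"
    using u v by (auto simp: W1p_def)
  have w: "is_weak_gradient U (\<lambda>x. u x + c * v x) (\<lambda>x. g x + c *\<^sub>R h x)"
    by (rule is_weak_gradient_lincomb[OF U g(1) h(1)])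
  show "(\<lambda>x. u x + c * v x) \<in> W1p p U \<rho>"
    using w weighted_Lp_lincomb[OF p r g(2) h(2), of c] weighted_Lp_lincomb[OF p r g(3) h(3), of c]
    by (auto simp: W1p_def)
  have m: "u \<in> borel_measurable (lebesgue_on U)" "v \<in> borel_measurable (lebesgue_on U)"
    "g \<in> borel_measurable (lebesgue_on U)" "h \<in> borel_measurable (lebesgue_on U)"
    using g h by (auto simp: weighted_Lp_def)
  have "W1p_pow p U \<rho> (\<lambda>x. u x + c * v x)
    \<le> ennreal (2 powr p) * (Lp_pow p U \<rho> u + ennreal (\<bar>c\<bar> powr p) * Lp_pow p U \<rho> v)
    + ennreal (2 powr p) * (Lp_pow p U \<rho> g + ennreal (\<bar>c\<bar> powr p) * Lp_pow p U \<rho> h)"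
    unfolding W1p_pow_eq[OF U w]
    using Lp_pow_lincomb_le[OF p r m(1,2), of c] Lp_pow_lincomb_le[OF p r m(3,4), of c]
    by (intro add_mono) simp_all
  also have "\<dots> = ennreal (2 powr p) * (W1p_pow p U \<rho> u + ennreal (\<bar>c\<bar> powr p) * W1p_pow p U \<rho> v)"
    unfolding W1p_pow_eq[OF U g(1)] W1p_pow_eq[OF U h(1)] by (simp add: distrib_left add_ac)
  finally show "W1p_pow p U \<rho> (\<lambda>x. u x + c * v x) \<le>
      ennreal (2 powr p) * (W1p_pow p U \<rho> u + ennreal (\<bar>c\<bar> powr p) * W1p_pow p U \<rho> v)" .
qed

lemma W1p_pow_diff_le:
  assumes U: "open U" and p: "0 < p" and r: "\<rho> \<in> borel_measurable (lebesgue_on U)"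
    and u: "u \<in> W1p p U \<rho>" and v: "v \<in> W1p p U \<rho>"
  shows "(\<lambda>x. u x - v x) \<in> W1p p U \<rho>"
    and "W1p_pow p U \<rho> (\<lambda>x. u x - v x) \<le> ennreal (2 powr p) * (W1p_pow p U \<rho> u + W1p_pow p U \<rho> v)"
  using W1p_lincomb[OF U p r u v, of "-1"] by simp_all

lemma W1p_norm_less_iff:
  assumes U: "open U" and p: "0 < p" and u: "u \<in> W1p p U \<rho>" and e: "0 < e"
  shows "W1p_norm p U \<rho> u < e \<longleftrightarrow> W1p_pow p U \<rho> u < ennreal (e powr p)"
proof -
  obtain r where r: "W1p_pow p U \<rho> u = ennreal r" "0 \<le> r"
    using W1p_pow_finite[OF U u] by (cases "W1p_pow p U \<rho> u") auto
  have "W1p_norm p U \<rho> u = r powr (1 / p)" using r by (simp add: W1p_norm_def W1p_pow_def)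
  moreover have "r powr (1 / p) < e \<longleftrightarrow> r < e powr p"
  proof
    assume "r powr (1 / p) < e"
    then have "(r powr (1 / p)) powr p < e powr p" using p by (intro powr_less_mono2) auto
    then show "r < e powr p" using p r(2) by (simp add: powr_powr)
  next
    assume "r < e powr p"
    then have "r powr (1 / p) < (e powr p) powr (1 / p)" using p r(2) by (intro powr_less_mono2) auto
    then show "r powr (1 / p) < e" using p e by (simp add: powr_powr)
  qed
  ultimately show ?thesis using r by (simp add: ennreal_less_iff)
qed

text \<open>Approximation can be measured by \<open>p\<close>-th powers, for which sums are easily estimated.\<close>

lemma H1p_iff:
  assumes U: "open U" and p: "0 < p" and r: "\<rho> \<in> borel_measurable (lebesgue_on U)"
  shows "u \<in> H1p p U V \<rho> \<longleftrightarrow> u \<in> W1p p U \<rho> \<and>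
    (\<forall>e>0. \<exists>f \<in> Cc_smooth U V \<inter> W1p p U \<rho>. W1p_pow p U \<rho> (\<lambda>z. u z - f z) < ennreal e)"
proof (cases "u \<in> W1p p U \<rho>")
  case u: True
  have *: "W1p_norm p U \<rho> (\<lambda>z. u z - f z) < e \<longleftrightarrow> W1p_pow p U \<rho> (\<lambda>z. u z - f z) < ennreal (e powr p)"
    if "f \<in> Cc_smooth U V \<inter> W1p p U \<rho>" "0 < e" for f e
    using that W1p_pow_diff_le(1)[OF U p r u, of f] by (intro W1p_norm_less_iff[OF U p]) auto
  show ?thesis
  proof
    assume L: "u \<in> H1p p U V \<rho>"
    show "u \<in> W1p p U \<rho> \<and> (\<forall>e>0. \<exists>f \<in> Cc_smooth U V \<inter> W1p p U \<rho>. W1p_pow p U \<rho> (\<lambda>z. u z - f z) < ennreal e)"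
    proof (intro conjI allI impI u)
      fix e :: real assume e: "0 < e"
      then obtain f where f: "f \<in> Cc_smooth U V \<inter> W1p p U \<rho>" "W1p_norm p U \<rho> (\<lambda>z. u z - f z) < e powr (1 / p)"
        using L unfolding H1p_def by (auto dest!: spec[of _ "e powr (1 / p)"])
      then show "\<exists>f \<in> Cc_smooth U V \<inter> W1p p U \<rho>. W1p_pow p U \<rho> (\<lambda>z. u z - f z) < ennreal e"
        using *[OF f(1), of "e powr (1 / p)"] e p by (intro bexI[of _ f]) (auto simp: powr_powr)
    qed
  next
    assume R: "u \<in> W1p p U \<rho> \<and> (\<forall>e>0. \<exists>f \<in> Cc_smooth U V \<inter> W1p p U \<rho>. W1p_pow p U \<rho> (\<lambda>z. u z - f z) < ennreal e)"
    have "\<exists>f \<in> Cc_smooth U V \<inter> W1p p U \<rho>. W1p_norm p U \<rho> (\<lambda>z. u z - f z) < e" if e: "0 < e" for e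
    proof -
      have "0 < e powr p" using e by simp
      then obtain f where f: "f \<in> Cc_smooth U V \<inter> W1p p U \<rho>" "W1p_pow p U \<rho> (\<lambda>z. u z - f z) < ennreal (e powr p)"
        using R by blast
      then show ?thesis using *[OF f(1) e] by blast
    qed
    then show "u \<in> H1p p U V \<rho>" using u by (auto simp: H1p_def)
  qed
qed (simp add: H1p_def)

lemma W1p_pow_zero:
  assumes "open U" shows "(\<lambda>x. 0) \<in> W1p p U \<rho>" "W1p_pow p U \<rho> (\<lambda>x. 0) = 0"
proof -
  have "L1_loc U (\<lambda>x. 0 :: real)" "L1_loc U (\<lambda>x. 0 :: 'a)" by (auto simp: L1_loc_def set_integrable_def)
  then have w: "is_weak_gradient U (\<lambda>x. 0) (\<lambda>x. 0)" by (simp add: is_weak_gradient_def)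
  then show "W1p_pow p U \<rho> (\<lambda>x. 0) = 0"
    by (subst W1p_pow_eq[OF assms w]) (simp add: Lp_pow_def)
  show "(\<lambda>x. 0) \<in> W1p p U \<rho>"
    using w by (auto simp: W1p_def weighted_Lp_def Lp_pow_def)
qed

lemma Cc_smooth_W1p_subset_H1p:
  assumes "open U" "0 < p" "\<rho> \<in> borel_measurable (lebesgue_on U)" "f \<in> Cc_smooth U V" "f \<in> W1p p U \<rho>"
  shows "f \<in> H1p p U V \<rho>"
  unfolding H1p_iff[OF assms(1-3)] using assms(4,5) W1p_pow_zero(2)[OF assms(1)]
  by (auto intro!: bexI[of _ f])

lemma H1p_lincomb:
  assumes U: "open U" and p: "0 < p" and r: "\<rho> \<in> borel_measurable (lebesgue_on U)"
    and u: "u \<in> H1p p U V \<rho>" and v: "v \<in> H1p p U V \<rho>"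
  shows "(\<lambda>x. u x + c * v x) \<in> H1p p U V \<rho>"
  unfolding H1p_iff[OF U p r]
proof (intro conjI allI impI)
  have W: "u \<in> W1p p U \<rho>" "v \<in> W1p p U \<rho>" using u v by (auto simp: H1p_def)
  show "(\<lambda>x. u x + c * v x) \<in> W1p p U \<rho>" by (rule W1p_lincomb(1)[OF U p r W])
  fix e :: real assume e: "0 < e"
  define d where "d = e / 2 / (2 powr p * (1 + \<bar>c\<bar> powr p))"
  have c: "0 < 1 + \<bar>c\<bar> powr p" by (smt (verit) powr_ge_zero)
  have d: "0 < d" using e c by (simp add: d_def)
  obtain f g where f: "f \<in> Cc_smooth U V \<inter> W1p p U \<rho>" "W1p_pow p U \<rho> (\<lambda>z. u z - f z) < ennreal d"
    and g: "g \<in> Cc_smooth U V \<inter> W1p p U \<rho>" "W1p_pow p U \<rho> (\<lambda>z. v z - g z) < ennreal d"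
    using u v d unfolding H1p_iff[OF U p r] by meson
  have W': "(\<lambda>z. u z - f z) \<in> W1p p U \<rho>" "(\<lambda>z. v z - g z) \<in> W1p p U \<rho>"
    using W f g W1p_pow_diff_le(1)[OF U p r] by blast+
  have "W1p_pow p U \<rho> (\<lambda>x. (u x - f x) + c * (v x - g x)) \<le>
    ennreal (2 powr p) * (W1p_pow p U \<rho> (\<lambda>z. u z - f z) + ennreal (\<bar>c\<bar> powr p) * W1p_pow p U \<rho> (\<lambda>z. v z - g z))"
    by (rule W1p_lincomb(2)[OF U p r W'])
  also have "\<dots> \<le> ennreal (2 powr p) * (ennreal d + ennreal (\<bar>c\<bar> powr p) * ennreal d)"
    using f(2) g(2) by (intro mult_left_mono add_mono) (auto simp: less_imp_le)
  also have "\<dots> = ennreal (2 powr p * (1 + \<bar>c\<bar> powr p) * d)"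
    using d by (simp add: ennreal_mult' ennreal_plus distrib_left distrib_right mult.assoc)
  also have "\<dots> = ennreal (e / 2)" using c by (simp add: d_def)
  also have "\<dots> < ennreal e" using e by (simp add: ennreal_less_iff)
  finally have "W1p_pow p U \<rho> (\<lambda>x. (u x - f x) + c * (v x - g x)) < ennreal e" .
  moreover have "(\<lambda>x. (u x - f x) + c * (v x - g x)) = (\<lambda>x. (u x + c * v x) - (f x + c * g x))"
    by (auto simp: algebra_simps)
  moreover have "(\<lambda>x. f x + c * g x) \<in> Cc_smooth U V \<inter> W1p p U \<rho>"
    using f(1) g(1) Cc_smooth_lincomb[OF U] W1p_lincomb(1)[OF U p r] by blast
  ultimately show "\<exists>h \<in> Cc_smooth U V \<inter> W1p p U \<rho>. W1p_pow p U \<rho> (\<lambda>z. (u z + c * v z) - h z) < ennreal e"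
    by (intro bexI[of _ "\<lambda>x. f x + c * g x"]) auto
qed

section \<open>Integral inequalities on the line\<close>

text \<open>Hoelder's inequality, up to the factor \<open>2\<^sup>p\<close>, for the splitting
\<open>k = k T\<^sup>(\<^sup>1\<^sup>-\<^sup>p\<^sup>)\<^sup>/\<^sup>p \<cdot> T\<^sup>(\<^sup>p\<^sup>-\<^sup>1\<^sup>)\<^sup>/\<^sup>p\<close>. It follows from the pointwise bound
\<open>k \<le> \<lambda>T + k\<^sup>p (\<lambda>T)\<^sup>1\<^sup>-\<^sup>p\<close>, valid since one of the two terms on the right is at least
\<open>k\<close>, by optimising over \<open>\<lambda> > 0\<close>. The left-hand side is a real number \<open>h\<close>, so
that powers of extended reals do not occur.\<close>

lemma nn_integral_Holder:
  fixes k T :: "'a \<Rightarrow> real"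
  assumes p: "1 < p" and [measurable]: "k \<in> borel_measurable M" "T \<in> borel_measurable M"
    and k: "\<And>x. 0 \<le> k x" and T: "\<And>x. 0 \<le> T x" "\<And>x. T x = 0 \<Longrightarrow> k x = 0"
    and h: "0 \<le> h" "ennreal h \<le> (\<integral>\<^sup>+x. ennreal (k x) \<partial>M)"
    and A: "0 < A" "(\<integral>\<^sup>+x. ennreal (T x) \<partial>M) \<le> ennreal A"
  shows "ennreal (h powr p) \<le> ennreal (2 powr p * A powr (p - 1)) * (\<integral>\<^sup>+x. ennreal (k x powr p * T x powr (1 - p)) \<partial>M)"
proof -
  let ?B = "\<integral>\<^sup>+x. ennreal (k x powr p * T x powr (1 - p)) \<partial>M"
  have key: "ennreal h \<le> ennreal (l * A) + ennreal (l powr (1 - p)) * ?B" if l: "0 < l" for l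
  proof -
    have pt: "k x \<le> l * T x + l powr (1 - p) * (k x powr p * T x powr (1 - p))" for x
    proof (cases "k x \<le> l * T x")
      case False
      then have "T x \<noteq> 0" using T(2)[of x] by auto
      then have "l * T x < k x" "0 < T x" using False T(1)[of x] by auto
      then have lt: "l * T x < k x" "0 < T x" "0 < k x"
        using l mult_pos_pos[of l "T x"] by linarith+
      have "k x = k x powr p * k x powr (1 - p)"
        using lt by (simp add: powr_add[symmetric])
      also have "\<dots> \<le> k x powr p * (l * T x) powr (1 - p)"
        using lt l p by (intro mult_left_mono powr_mono2') auto
      also have "\<dots> = l powr (1 - p) * (k x powr p * T x powr (1 - p))"
        using lt l by (simp add: powr_mult)
      finally show ?thesis using lt l by (smt (verit) mult_nonneg_nonneg)
    qed (simp add: add_increasing2)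
    have "ennreal h \<le> (\<integral>\<^sup>+x. ennreal (k x) \<partial>M)" by fact
    also have "\<dots> \<le> (\<integral>\<^sup>+x. ennreal l * ennreal (T x) + ennreal (l powr (1 - p)) * ennreal (k x powr p * T x powr (1 - p)) \<partial>M)"
    proof (rule nn_integral_mono)
      fix x
      have "ennreal (k x) \<le> ennreal (l * T x + l powr (1 - p) * (k x powr p * T x powr (1 - p)))"
        by (rule ennreal_leI[OF pt])
      then show "ennreal (k x) \<le> ennreal l * ennreal (T x) + ennreal (l powr (1 - p)) * ennreal (k x powr p * T x powr (1 - p))"
        using l T[of x] by (simp add: ennreal_mult'' ennreal_plus ennreal_mult)
    qed
    also have "\<dots> = ennreal l * (\<integral>\<^sup>+x. ennreal (T x) \<partial>M) + ennreal (l powr (1 - p)) * ?B"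
      by (simp add: nn_integral_add nn_integral_cmult)
    also have "\<dots> \<le> ennreal l * ennreal A + ennreal (l powr (1 - p)) * ?B"
      using A by (intro add_mono mult_left_mono) auto
    finally show ?thesis using l A by (simp add: ennreal_mult)
  qed
  show ?thesis
  proof (cases "?B")
    case top
    then show ?thesis using A(1) by (simp add: ennreal_mult_top)
  next
    case (real b)
    have key': "h \<le> l * A + l powr (1 - p) * b" if l: "0 < l" for l
    proof -
      have "ennreal h \<le> ennreal (l * A + l powr (1 - p) * b)"
        using key[OF l] l A real(1) unfolding real(2) by (simp add: ennreal_mult'' ennreal_plus)
      then show ?thesis using l A real(1) by (subst (asm) ennreal_le_iff) auto
    qed
    have "h powr p \<le> 2 powr p * A powr (p - 1) * b"
    proof (cases "b = 0")
      case True
      have "h \<le> e" if "0 < e" for e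
        using key'[of "e / A"] that A True by simp
      then have "h = 0" using h(1) field_le_epsilon[of h 0] by auto
      then show ?thesis using True by simp
    next
      case False
      then have b: "0 < b" using real by simp
      \<comment> \<open>this choice makes the two terms of the bound equal\<close>
      define l where "l = (b / A) powr (1 / p)"
      have l: "0 < l" using b A by (simp add: l_def)
      have "l * A = b powr (1 / p) * A powr ((p - 1) / p)"
      proof -
        have "l * A = b powr (1 / p) * (A powr 1 / A powr (1 / p))"
          using b A by (simp add: l_def powr_divide)
        also have "A powr 1 / A powr (1 / p) = A powr (1 - 1 / p)" by (simp only: powr_diff)
        also have "1 - 1 / p = (p - 1) / p" using p by (simp add: field_simps)
        finally show ?thesis .
      qed
      moreover have "l powr (1 - p) * b = b powr (1 / p) * A powr ((p - 1) / p)"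
      proof -
        have "l powr (1 - p) * b = (b / A) powr ((1 - p) / p) * b" by (simp add: l_def powr_powr)
        also have "\<dots> = (b powr ((1 - p) / p) * b powr 1) * (1 / A powr ((1 - p) / p))"
          using b A by (simp add: powr_divide)
        also have "b powr ((1 - p) / p) * b powr 1 = b powr ((1 - p) / p + 1)" by (simp only: powr_add)
        also have "(1 - p) / p + 1 = 1 / p" using p by (simp add: field_simps)
        also have "1 / A powr ((1 - p) / p) = A powr (- ((1 - p) / p))"
          by (simp add: powr_minus field_simps)
        also have "- ((1 - p) / p) = (p - 1) / p" using p by (simp add: field_simps)
        finally show ?thesis .
      qed
      ultimately have "h \<le> 2 * (b powr (1 / p) * A powr ((p - 1) / p))" using key'[OF l] by simp
      then have "h powr p \<le> (2 * (b powr (1 / p) * A powr ((p - 1) / p))) powr p"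
        using h p by (intro powr_mono2) auto
      also have "\<dots> = 2 powr p * A powr (p - 1) * b"
        using b A p by (simp add: powr_mult powr_powr)
      finally show ?thesis .
    qed
    then have "ennreal (h powr p) \<le> ennreal (2 powr p * A powr (p - 1) * b)" by (rule ennreal_leI)
    then show ?thesis unfolding real(2) using real(1) by (simp add: ennreal_mult'')
  qed
qed

text \<open>The fundamental theorem of calculus with a derivative that exists only in the open interval. If the
right-hand side is finite, the gauge integral of \<open>h'\<close> is dominated by the Lebesgue integral of
\<open>k\<close>.\<close>

lemma abs_increment_le_nn_integral:
  fixes h :: "real \<Rightarrow> real"
  assumes ab: "a \<le> b" and h: "continuous_on {a..b} h"
    and d: "\<And>x. a < x \<Longrightarrow> x < b \<Longrightarrow> (h has_real_derivative h' x) (at x)"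
    and k: "\<And>x. a < x \<Longrightarrow> x < b \<Longrightarrow> \<bar>h' x\<bar> \<le> k x"
    and [measurable]: "k \<in> borel_measurable borel"
  shows "ennreal \<bar>h b - h a\<bar> \<le> (\<integral>\<^sup>+x\<in>{a<..<b}. ennreal (k x) \<partial>lborel)"
proof (cases "(\<integral>\<^sup>+x\<in>{a<..<b}. ennreal (k x) \<partial>lborel) = \<infinity>")
  case False
  let ?k = "\<lambda>x. indicator {a<..<b} x * k x"
  have k0: "0 \<le> k x" if "a < x" "x < b" for x using k[OF that] by linarith
  have eq: "ennreal (norm (?k x)) = ennreal (k x) * indicator {a<..<b} x" for x
    using k0[of x] by (auto simp: indicator_def)
  have i: "integrable lborel ?k"
    unfolding integrable_iff_bounded eq using False by (simp add: less_top[symmetric])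
  have kif: "?k = (\<lambda>x. if x \<in> {a<..<b} then k x else 0)" by auto
  have "(h' has_integral (h b - h a)) {a..b}"
    using ab h d by (intro fundamental_theorem_of_calculus_interior)
      (auto simp: has_real_derivative_iff_has_vector_derivative)
  then have 1: "(h' has_integral (h b - h a)) {a<..<b}" by (simp add: has_integral_Icc_iff_Ioo)
  have "(?k has_integral (LINT x|lborel. ?k x)) UNIV"
    by (rule has_integral_integral_lborel[OF i])
  then have 2: "(k has_integral (LINT x|lborel. ?k x)) {a<..<b}"
    unfolding kif has_integral_restrict_UNIV .
  have "norm (integral {a<..<b} h') \<le> integral {a<..<b} k"
    using 1 2 k by (intro Henstock_Kurzweil_Integration.integral_norm_bound_integral) (auto simp: has_integral_iff)
  then have "\<bar>h b - h a\<bar> \<le> (LINT x|lborel. ?k x)"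
    using 1 2 by (simp add: integral_unique)
  then have "ennreal \<bar>h b - h a\<bar> \<le> ennreal (LINT x|lborel. ?k x)" by (rule ennreal_leI)
  also have "\<dots> = (\<integral>\<^sup>+x. ennreal (?k x) \<partial>lborel)"
    using k0 by (intro nn_integral_eq_integral[symmetric] i) (auto simp: indicator_def)
  also have "\<dots> = (\<integral>\<^sup>+x\<in>{a<..<b}. ennreal (k x) \<partial>lborel)"
    by (intro nn_integral_cong) (auto simp: indicator_def)
  finally show ?thesis .
qed simp

lemma ennreal_powr_minus_layer_cake:
  assumes a: "0 < a" and y: "0 < (y :: real)"
  shows "ennreal (y powr - a) = (\<integral>\<^sup>+z\<in>{y..}. ennreal (a * z powr (- a - 1)) \<partial>lborel)"
proof -
  have "((\<lambda>z. a * z powr (- a - 1)) has_integral a * (- (y powr ((- a - 1) + 1)) / ((- a - 1) + 1))) {y..}"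
    using a y by (intro has_integral_mult_right has_integral_powr_to_inf) auto
  also have "a * (- (y powr ((- a - 1) + 1)) / ((- a - 1) + 1)) = y powr - a" using a by simp
  finally show ?thesis
    using a by (intro nn_integral_has_integral_lebesgue'[symmetric]) auto
qed

text \<open>Write \<open>y\<^sup>-\<^sup>a\<close> as an integral over \<open>z \<ge> y\<close> and exchange the order of integration. In this
way powers of a primitive \<open>y = \<integral>\<omega>\<close> are integrated against \<open>\<omega>\<close> without
differentiating \<open>y\<close>, which is merely absolutely continuous; the measure of its sublevel sets is
all that matters.\<close>

lemma nn_integral_powr_minus_layer_cake:
  assumes N: "sigma_finite_measure N" and [measurable]: "y \<in> borel_measurable N"
    and a: "0 < a" and y: "AE x in N. 0 < (y x :: real)"
  shows "(\<integral>\<^sup>+x. ennreal (y x powr - a) \<partial>N) =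
    (\<integral>\<^sup>+z\<in>{0<..}. ennreal (a * z powr (- a - 1)) * emeasure N {x \<in> space N. y x \<le> z} \<partial>lborel)"
proof -
  interpret N: sigma_finite_measure N by fact
  interpret NL: pair_sigma_finite N lborel ..
  have "(\<integral>\<^sup>+x. ennreal (y x powr - a) \<partial>N) =
    (\<integral>\<^sup>+x. \<integral>\<^sup>+z. ennreal (a * z powr (- a - 1)) * indicator {0<..} z * indicator {x \<in> space N. y x \<le> z} x \<partial>lborel \<partial>N)"
  proof (rule nn_integral_cong_AE)
    show "AE x in N. ennreal (y x powr - a) =
      (\<integral>\<^sup>+z. ennreal (a * z powr (- a - 1)) * indicator {0<..} z * indicator {x \<in> space N. y x \<le> z} x \<partial>lborel)"
      using y AE_space
    proof eventually_elim
      case (elim x)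
      show ?case
        unfolding ennreal_powr_minus_layer_cake[OF a elim(1)]
        using elim by (intro nn_integral_cong) (auto simp: indicator_def)
    qed
  qed
  also have "\<dots> = (\<integral>\<^sup>+z. \<integral>\<^sup>+x. ennreal (a * z powr (- a - 1)) * indicator {0<..} z * indicator {x \<in> space N. y x \<le> z} x \<partial>N \<partial>lborel)"
    by (rule NL.Fubini'[symmetric]) measurable
  also have "\<dots> = (\<integral>\<^sup>+z\<in>{0<..}. ennreal (a * z powr (- a - 1)) * emeasure N {x \<in> space N. y x \<le> z} \<partial>lborel)"
    by (intro nn_integral_cong, subst nn_integral_cmult_indicator) (simp_all add: mult_ac)
  finally show ?thesis .
qed

text \<open>If \<open>y\<close> were uniformly distributed on \<open>[0,m]\<close>, this would be the integral of
\<open>z\<^sup>-\<^sup>1\<^sup>/\<^sup>2\<close>; the hypotheses say that sublevel sets are no larger than in that case.\<close>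

lemma nn_integral_rsqrt_le:
  assumes N: "sigma_finite_measure N" and [measurable]: "y \<in> borel_measurable N"
    and y: "AE x in N. 0 < (y x :: real)" and m: "0 < m"
    and le: "\<And>z. 0 < z \<Longrightarrow> emeasure N {x \<in> space N. y x \<le> z} \<le> ennreal z"
    and tot: "emeasure N (space N) \<le> ennreal m"
  shows "(\<integral>\<^sup>+x. ennreal (y x powr - (1/2)) \<partial>N) \<le> ennreal (2 * m powr (1/2))"
proof -
  have "(\<integral>\<^sup>+x. ennreal (y x powr - (1/2)) \<partial>N) =
    (\<integral>\<^sup>+z\<in>{0<..}. ennreal ((1/2) * z powr (- (1/2) - 1)) * emeasure N {x \<in> space N. y x \<le> z} \<partial>lborel)"
    by (rule nn_integral_powr_minus_layer_cake[OF N _ _ y]) auto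
  also have "\<dots> \<le> (\<integral>\<^sup>+z. ennreal (1/2) * (ennreal (z powr (- (1/2))) * indicator {0..m} z) +
      ennreal m * (ennreal ((1/2) * z powr (- (1/2) - 1)) * indicator {m..} z) \<partial>lborel)"
  proof (rule nn_integral_mono)
    fix z :: real
    consider "z \<le> 0" | "0 < z" "z \<le> m" | "0 < z" "m < z" by linarith
    then show "ennreal ((1/2) * z powr (- (1/2) - 1)) * emeasure N {x \<in> space N. y x \<le> z} * indicator {0<..} z \<le>
      ennreal (1/2) * (ennreal (z powr (- (1/2))) * indicator {0..m} z) +
      ennreal m * (ennreal ((1/2) * z powr (- (1/2) - 1)) * indicator {m..} z)"
    proof cases
      case 2
      have "ennreal ((1/2) * z powr (- (1/2) - 1)) * emeasure N {x \<in> space N. y x \<le> z} \<le> ennreal ((1/2) * z powr (- (1/2) - 1)) * ennreal z"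
        using 2 by (intro mult_left_mono le) auto
      also have "\<dots> = ennreal (1/2 * (z powr (- (1/2) - 1) * z powr 1))"
        using 2 by (simp add: ennreal_mult''[symmetric])
      also have "z powr (- (1/2) - 1) * z powr 1 = z powr (- (1/2))"
        by (simp only: powr_add[symmetric]) simp
      also have "ennreal (1/2 * z powr (- (1/2))) = ennreal (1/2) * ennreal (z powr (- (1/2)))"
        by (rule ennreal_mult) auto
      finally have "ennreal ((1/2) * z powr (- (1/2) - 1)) * emeasure N {x \<in> space N. y x \<le> z} * indicator {0<..} z
          \<le> ennreal (1/2) * (ennreal (z powr (- (1/2))) * indicator {0..m} z)"
        using 2 by (simp add: indicator_def)
      then show ?thesis by (rule add_increasing2[OF zero_le])
    next
      case 3
      have "ennreal ((1/2) * z powr (- (1/2) - 1)) * emeasure N {x \<in> space N. y x \<le> z} \<le> ennreal ((1/2) * z powr (- (1/2) - 1)) * ennreal m"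
        using tot by (intro mult_left_mono order_trans[OF emeasure_space tot]) auto
      then show ?thesis using 3 by (simp add: mult.commute)
    qed simp
  qed
  also have "\<dots> = ennreal (1/2) * (\<integral>\<^sup>+z\<in>{0..m}. ennreal (z powr (- (1/2))) \<partial>lborel) +
      ennreal m * (\<integral>\<^sup>+z\<in>{m..}. ennreal ((1/2) * z powr (- (1/2) - 1)) \<partial>lborel)"
    by (simp add: nn_integral_add nn_integral_cmult)
  also have "(\<integral>\<^sup>+z\<in>{0..m}. ennreal (z powr (- (1/2))) \<partial>lborel) = ennreal (m powr (- (1/2) + 1) / (- (1/2) + 1))"
    using m by (intro nn_integral_has_integral_lebesgue' has_integral_powr_from_0) auto
  also have "(\<integral>\<^sup>+z\<in>{m..}. ennreal ((1/2) * z powr (- (1/2) - 1)) \<partial>lborel) = ennreal (m powr - (1/2))"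
    using m by (intro ennreal_powr_minus_layer_cake[symmetric]) auto
  also have "ennreal (1/2) * ennreal (m powr (- (1/2) + 1) / (- (1/2) + 1)) = ennreal (m powr (1/2))"
    by (subst ennreal_mult[symmetric]) auto
  also have "ennreal m * ennreal (m powr - (1/2)) = ennreal (m powr (1/2))"
  proof -
    have "m powr 1 * m powr - (1/2) = m powr (1/2)" by (simp only: powr_add[symmetric]) simp
    then show ?thesis using m by (simp add: ennreal_mult[symmetric])
  qed
  also have "ennreal (m powr (1/2)) + ennreal (m powr (1/2)) = ennreal (2 * m powr (1/2))"
    by (simp add: ennreal_plus[symmetric] del: ennreal_plus)
  finally show ?thesis .
qed

text \<open>The corresponding bound for the integral of \<open>z\<^sup>-\<^sup>1\<^sup>-\<^sup>g\<close> over \<open>z \<ge> m\<close>.\<close>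

lemma nn_integral_powr_minus_tail_le:
  assumes N: "sigma_finite_measure N" and [measurable]: "y \<in> borel_measurable N"
    and y: "AE x in N. m \<le> (y x :: real)" and m: "0 < m" and g: "0 < g"
    and le: "\<And>z. 0 < z \<Longrightarrow> emeasure N {x \<in> space N. y x \<le> z} \<le> ennreal z"
  shows "(\<integral>\<^sup>+x. ennreal (y x powr (- 1 - g)) \<partial>N) \<le> ennreal ((1 + g) / g * m powr - g)"
proof -
  have y0: "AE x in N. 0 < y x" using y by eventually_elim (use m in simp)
  have "(\<integral>\<^sup>+x. ennreal (y x powr (- 1 - g)) \<partial>N) = (\<integral>\<^sup>+x. ennreal (y x powr - (1 + g)) \<partial>N)"
    by (simp add: algebra_simps)
  also have "\<dots> = (\<integral>\<^sup>+z\<in>{0<..}. ennreal ((1 + g) * z powr (- (1 + g) - 1)) * emeasure N {x \<in> space N. y x \<le> z} \<partial>lborel)"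
    using g by (intro nn_integral_powr_minus_layer_cake[OF N _ _ y0]) auto
  also have "\<dots> \<le> (\<integral>\<^sup>+z. ennreal ((1 + g) / g) * (ennreal (g * z powr (- g - 1)) * indicator {m..} z) \<partial>lborel)"
  proof (rule nn_integral_mono)
    fix z :: real
    consider "z \<le> 0" | "0 < z" "z < m" | "m \<le> z" by linarith
    then show "ennreal ((1 + g) * z powr (- (1 + g) - 1)) * emeasure N {x \<in> space N. y x \<le> z} * indicator {0<..} z
       \<le> ennreal ((1 + g) / g) * (ennreal (g * z powr (- g - 1)) * indicator {m..} z)"
    proof cases
      case 2
      have "AE x in N. \<not> y x \<le> z" using y by eventually_elim (use 2 in simp)
      then have "emeasure N {x \<in> space N. y x \<le> z} = 0" by (rule emeasure_eq_0_AE)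
      then show ?thesis by simp
    next
      case 3
      then have z: "0 < z" using m by simp
      have "ennreal ((1 + g) * z powr (- (1 + g) - 1)) * emeasure N {x \<in> space N. y x \<le> z} \<le> ennreal ((1 + g) * z powr (- (1 + g) - 1)) * ennreal z"
        using z by (intro mult_left_mono le) auto
      also have "\<dots> = ennreal ((1 + g) * (z powr (- (1 + g) - 1) * z powr 1))"
        using z g by (simp add: ennreal_mult''[symmetric] mult.assoc)
      also have "z powr (- (1 + g) - 1) * z powr 1 = z powr (- (1 + g) - 1 + 1)" by (simp only: powr_add)
      also have "- (1 + g) - 1 + 1 = - g - 1" by simp
      also have "ennreal ((1 + g) * z powr (- g - 1)) = ennreal ((1 + g) / g) * ennreal (g * z powr (- g - 1))"
        using g by (simp add: ennreal_mult''[symmetric])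
      finally show ?thesis using 3 z by simp
    qed simp
  qed
  also have "\<dots> = ennreal ((1 + g) / g) * (\<integral>\<^sup>+z\<in>{m..}. ennreal (g * z powr (- g - 1)) \<partial>lborel)"
    by (rule nn_integral_cmult) measurable
  also have "(\<integral>\<^sup>+z\<in>{m..}. ennreal (g * z powr (- g - 1)) \<partial>lborel) = ennreal (m powr - g)"
    by (rule ennreal_powr_minus_layer_cake[OF g m, symmetric])
  also have "ennreal ((1 + g) / g) * ennreal (m powr - g) = ennreal ((1 + g) / g * m powr - g)"
    using g by (intro ennreal_mult[symmetric]) auto
  finally show ?thesis .
qed

text \<open>Up to its supremum, \<open>S\<close> is covered by an increasing sequence of intervals starting at
\<open>c\<close>, and each of them lies in an interval ending in a point of \<open>S\<close>.\<close>

lemma emeasure_sublevel_primitive_le: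
  fixes \<omega> :: "real \<Rightarrow> real"
  assumes [measurable]: "\<omega> \<in> borel_measurable borel" "S \<in> sets borel"
    and S: "S \<subseteq> {c<..<d}" and z: "\<And>r. r \<in> S \<Longrightarrow> (\<integral>\<^sup>+t\<in>{c<..<r}. ennreal (\<omega> t) \<partial>lborel) \<le> z"
  shows "(\<integral>\<^sup>+t\<in>S. ennreal (\<omega> t) \<partial>lborel) \<le> z"
proof (cases "S = {}")
  case False
  \<comment> \<open>the point \<open>R\<close> itself may belong to \<open>S\<close>, but it is a null set\<close>
  define R where "R = Sup S"
  have bdd: "bdd_above S" using S by (intro bdd_aboveI[of _ d]) auto
  define A where "A n = {c<..<R - 1 / real (Suc n)}" for n
  have "(\<integral>\<^sup>+t\<in>S. ennreal (\<omega> t) \<partial>lborel) \<le> (\<integral>\<^sup>+t\<in>{c<..<R}. ennreal (\<omega> t) \<partial>lborel)"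
  proof (rule nn_integral_mono_AE)
    show "AE t in lborel. ennreal (\<omega> t) * indicator S t \<le> ennreal (\<omega> t) * indicator {c<..<R} t"
      using AE_lborel_singleton[of R]
    proof eventually_elim
      case (elim t)
      then show ?case using S cSup_upper[OF _ bdd, of t] by (auto simp: indicator_def R_def)
    qed
  qed
  also have "{c<..<R} = (\<Union>n. A n)"
  proof (intro equalityI subsetI)
    fix t assume t: "t \<in> {c<..<R}"
    then obtain n where "inverse (real (Suc n)) < R - t" using reals_Archimedean[of "R - t"] by auto
    then have "t \<in> A n" using t by (simp add: A_def inverse_eq_divide)
    then show "t \<in> (\<Union>n. A n)" by blast
  next
    fix t assume "t \<in> (\<Union>n. A n)"
    then obtain n where "c < t" "t < R - 1 / real (Suc n)" by (auto simp: A_def)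
    moreover have "0 < 1 / real (Suc n)" by simp
    ultimately have "t < R" by linarith
    with \<open>c < t\<close> show "t \<in> {c<..<R}" by simp
  qed
  also have "(\<integral>\<^sup>+t\<in>(\<Union>n. A n). ennreal (\<omega> t) \<partial>lborel) = emeasure (density lborel (\<lambda>t. ennreal (\<omega> t))) (\<Union>n. A n)"
    by (subst emeasure_density) (auto simp: A_def)
  also have "\<dots> = (SUP n. emeasure (density lborel (\<lambda>t. ennreal (\<omega> t))) (A n))"
  proof (rule SUP_emeasure_incseq[symmetric])
    show "incseq A"
    proof (rule incseq_SucI)
      fix n
      have "1 / real (Suc (Suc n)) \<le> 1 / real (Suc n)" by (simp add: field_simps)
      then show "A n \<subseteq> A (Suc n)" by (auto simp: A_def simp del: of_nat_Suc)
    qed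
  qed (auto simp: A_def)
  also have "\<dots> \<le> z"
  proof (rule SUP_least)
    fix n
    have "R - 1 / real (Suc n) < Sup S" by (simp add: R_def del: of_nat_Suc)
    then obtain r where r: "r \<in> S" "R - 1 / real (Suc n) < r"
      using less_cSup_iff[OF False bdd] by blast
    have "emeasure (density lborel (\<lambda>t. ennreal (\<omega> t))) (A n) = (\<integral>\<^sup>+t\<in>A n. ennreal (\<omega> t) \<partial>lborel)"
      by (subst emeasure_density) (auto simp: A_def)
    also have "\<dots> \<le> (\<integral>\<^sup>+t\<in>{c<..<r}. ennreal (\<omega> t) \<partial>lborel)"
      using r(2) by (intro nn_integral_mono) (auto simp: A_def indicator_def simp del: of_nat_Suc)
    also have "\<dots> \<le> z" by (rule z[OF r(1)])
    finally show "emeasure (density lborel (\<lambda>t. ennreal (\<omega> t))) (A n) \<le> z" .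
  qed
  finally show ?thesis .
qed simp

section \<open>The weighted Hardy inequality and a boundary estimate\<close>

definition Hardy_const :: "real \<Rightarrow> real" where
  "Hardy_const p = 2 powr p * 2 powr (p - 1) * ((p + 1) / (p - 1))"

lemma Hardy_const_nonneg: "1 < p \<Longrightarrow> 0 \<le> Hardy_const p"
  by (simp add: Hardy_const_def)

lemma sigma_finite_density_lborel:
  fixes f :: "real \<Rightarrow> ennreal"
  assumes "f \<in> borel_measurable borel" "\<And>x. f x < \<infinity>"
  shows "sigma_finite_measure (density lborel f)"
  using assms by (subst sigma_finite_measure.sigma_finite_iff_density_finite[OF sigma_finite_lborel]) (auto simp: less_top)

text \<open>Both sides are \<open>0\<close> if the integral diverges. Thus the convention for divergent inner integrals
in the weights \<open>\<phi>\<^sub>i\<close> and \<open>\<psi>\<^sub>i\<close> carries through without case distinctions.\<close>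

lemma set_LINT_Icc_eq_enn2real:
  fixes \<omega> :: "real \<Rightarrow> real"
  assumes [measurable]: "\<omega> \<in> borel_measurable borel" and pos: "\<And>t. c < t \<Longrightarrow> t < r \<Longrightarrow> 0 < \<omega> t"
  shows "(LINT t:{c..r}|lborel. \<omega> t) = enn2real (\<integral>\<^sup>+t\<in>{c<..<r}. ennreal (\<omega> t) \<partial>lborel)"
proof -
  have ae: "AE t in lborel. t \<noteq> c \<and> t \<noteq> r" using AE_lborel_singleton[of c] AE_lborel_singleton[of r] by eventually_elim auto
  have "(LINT t:{c..r}|lborel. \<omega> t) = (LINT t|lborel. indicator {c<..<r} t * \<omega> t)"
    unfolding set_lebesgue_integral_def
  proof (intro integral_cong_AE)
    show "AE t in lborel. indicator {c..r} t *\<^sub>R \<omega> t = indicator {c<..<r} t * \<omega> t"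
      using ae by eventually_elim (auto simp: indicator_def)
  qed auto
  also have "\<dots> = enn2real (\<integral>\<^sup>+t. ennreal (indicator {c<..<r} t * \<omega> t) \<partial>lborel)"
    using pos by (intro integral_eq_nn_integral) (auto simp: indicator_def less_imp_le)
  also have "(\<integral>\<^sup>+t. ennreal (indicator {c<..<r} t * \<omega> t) \<partial>lborel) = (\<integral>\<^sup>+t\<in>{c<..<r}. ennreal (\<omega> t) \<partial>lborel)"
    by (intro nn_integral_cong) (auto simp: indicator_def)
  finally show ?thesis .
qed

text \<open>Let \<open>m(r)\<close> be the integral of \<open>\<omega>\<close> over \<open>(c,r)\<close>. The Hoelder inequality on
\<open>(c,r)\<close> with \<open>T = \<omega> m\<^sup>-\<^sup>1\<^sup>/\<^sup>2\<close> bounds \<open>h(r)\<^sup>p\<close> by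
\<open>m(r)\<^sup>g\<close> times the integral of \<open>Q = k\<^sup>p \<omega>\<^sup>1\<^sup>-\<^sup>p m\<^sup>g\<close>, where \<open>g = (p-1)/2\<close>. After
exchanging the order of integration, the integral of \<open>\<omega> m\<^sup>-\<^sup>1\<^sup>-\<^sup>g\<close> over \<open>r > t\<close> contributes
\<open>m(t)\<^sup>-\<^sup>g\<close>, which cancels the factor in \<open>Q\<close>. The set \<open>S\<close> consists of the points with
\<open>m < \<infinity>\<close>; the weight on the left is zero outside of it.\<close>

lemma Hardy_inequality_right:
  fixes \<omega> k h :: "real \<Rightarrow> real"
  assumes p: "1 < p" and [measurable]: "\<omega> \<in> borel_measurable borel" "k \<in> borel_measurable borel"
    and pos: "\<And>t. c < t \<Longrightarrow> t < d \<Longrightarrow> 0 < \<omega> t" and k: "\<And>t. 0 \<le> k t"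
    and h: "\<And>r. c < r \<Longrightarrow> r < d \<Longrightarrow> 0 \<le> h r"
      "\<And>r. c < r \<Longrightarrow> r < d \<Longrightarrow> ennreal (h r) \<le> (\<integral>\<^sup>+t\<in>{c<..<r}. ennreal (k t) \<partial>lborel)"
  shows "(\<integral>\<^sup>+r\<in>{c<..<d}. ennreal (\<omega> r * (LINT t:{c..r}|lborel. \<omega> t) powr (- p) * h r powr p) \<partial>lborel) \<le>
    ennreal (Hardy_const p) * (\<integral>\<^sup>+t\<in>{c<..<d}. ennreal (k t powr p * \<omega> t powr (1 - p)) \<partial>lborel)"
proof -
  define M where "M r = (\<integral>\<^sup>+t\<in>{c<..<r}. ennreal (\<omega> t) \<partial>lborel)" for r
  define m where "m r = enn2real (M r)" for r
  define S where "S = {r. c < r \<and> r < d \<and> M r < \<infinity>}"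
  define g where "g = (p - 1) / 2"
  define Q where "Q t = k t powr p * \<omega> t powr (1 - p) * m t powr g" for t
  have g: "0 < g" using p by (simp add: g_def)
  have "M r = (\<integral>\<^sup>+t. (if c < t \<and> t < r then ennreal (\<omega> t) else 0) \<partial>lborel)" for r
    unfolding M_def by (intro nn_integral_cong) auto
  then have [measurable]: "M \<in> borel_measurable borel" by (simp cong: measurable_cong)
  then have [measurable]: "m \<in> borel_measurable borel" "S \<in> sets borel" "Q \<in> borel_measurable borel"
    unfolding m_def[abs_def] S_def Q_def[abs_def] by measurable
  have mono: "M r \<le> M r'" if "r \<le> r'" for r r'
    unfolding M_def using that by (intro nn_integral_mono) (auto simp: indicator_def)
  have S_down: "t \<in> S" if "r \<in> S" "c < t" "t \<le> r" for t r
    using that mono[of t r] by (auto simp: S_def intro: le_less_trans)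
  have MS: "M r = ennreal (m r)" "0 < m r" if r: "r \<in> S" for r
  proof -
    have fin: "M r < \<infinity>" and cd: "c < r" "r < d" using r by (auto simp: S_def)
    then show 1: "M r = ennreal (m r)" by (simp add: m_def)
    have "M r \<noteq> 0"
    proof
      assume "M r = 0"
      then have "AE t in lborel. ennreal (\<omega> t) * indicator {c<..<r} t = 0"
        unfolding M_def by (subst (asm) nn_integral_0_iff_AE) auto
      then have "AE t in lborel. t \<notin> {c<..<r}"
      proof eventually_elim
        case (elim t)
        then show ?case using pos[of t] cd by (auto simp: indicator_def ennreal_eq_0_iff split: if_splits)
      qed
      then have "emeasure lborel {c<..<r} = 0" by (subst (asm) AE_iff_measurable[of "{c<..<r}"]) auto
      then show False using cd by simp
    qed
    then show "0 < m r" using 1 by (cases "m r > 0") (auto simp: ennreal_neg)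
  qed
  have mmono: "m t \<le> m r" if "r \<in> S" "t \<le> r" for t r
    unfolding m_def using that mono[of t r] by (intro enn2real_mono) (auto simp: S_def)
  have sub: "(\<integral>\<^sup>+t\<in>{t \<in> S. m t \<le> z}. ennreal (\<omega> t) \<partial>lborel) \<le> ennreal z" for z
  proof (rule emeasure_sublevel_primitive_le[of _ _ c d])
    show "(\<integral>\<^sup>+t\<in>{c<..<r}. ennreal (\<omega> t) \<partial>lborel) \<le> ennreal z" if "r \<in> {t \<in> S. m t \<le> z}" for r
      using that MS(1)[of r] by (simp add: M_def[symmetric] ennreal_leI)
  qed (auto simp: S_def)
  \<comment> \<open>also for \<open>M r = \<infinity>\<close>, where both sides are \<open>0\<close>\<close>
  have meq: "(LINT t:{c..r}|lborel. \<omega> t) = m r" if "c < r" "r < d" for r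
    unfolding m_def M_def using that pos by (intro set_LINT_Icc_eq_enn2real) auto
  have point: "ennreal (\<omega> r * m r powr (- p) * h r powr p) \<le>
      ennreal (2 powr p * 2 powr (p - 1)) * (ennreal (\<omega> r * m r powr (- 1 - g)) * (\<integral>\<^sup>+t\<in>{c<..<r}. ennreal (Q t) \<partial>lborel))"
    if r: "r \<in> S" for r
  proof -
    have cd: "c < r" "r < d" using r by (auto simp: S_def)
    have inS: "t \<in> S" if "c < t" "t < r" for t using S_down[OF r that(1)] that(2) by simp
    let ?k = "\<lambda>t. indicator {c<..<r} t * k t"
    let ?T = "\<lambda>t. indicator {c<..<r} t * (\<omega> t * m t powr - (1/2))"
    have A: "(\<integral>\<^sup>+t. ennreal (?T t) \<partial>lborel) \<le> ennreal (2 * m r powr (1/2))"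
    proof -
      let ?f = "\<lambda>t. ennreal (\<omega> t) * indicator {c<..<r} t"
      let ?N = "density lborel ?f"
      have "(\<integral>\<^sup>+t. ennreal (?T t) \<partial>lborel) = (\<integral>\<^sup>+t. ?f t * ennreal (m t powr - (1/2)) \<partial>lborel)"
        by (intro nn_integral_cong) (auto simp: indicator_def ennreal_mult'')
      also have "\<dots> = (\<integral>\<^sup>+t. ennreal (m t powr - (1/2)) \<partial>?N)"
        by (subst nn_integral_density) auto
      also have "\<dots> \<le> ennreal (2 * m r powr (1/2))"
      proof (rule nn_integral_rsqrt_le)
        show "sigma_finite_measure ?N"
          by (rule sigma_finite_density_lborel) (auto simp: ennreal_mult_less_top indicator_def)
        show "AE t in ?N. 0 < m t"
          by (subst AE_density) (auto simp: indicator_def intro!: AE_I2 MS(2) inS split: if_splits)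
        show "0 < m r" by (rule MS(2)[OF r])
        show "emeasure ?N {t \<in> space ?N. m t \<le> z} \<le> ennreal z" for z
        proof -
          have "emeasure ?N {t \<in> space ?N. m t \<le> z} = (\<integral>\<^sup>+t. ?f t * indicator {t. m t \<le> z} t \<partial>lborel)"
            by (subst emeasure_density) auto
          also have "\<dots> \<le> (\<integral>\<^sup>+t\<in>{t \<in> S. m t \<le> z}. ennreal (\<omega> t) \<partial>lborel)"
            by (intro nn_integral_mono) (auto simp: indicator_def intro: inS)
          also have "\<dots> \<le> ennreal z" by (rule sub)
          finally show ?thesis .
        qed
        have "emeasure ?N (space ?N) = M r" by (subst emeasure_density) (auto simp: M_def)
        then show "emeasure ?N (space ?N) \<le> ennreal (m r)" using MS(1)[OF r] by simp
      qed simp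
      finally show ?thesis .
    qed
    have H: "ennreal (h r powr p) \<le> ennreal (2 powr p * (2 * m r powr (1/2)) powr (p - 1)) *
        (\<integral>\<^sup>+t. ennreal (?k t powr p * ?T t powr (1 - p)) \<partial>lborel)"
    proof (rule nn_integral_Holder[OF p])
      show "0 \<le> ?T x" for x using pos[of x] cd by (auto simp: indicator_def)
      show "?k x = 0" if "?T x = 0" for x
        using that pos[of x] cd MS(2)[OF inS, of x] by (auto simp: indicator_def split: if_splits)
      show "ennreal (h r) \<le> (\<integral>\<^sup>+t. ennreal (?k t) \<partial>lborel)"
        using h(2)[OF cd] by (rule order_trans) (auto intro!: nn_integral_mono simp: indicator_def)
      show "0 < 2 * m r powr (1/2)" using MS(2)[OF r] by simp
    qed (use A h(1)[OF cd] k in auto)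
    also have "(\<integral>\<^sup>+t. ennreal (?k t powr p * ?T t powr (1 - p)) \<partial>lborel) = (\<integral>\<^sup>+t\<in>{c<..<r}. ennreal (Q t) \<partial>lborel)"
    proof (rule nn_integral_cong)
      fix t
      show "ennreal (?k t powr p * ?T t powr (1 - p)) = ennreal (Q t) * indicator {c<..<r} t"
      proof (cases "t \<in> {c<..<r}")
        case True
        then have "0 < \<omega> t" using pos[of t] cd by auto
        moreover have "(m t powr - (1/2)) powr (1 - p) = m t powr g"
          by (simp add: powr_powr g_def) (simp add: algebra_simps diff_divide_distrib)
        ultimately show ?thesis using True by (simp add: Q_def powr_mult mult.assoc)
      qed simp
    qed
    also have "2 powr p * (2 * m r powr (1/2)) powr (p - 1) = (2 powr p * 2 powr (p - 1)) * m r powr g"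
      by (simp add: powr_mult powr_powr g_def mult.assoc)
    finally have H: "ennreal (h r powr p) \<le> ennreal ((2 powr p * 2 powr (p - 1)) * m r powr g) * (\<integral>\<^sup>+t\<in>{c<..<r}. ennreal (Q t) \<partial>lborel)" .
    have w: "0 < \<omega> r" using pos cd by auto
    have "ennreal (\<omega> r * m r powr (- p) * h r powr p) = ennreal (\<omega> r * m r powr (- p)) * ennreal (h r powr p)"
      by (simp add: ennreal_mult'')
    also have "\<dots> \<le> ennreal (\<omega> r * m r powr (- p)) * (ennreal ((2 powr p * 2 powr (p - 1)) * m r powr g) * (\<integral>\<^sup>+t\<in>{c<..<r}. ennreal (Q t) \<partial>lborel))"
      by (intro mult_left_mono H) auto
    also have "\<dots> = (ennreal (\<omega> r * m r powr (- p)) * ennreal ((2 powr p * 2 powr (p - 1)) * m r powr g)) * (\<integral>\<^sup>+t\<in>{c<..<r}. ennreal (Q t) \<partial>lborel)"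
      by (simp only: mult.assoc)
    also have "ennreal (\<omega> r * m r powr (- p)) * ennreal ((2 powr p * 2 powr (p - 1)) * m r powr g)
       = ennreal ((2 powr p * 2 powr (p - 1)) * (\<omega> r * (m r powr (- p) * m r powr g)))"
      using w by (subst ennreal_mult[symmetric]) (auto simp: mult_ac)
    also have "m r powr (- p) * m r powr g = m r powr (- p + g)" by (simp only: powr_add)
    also have "- p + g = - 1 - g" by (simp add: g_def field_simps)
    also have "ennreal ((2 powr p * 2 powr (p - 1)) * (\<omega> r * m r powr (- 1 - g))) = ennreal (2 powr p * 2 powr (p - 1)) * ennreal (\<omega> r * m r powr (- 1 - g))"
      using w by (intro ennreal_mult) auto
    finally show ?thesis by (simp only: mult.assoc)
  qed
  have tail: "(\<integral>\<^sup>+r. ennreal (\<omega> r * m r powr (- 1 - g)) * indicator (S \<inter> {t<..}) r \<partial>lborel) \<le> ennreal ((1 + g) / g * m t powr - g)"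
    if t: "c < t" "t < d" for t
  proof (cases "t \<in> S")
    case False
    then have "S \<inter> {t<..} = {}" using S_down t by force
    then show ?thesis by simp
  next
    case True
    let ?f = "\<lambda>r. ennreal (\<omega> r) * indicator (S \<inter> {t<..}) r"
    let ?N = "density lborel ?f"
    have "(\<integral>\<^sup>+r. ennreal (\<omega> r * m r powr (- 1 - g)) * indicator (S \<inter> {t<..}) r \<partial>lborel) = (\<integral>\<^sup>+r. ?f r * ennreal (m r powr (- 1 - g)) \<partial>lborel)"
      by (intro nn_integral_cong) (auto simp: indicator_def ennreal_mult'')
    also have "\<dots> = (\<integral>\<^sup>+r. ennreal (m r powr (- 1 - g)) \<partial>?N)"
      by (subst nn_integral_density) auto
    also have "\<dots> \<le> ennreal ((1 + g) / g * m t powr - g)"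
    proof (rule nn_integral_powr_minus_tail_le)
      show "sigma_finite_measure ?N"
        by (rule sigma_finite_density_lborel) (auto simp: ennreal_mult_less_top indicator_def)
      show "AE r in ?N. m t \<le> m r"
        by (subst AE_density) (auto simp: indicator_def intro!: AE_I2 mmono split: if_splits)
      show "0 < m t" by (rule MS(2)[OF True])
      show "emeasure ?N {r \<in> space ?N. m r \<le> z} \<le> ennreal z" for z
      proof -
        have "emeasure ?N {r \<in> space ?N. m r \<le> z} = (\<integral>\<^sup>+r. ?f r * indicator {t. m t \<le> z} r \<partial>lborel)"
          by (subst emeasure_density) auto
        also have "\<dots> \<le> (\<integral>\<^sup>+t\<in>{t \<in> S. m t \<le> z}. ennreal (\<omega> t) \<partial>lborel)"
          by (intro nn_integral_mono) (auto simp: indicator_def)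
        also have "\<dots> \<le> ennreal z" by (rule sub)
        finally show ?thesis .
      qed
    qed (use g in auto)
    finally show ?thesis .
  qed
  have "(\<integral>\<^sup>+r\<in>{c<..<d}. ennreal (\<omega> r * (LINT t:{c..r}|lborel. \<omega> t) powr (- p) * h r powr p) \<partial>lborel) \<le>
     (\<integral>\<^sup>+r. ennreal (2 powr p * 2 powr (p - 1)) * (ennreal (\<omega> r * m r powr (- 1 - g)) * indicator S r * (\<integral>\<^sup>+t\<in>{c<..<r}. ennreal (Q t) \<partial>lborel)) \<partial>lborel)"
  proof (rule nn_integral_mono)
    fix r
    show "ennreal (\<omega> r * (LINT t:{c..r}|lborel. \<omega> t) powr (- p) * h r powr p) * indicator {c<..<d} r \<le>
      ennreal (2 powr p * 2 powr (p - 1)) * (ennreal (\<omega> r * m r powr (- 1 - g)) * indicator S r * (\<integral>\<^sup>+t\<in>{c<..<r}. ennreal (Q t) \<partial>lborel))"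
    proof (cases "r \<in> S")
      case True
      then show ?thesis using point[OF True] meq[of r] by (simp add: S_def)
    next
      case False
      then have "m r = 0" if "r \<in> {c<..<d}" using that by (auto simp: S_def m_def not_less top_unique)
      then show ?thesis using False meq[of r] by (auto simp: indicator_def)
    qed
  qed
  also have "\<dots> = ennreal (2 powr p * 2 powr (p - 1)) * (\<integral>\<^sup>+r. \<integral>\<^sup>+t. ennreal (\<omega> r * m r powr (- 1 - g)) * indicator S r * (if c < t \<and> t < r then ennreal (Q t) else 0) \<partial>lborel \<partial>lborel)"
  proof -
    have e: "(\<integral>\<^sup>+t\<in>{c<..<r}. ennreal (Q t) \<partial>lborel) = (\<integral>\<^sup>+t. (if c < t \<and> t < r then ennreal (Q t) else 0) \<partial>lborel)" for r
      by (intro nn_integral_cong) auto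
    show ?thesis unfolding e by (subst nn_integral_cmult) (auto simp: nn_integral_cmult)
  qed
  also have "(\<integral>\<^sup>+r. \<integral>\<^sup>+t. ennreal (\<omega> r * m r powr (- 1 - g)) * indicator S r * (if c < t \<and> t < r then ennreal (Q t) else 0) \<partial>lborel \<partial>lborel)
     = (\<integral>\<^sup>+t. \<integral>\<^sup>+r. ennreal (\<omega> r * m r powr (- 1 - g)) * indicator S r * (if c < t \<and> t < r then ennreal (Q t) else 0) \<partial>lborel \<partial>lborel)"
    by (rule lborel_pair.Fubini') measurable
  also have "\<dots> \<le> (\<integral>\<^sup>+t. ennreal ((1 + g) / g) * (ennreal (k t powr p * \<omega> t powr (1 - p)) * indicator {c<..<d} t) \<partial>lborel)"
  proof (rule nn_integral_mono)
    fix t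
    have "(\<integral>\<^sup>+r. ennreal (\<omega> r * m r powr (- 1 - g)) * indicator S r * (if c < t \<and> t < r then ennreal (Q t) else 0) \<partial>lborel)
      = (\<integral>\<^sup>+r. (ennreal (Q t) * indicator {c<..<d} t) * (ennreal (\<omega> r * m r powr (- 1 - g)) * indicator (S \<inter> {t<..}) r) \<partial>lborel)"
      by (intro nn_integral_cong) (auto simp: indicator_def S_def mult_ac)
    also have "\<dots> = (ennreal (Q t) * indicator {c<..<d} t) * (\<integral>\<^sup>+r. ennreal (\<omega> r * m r powr (- 1 - g)) * indicator (S \<inter> {t<..}) r \<partial>lborel)"
      by (rule nn_integral_cmult) measurable
    also have "\<dots> \<le> ennreal ((1 + g) / g) * (ennreal (k t powr p * \<omega> t powr (1 - p)) * indicator {c<..<d} t)"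
    proof (cases "t \<in> {c<..<d}")
      case True
      then have "ennreal (Q t) * (\<integral>\<^sup>+r. ennreal (\<omega> r * m r powr (- 1 - g)) * indicator (S \<inter> {t<..}) r \<partial>lborel) \<le> ennreal (Q t) * ennreal ((1 + g) / g * m t powr - g)"
        by (intro mult_left_mono tail) auto
      also have "\<dots> = ennreal ((1 + g) / g * (k t powr p * \<omega> t powr (1 - p)) * (m t powr g * m t powr - g))"
        using g by (subst ennreal_mult[symmetric]) (auto simp: Q_def mult_ac)
      also have "\<dots> \<le> ennreal ((1 + g) / g * (k t powr p * \<omega> t powr (1 - p)) * 1)"
        using g by (intro ennreal_leI mult_left_mono) (auto simp: powr_minus field_simps)
      also have "\<dots> = ennreal ((1 + g) / g) * ennreal (k t powr p * \<omega> t powr (1 - p))"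
        using g by (subst ennreal_mult[symmetric]) auto
      finally show ?thesis using True by simp
    qed simp
    finally show "(\<integral>\<^sup>+r. ennreal (\<omega> r * m r powr (- 1 - g)) * indicator S r * (if c < t \<and> t < r then ennreal (Q t) else 0) \<partial>lborel)
      \<le> ennreal ((1 + g) / g) * (ennreal (k t powr p * \<omega> t powr (1 - p)) * indicator {c<..<d} t)" .
  qed
  also have "\<dots> = ennreal ((1 + g) / g) * (\<integral>\<^sup>+t\<in>{c<..<d}. ennreal (k t powr p * \<omega> t powr (1 - p)) \<partial>lborel)"
    by (rule nn_integral_cmult) measurable
  finally have "(\<integral>\<^sup>+r\<in>{c<..<d}. ennreal (\<omega> r * (LINT t:{c..r}|lborel. \<omega> t) powr (- p) * h r powr p) \<partial>lborel) \<le>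
    ennreal (2 powr p * 2 powr (p - 1)) * (ennreal ((1 + g) / g) * (\<integral>\<^sup>+t\<in>{c<..<d}. ennreal (k t powr p * \<omega> t powr (1 - p)) \<partial>lborel))"
    by (simp add: mult_left_mono)
  also have "\<dots> = (ennreal (2 powr p * 2 powr (p - 1)) * ennreal ((1 + g) / g)) * (\<integral>\<^sup>+t\<in>{c<..<d}. ennreal (k t powr p * \<omega> t powr (1 - p)) \<partial>lborel)"
    by (simp only: mult.assoc)
  also have "ennreal (2 powr p * 2 powr (p - 1)) * ennreal ((1 + g) / g) = ennreal (2 powr p * 2 powr (p - 1) * ((1 + g) / g))"
    using g by (intro ennreal_mult[symmetric]) auto
  also have "(1 + g) / g = (p + 1) / (p - 1)" using p by (simp add: g_def field_simps)
  finally show ?thesis by (simp only: Hardy_const_def)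
qed

lemma nn_integral_reflect:
  fixes f :: "real \<Rightarrow> ennreal"
  assumes "f \<in> borel_measurable borel"
  shows "(\<integral>\<^sup>+x. f x \<partial>lborel) = (\<integral>\<^sup>+x. f (- x) \<partial>lborel)"
  using nn_integral_real_affine[OF assms, of "-1" 0] by simp

text \<open>The part to the left of \<open>c\<close> is reflected at the origin.\<close>

lemma Hardy_inequality:
  fixes \<omega> k h :: "real \<Rightarrow> real"
  assumes p: "1 < p" and [measurable]: "\<omega> \<in> borel_measurable borel" "k \<in> borel_measurable borel" "h \<in> borel_measurable borel"
    and c: "a < c" "c < b"
    and pos: "\<And>t. a < t \<Longrightarrow> t < b \<Longrightarrow> t \<noteq> c \<Longrightarrow> 0 < \<omega> t" and k: "\<And>t. 0 \<le> k t"
    and h: "\<And>r. a < r \<Longrightarrow> r < b \<Longrightarrow> 0 \<le> h r"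
      "\<And>r. a < r \<Longrightarrow> r < b \<Longrightarrow> ennreal (h r) \<le> (\<integral>\<^sup>+t\<in>{min c r<..<max c r}. ennreal (k t) \<partial>lborel)"
  shows "(\<integral>\<^sup>+r\<in>{a<..<b}. ennreal (\<omega> r * (LINT t:{min c r..max c r}|lborel. \<omega> t) powr (- p) * h r powr p) \<partial>lborel) \<le>
    ennreal (Hardy_const p) * (\<integral>\<^sup>+t\<in>{a<..<b}. ennreal (k t powr p * \<omega> t powr (1 - p)) \<partial>lborel)"
proof -
  let ?F = "\<lambda>r. ennreal (\<omega> r * (LINT t:{min c r..max c r}|lborel. \<omega> t) powr (- p) * h r powr p)"
  let ?R = "\<lambda>t. ennreal (k t powr p * \<omega> t powr (1 - p))"
  define P where "P r = enn2real (\<integral>\<^sup>+t. (if c < t \<and> t < r then ennreal (\<omega> t) else 0) \<partial>lborel)" for r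
  define N where "N r = enn2real (\<integral>\<^sup>+t. (if r < t \<and> t < c then ennreal (\<omega> t) else 0) \<partial>lborel)" for r
  have [measurable]: "P \<in> borel_measurable borel" "N \<in> borel_measurable borel"
    unfolding P_def[abs_def] N_def[abs_def] by measurable
  have P: "(LINT t:{c..r}|lborel. \<omega> t) = P r" if "c < r" "r < b" for r
    unfolding P_def using that c pos
    by (subst set_LINT_Icc_eq_enn2real) (auto intro!: arg_cong[where f = enn2real] nn_integral_cong)
  have N: "(LINT t:{r..c}|lborel. \<omega> t) = N r" if "a < r" "r < c" for r
    unfolding N_def using that c pos
    by (subst set_LINT_Icc_eq_enn2real) (auto intro!: arg_cong[where f = enn2real] nn_integral_cong)
  have N': "(LINT t:{-c..s}|lborel. \<omega> (- t)) = N (- s)" if "- c < s" "s < - a" for s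
  proof -
    have "(LINT t:{-c..s}|lborel. \<omega> (- t)) = (LINT t:{-s..c}|lborel. \<omega> t)"
      by (subst set_integral_reflect) (auto intro!: arg_cong2[where f = "\<lambda>A. set_lebesgue_integral lborel A"])
    then show ?thesis using N[of "- s"] that by simp
  qed
  have split: "(\<integral>\<^sup>+r\<in>{a<..<b}. G r \<partial>lborel) = (\<integral>\<^sup>+r\<in>{a<..<c}. G r \<partial>lborel) + (\<integral>\<^sup>+r\<in>{c<..<b}. G r \<partial>lborel)"
    if [measurable]: "G \<in> borel_measurable borel" for G :: "real \<Rightarrow> ennreal"
  proof -
    have "(\<integral>\<^sup>+r\<in>{a<..<b}. G r \<partial>lborel) = (\<integral>\<^sup>+r. G r * indicator {a<..<c} r + G r * indicator {c<..<b} r \<partial>lborel)"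
    proof (rule nn_integral_cong_AE)
      show "AE r in lborel. G r * indicator {a<..<b} r = G r * indicator {a<..<c} r + G r * indicator {c<..<b} r"
        using AE_lborel_singleton[of c] by eventually_elim (use c in \<open>auto simp: indicator_def\<close>)
    qed
    then show ?thesis by (simp add: nn_integral_add)
  qed
  let ?G = "\<lambda>r. ennreal (\<omega> r * (if r < c then N r else P r) powr (- p) * h r powr p)"
  have "(\<integral>\<^sup>+r\<in>{a<..<b}. ?F r \<partial>lborel) = (\<integral>\<^sup>+r\<in>{a<..<b}. ?G r \<partial>lborel)"
  proof (rule nn_integral_cong_AE)
    show "AE r in lborel. ?F r * indicator {a<..<b} r = ?G r * indicator {a<..<b} r"
      using AE_lborel_singleton[of c]
    proof eventually_elim
      case (elim r)
      then consider "r < c" | "c < r" by linarith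
      then show ?case by cases (auto simp: N P indicator_def min_def max_def)
    qed
  qed
  also have "\<dots> = (\<integral>\<^sup>+r\<in>{a<..<c}. ?G r \<partial>lborel) + (\<integral>\<^sup>+r\<in>{c<..<b}. ?G r \<partial>lborel)"
    by (rule split) measurable
  finally have total: "(\<integral>\<^sup>+r\<in>{a<..<b}. ?F r \<partial>lborel) =
    (\<integral>\<^sup>+r\<in>{a<..<c}. ?G r \<partial>lborel) + (\<integral>\<^sup>+r\<in>{c<..<b}. ?G r \<partial>lborel)" .
  have "(\<integral>\<^sup>+r\<in>{a<..<c}. ?G r \<partial>lborel) = (\<integral>\<^sup>+s. ?G (- s) * indicator {a<..<c} (- s) \<partial>lborel)"
    by (rule nn_integral_reflect) measurable
  also have "\<dots> = (\<integral>\<^sup>+s\<in>{-c<..<-a}. ennreal (\<omega> (- s) * (LINT t:{-c..s}|lborel. \<omega> (- t)) powr (- p) * h (- s) powr p) \<partial>lborel)"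
    by (intro nn_integral_cong) (auto simp: indicator_def N')
  also have "\<dots> \<le> ennreal (Hardy_const p) * (\<integral>\<^sup>+t\<in>{-c<..<-a}. ?R (- t) \<partial>lborel)"
  proof (rule Hardy_inequality_right[OF p])
    fix r assume r: "- c < r" "r < - a"
    show "0 \<le> h (- r)" using h(1)[of "- r"] r c by auto
    have "ennreal (h (- r)) \<le> (\<integral>\<^sup>+t\<in>{- r<..<c}. ennreal (k t) \<partial>lborel)"
      using h(2)[of "- r"] r c by (auto simp: min_def max_def)
    also have "\<dots> = (\<integral>\<^sup>+t. ennreal (k (- t)) * indicator {- r<..<c} (- t) \<partial>lborel)"
      by (rule nn_integral_reflect) measurable
    also have "\<dots> = (\<integral>\<^sup>+t\<in>{- c<..<r}. ennreal (k (- t)) \<partial>lborel)"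
      by (intro nn_integral_cong) (auto simp: indicator_def)
    finally show "ennreal (h (- r)) \<le> (\<integral>\<^sup>+t\<in>{- c<..<r}. ennreal (k (- t)) \<partial>lborel)" .
  qed (use pos c k in auto)
  also have "(\<integral>\<^sup>+t\<in>{-c<..<-a}. ?R (- t) \<partial>lborel) = (\<integral>\<^sup>+t. ?R (- t) * indicator {a<..<c} (- t) \<partial>lborel)"
  proof -
    have "indicator {-c<..<-a} t = (indicator {a<..<c} (- t) :: ennreal)" for t
      by (auto simp: indicator_def)
    then show ?thesis by simp
  qed
  also have "\<dots> = (\<integral>\<^sup>+t\<in>{a<..<c}. ?R t \<partial>lborel)"
    by (rule nn_integral_reflect[symmetric]) measurable
  finally have left: "(\<integral>\<^sup>+r\<in>{a<..<c}. ?G r \<partial>lborel) \<le> ennreal (Hardy_const p) * (\<integral>\<^sup>+t\<in>{a<..<c}. ?R t \<partial>lborel)" .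
  have "(\<integral>\<^sup>+r\<in>{c<..<b}. ?G r \<partial>lborel) = (\<integral>\<^sup>+r\<in>{c<..<b}. ennreal (\<omega> r * (LINT t:{c..r}|lborel. \<omega> t) powr (- p) * h r powr p) \<partial>lborel)"
    by (intro nn_integral_cong) (auto simp: indicator_def P)
  also have "\<dots> \<le> ennreal (Hardy_const p) * (\<integral>\<^sup>+t\<in>{c<..<b}. ?R t \<partial>lborel)"
  proof (rule Hardy_inequality_right[OF p])
    fix r assume r: "c < r" "r < b"
    show "0 \<le> h r" using h(1)[of r] r c by auto
    show "ennreal (h r) \<le> (\<integral>\<^sup>+t\<in>{c<..<r}. ennreal (k t) \<partial>lborel)"
      using h(2)[of r] r c by (auto simp: min_def max_def)
  qed (use pos c k in auto)
  finally have right: "(\<integral>\<^sup>+r\<in>{c<..<b}. ?G r \<partial>lborel) \<le> ennreal (Hardy_const p) * (\<integral>\<^sup>+t\<in>{c<..<b}. ?R t \<partial>lborel)" .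
  have "(\<integral>\<^sup>+r\<in>{a<..<b}. ?F r \<partial>lborel) \<le> ennreal (Hardy_const p) * (\<integral>\<^sup>+t\<in>{a<..<c}. ?R t \<partial>lborel) +
      ennreal (Hardy_const p) * (\<integral>\<^sup>+t\<in>{c<..<b}. ?R t \<partial>lborel)"
    unfolding total by (intro add_mono left right)
  also have "\<dots> = ennreal (Hardy_const p) * (\<integral>\<^sup>+t\<in>{a<..<b}. ?R t \<partial>lborel)"
    by (subst split) (auto simp: distrib_left)
  finally show ?thesis .
qed

definition boundary_const :: "real \<Rightarrow> real" where
  "boundary_const p = 4 * (4 powr p * p powr p)"

text \<open>For \<open>1/2 < y < 1\<close> the weight \<open>y\<^sup>1\<^sup>-\<^sup>2\<^sup>s\<close> is at least \<open>1/2\<close>, and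
\<open>\<bar>g(0) - g(y)\<bar>\<close> is at most the integral of \<open>k\<close>, to which the Hoelder inequality applies with
\<open>T = y\<^sup>e\<close>, \<open>e = -(1-2s)/(p-1)\<close>; the integral of \<open>T\<close> over \<open>(0,1)\<close> is
\<open>(p-1)/(p-2+2s)\<close>. The resulting bound is averaged over \<open>y\<close>. The constant does not depend
on \<open>s\<close>.\<close>

lemma boundary_value_estimate:
  fixes g k :: "real \<Rightarrow> real"
  assumes p: "2 \<le> p" and s: "0 < s" "s \<le> 1"
    and g: "continuous_on {0..1} g" and d: "\<And>y. 0 < y \<Longrightarrow> y < 1 \<Longrightarrow> (g has_real_derivative g' y) (at y)"
    and k: "\<And>y. 0 < y \<Longrightarrow> y < 1 \<Longrightarrow> \<bar>g' y\<bar> \<le> k y" "\<And>y. 0 \<le> k y"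
    and [measurable]: "k \<in> borel_measurable borel" "g1 \<in> borel_measurable borel"
    and g1: "\<And>y. 0 < y \<Longrightarrow> y < 1 \<Longrightarrow> g1 y = g y"
  shows "ennreal ((p - 2 + 2 * s) powr p * \<bar>g 0\<bar> powr p) \<le> ennreal (boundary_const p) *
    ((\<integral>\<^sup>+y\<in>{0<..<1}. ennreal (\<bar>g1 y\<bar> powr p * y powr (1 - 2 * s)) \<partial>lborel) +
     (\<integral>\<^sup>+y\<in>{0<..<1}. ennreal (k y powr p * y powr (1 - 2 * s)) \<partial>lborel))"
proof -
  define \<delta> where "\<delta> = p - 2 + 2 * s"
  define e where "e = - (1 - 2 * s) / (p - 1)"
  define B where "B = (\<integral>\<^sup>+y\<in>{0<..<1}. ennreal (k y powr p * y powr (1 - 2 * s)) \<partial>lborel)"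
  have dl: "0 < \<delta>" "\<delta> \<le> p" using p s by (auto simp: \<delta>_def)
  have e1: "e + 1 = \<delta> / (p - 1)" using p by (simp add: e_def \<delta>_def field_simps)
  then have "0 < e + 1" using dl p by simp
  then have e: "- 1 < e" by simp
  let ?k = "\<lambda>y. indicator {0<..<1} y * k y"
  let ?T = "\<lambda>y. indicator {0<..<1::real} y * y powr e"
  have T: "(\<integral>\<^sup>+y. ennreal (?T y) \<partial>lborel) \<le> ennreal ((p - 1) / \<delta>)"
  proof -
    have "(\<integral>\<^sup>+y. ennreal (?T y) \<partial>lborel) \<le> (\<integral>\<^sup>+y\<in>{0..1}. ennreal (y powr e) \<partial>lborel)"
      by (intro nn_integral_mono) (auto simp: indicator_def)
    also have "\<dots> = ennreal (1 powr (e + 1) / (e + 1))"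
      using e by (intro nn_integral_has_integral_lebesgue' has_integral_powr_from_0) auto
    also have "1 powr (e + 1) / (e + 1) = (p - 1) / \<delta>" unfolding e1 by simp
    finally show ?thesis .
  qed
  have incr: "ennreal (\<bar>g 0 - g y\<bar> powr p) \<le> ennreal (2 powr p * ((p - 1) / \<delta>) powr (p - 1)) * B"
    if y: "0 < y" "y < 1" for y
  proof -
    have "ennreal (\<bar>g 0 - g y\<bar> powr p) \<le> ennreal (2 powr p * ((p - 1) / \<delta>) powr (p - 1)) *
        (\<integral>\<^sup>+y. ennreal (?k y powr p * ?T y powr (1 - p)) \<partial>lborel)"
    proof (rule nn_integral_Holder)
      have "ennreal \<bar>g y - g 0\<bar> \<le> (\<integral>\<^sup>+y\<in>{0<..<y}. ennreal (k y) \<partial>lborel)"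
      proof (rule abs_increment_le_nn_integral)
        show "continuous_on {0..y} g" using g y by (auto intro: continuous_on_subset)
        show "(g has_real_derivative g' x) (at x)" if "0 < x" "x < y" for x using d that y by simp
        show "\<bar>g' x\<bar> \<le> k x" if "0 < x" "x < y" for x using k(1) that y by simp
      qed (use y in auto)
      also have "\<dots> \<le> (\<integral>\<^sup>+y. ennreal (?k y) \<partial>lborel)"
        using y by (intro nn_integral_mono) (auto simp: indicator_def)
      finally show "ennreal \<bar>g 0 - g y\<bar> \<le> (\<integral>\<^sup>+y. ennreal (?k y) \<partial>lborel)"
        by (simp add: abs_minus_commute)
    qed (use p dl T k in \<open>auto simp: indicator_def split: if_splits\<close>)
    also have "(\<integral>\<^sup>+y. ennreal (?k y powr p * ?T y powr (1 - p)) \<partial>lborel) = B"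
      unfolding B_def
    proof (rule nn_integral_cong)
      fix y :: real
      have "e * (1 - p) = 1 - 2 * s" using p by (simp add: e_def field_simps)
      then show "ennreal (?k y powr p * ?T y powr (1 - p)) = ennreal (k y powr p * y powr (1 - 2 * s)) * indicator {0<..<1} y"
        by (simp add: powr_powr indicator_def)
    qed
    finally show ?thesis .
  qed
  have c1: "\<delta> powr p * ((p - 1) / \<delta>) powr (p - 1) \<le> p powr p"
  proof -
    have "\<delta> powr p * ((p - 1) / \<delta>) powr (p - 1) = (\<delta> powr p / \<delta> powr (p - 1)) * (p - 1) powr (p - 1)"
      using p dl by (simp add: powr_divide)
    also have "\<delta> powr p / \<delta> powr (p - 1) = \<delta> powr (p - (p - 1))" by (simp only: powr_diff)
    also have "\<dots> = \<delta>" using dl by simp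
    also have "\<delta> * (p - 1) powr (p - 1) \<le> p * p powr (p - 1)"
      using p dl by (intro mult_mono powr_mono2) auto
    also have "\<dots> = p powr p" using p by (simp add: powr_mult_base)
    finally show ?thesis .
  qed
  have point: "ennreal (\<delta> powr p * \<bar>g 0\<bar> powr p) \<le>
      ennreal (4 powr p * p powr p) * (ennreal (2 * (\<bar>g1 y\<bar> powr p * y powr (1 - 2 * s))) + B)"
    if y: "1 / 2 < y" "y < 1" for y
  proof -
    \<comment> \<open>as \<open>-1 \<le> 1 - 2s \<le> 1\<close> and \<open>1/2 < y < 1\<close>\<close>
    have y1: "1 \<le> 2 * y powr (1 - 2 * s)"
    proof (cases "0 \<le> 1 - 2 * s")
      case True
      have "y powr 1 \<le> y powr (1 - 2 * s)" using y s by (intro powr_mono') auto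
      then show ?thesis using y by simp
    next
      case False
      have "y powr 0 \<le> y powr (1 - 2 * s)" using y False by (intro powr_mono') auto
      then show ?thesis using y by simp
    qed
    have "\<bar>g 0\<bar> powr p \<le> 2 powr p * (\<bar>g y\<bar> powr p + \<bar>g 0 - g y\<bar> powr p)"
    proof -
      have "\<bar>g 0\<bar> \<le> 2 * max \<bar>g y\<bar> \<bar>g 0 - g y\<bar>" 
        using abs_triangle_ineq[of "g 0 - g y" "g y"] max.cobounded1[of "\<bar>g y\<bar>" "\<bar>g 0 - g y\<bar>"]
          max.cobounded2[of "\<bar>g 0 - g y\<bar>" "\<bar>g y\<bar>"] unfolding diff_add_cancel by linarith
      then have "\<bar>g 0\<bar> powr p \<le> (2 * max \<bar>g y\<bar> \<bar>g 0 - g y\<bar>) powr p"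
        using p by (intro powr_mono2) auto
      also have "\<dots> = 2 powr p * max \<bar>g y\<bar> \<bar>g 0 - g y\<bar> powr p" by (simp add: powr_mult)
      also have "max \<bar>g y\<bar> \<bar>g 0 - g y\<bar> powr p \<le> \<bar>g y\<bar> powr p + \<bar>g 0 - g y\<bar> powr p" by (simp add: max_def)
      finally show ?thesis by simp
    qed
    then have "ennreal (\<delta> powr p * \<bar>g 0\<bar> powr p) \<le> ennreal (\<delta> powr p * 2 powr p * (\<bar>g y\<bar> powr p + \<bar>g 0 - g y\<bar> powr p))"
      by (intro ennreal_leI) (simp add: mult.assoc mult_left_mono)
    also have "\<dots> = ennreal (\<delta> powr p * 2 powr p) * (ennreal (\<bar>g y\<bar> powr p) + ennreal (\<bar>g 0 - g y\<bar> powr p))"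
      by (simp add: ennreal_mult ennreal_plus)
    also have "\<dots> \<le> ennreal (\<delta> powr p * 2 powr p) * (ennreal (2 * (\<bar>g1 y\<bar> powr p * y powr (1 - 2 * s))) + ennreal (2 powr p * ((p - 1) / \<delta>) powr (p - 1)) * B)"
    proof (intro mult_left_mono add_mono incr)
      have "\<bar>g y\<bar> powr p * 1 \<le> \<bar>g y\<bar> powr p * (2 * y powr (1 - 2 * s))"
        using y1 by (intro mult_left_mono) auto
      then show "ennreal (\<bar>g y\<bar> powr p) \<le> ennreal (2 * (\<bar>g1 y\<bar> powr p * y powr (1 - 2 * s)))"
        using y by (intro ennreal_leI) (simp add: g1 mult_ac)
    qed (use y in auto)
    also have "\<dots> = ennreal (\<delta> powr p * 2 powr p) * ennreal (2 * (\<bar>g1 y\<bar> powr p * y powr (1 - 2 * s))) +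
       ennreal (2 powr p * 2 powr p * (\<delta> powr p * ((p - 1) / \<delta>) powr (p - 1))) * B"
      by (simp add: distrib_left mult.assoc[symmetric] ennreal_mult[symmetric]) (simp add: mult_ac)
    also have "\<dots> \<le> ennreal (4 powr p * p powr p) * ennreal (2 * (\<bar>g1 y\<bar> powr p * y powr (1 - 2 * s))) + ennreal (4 powr p * p powr p) * B"
    proof (intro add_mono mult_right_mono ennreal_leI)
      have "\<delta> powr p * 2 powr p \<le> p powr p * 4 powr p"
        using dl p by (intro mult_mono powr_mono2) auto
      then show "\<delta> powr p * 2 powr p \<le> 4 powr p * p powr p" by (simp add: mult.commute)
      have "2 powr p * 2 powr p = (4::real) powr p" by (simp add: powr_mult[symmetric])
      then show "2 powr p * 2 powr p * (\<delta> powr p * ((p - 1) / \<delta>) powr (p - 1)) \<le> 4 powr p * p powr p"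
        using c1 by (simp add: mult_left_mono)
    qed auto
    finally show ?thesis by (simp add: distrib_left)
  qed
  have "ennreal (\<delta> powr p * \<bar>g 0\<bar> powr p) * ennreal (1 / 2) = (\<integral>\<^sup>+y. ennreal (\<delta> powr p * \<bar>g 0\<bar> powr p) * indicator {1/2<..<1::real} y \<partial>lborel)"
    by (subst nn_integral_cmult_indicator) auto
  also have "\<dots> \<le> (\<integral>\<^sup>+y. ennreal (4 powr p * p powr p) * (2 * (ennreal (\<bar>g1 y\<bar> powr p * y powr (1 - 2 * s)) * indicator {0<..<1} y) + B * indicator {1/2<..<1} y) \<partial>lborel)"
  proof (rule nn_integral_mono)
    fix y :: real
    show "ennreal (\<delta> powr p * \<bar>g 0\<bar> powr p) * indicator {1/2<..<1} y \<le> ennreal (4 powr p * p powr p) * (2 * (ennreal (\<bar>g1 y\<bar> powr p * y powr (1 - 2 * s)) * indicator {0<..<1} y) + B * indicator {1/2<..<1} y)"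
      using point[of y] by (auto simp: indicator_def ennreal_mult)
  qed
  also have "\<dots> = ennreal (4 powr p * p powr p) * (2 * (\<integral>\<^sup>+y\<in>{0<..<1}. ennreal (\<bar>g1 y\<bar> powr p * y powr (1 - 2 * s)) \<partial>lborel) + B * ennreal (1 / 2))"
    by (simp add: nn_integral_cmult nn_integral_add nn_integral_cmult_indicator)
  also have "\<dots> \<le> ennreal (4 powr p * p powr p) * (2 * (\<integral>\<^sup>+y\<in>{0<..<1}. ennreal (\<bar>g1 y\<bar> powr p * y powr (1 - 2 * s)) \<partial>lborel) + B * ennreal 2)"
    by (intro mult_left_mono add_mono order_refl ennreal_leI) auto
  finally have "2 * (ennreal (\<delta> powr p * \<bar>g 0\<bar> powr p) * ennreal (1 / 2)) \<le> 2 * (ennreal (4 powr p * p powr p) * (2 * (\<integral>\<^sup>+y\<in>{0<..<1}. ennreal (\<bar>g1 y\<bar> powr p * y powr (1 - 2 * s)) \<partial>lborel) + B * ennreal 2))"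
    by (rule mult_left_mono) simp
  also have "2 * (ennreal (\<delta> powr p * \<bar>g 0\<bar> powr p) * ennreal (1 / 2)) = ennreal (\<delta> powr p * \<bar>g 0\<bar> powr p)"
  proof -
    have "ennreal 2 * ennreal (1 / 2) = 1" by (subst ennreal_mult[symmetric]) auto
    then have "2 * ennreal (1 / 2) = 1" by (simp only: ennreal_numeral)
    then show ?thesis by (simp only: mult.left_commute[of 2] mult_1_right)
  qed
  also have "2 * (ennreal (4 powr p * p powr p) * (2 * (\<integral>\<^sup>+y\<in>{0<..<1}. ennreal (\<bar>g1 y\<bar> powr p * y powr (1 - 2 * s)) \<partial>lborel) + B * ennreal 2))
     = ennreal (boundary_const p) * ((\<integral>\<^sup>+y\<in>{0<..<1}. ennreal (\<bar>g1 y\<bar> powr p * y powr (1 - 2 * s)) \<partial>lborel) + B)"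
    by (simp add: boundary_const_def ennreal_mult distrib_left mult_ac)
  finally show ?thesis by (simp add: B_def \<delta>_def)
qed

section \<open>Exchanging a coordinate with the height variable\<close>

lemma measurable_vec_nth_borel [measurable]: "(\<lambda>x::real^'n. x $ i) \<in> borel_measurable borel"
  by (intro borel_measurable_continuous_onI continuous_intros)

lemma measurable_curried:
  fixes F :: "'b::topological_space \<Rightarrow> 'c::topological_space \<Rightarrow> 'd::topological_space"
  assumes F: "(\<lambda>z. F (fst z) (snd z)) \<in> borel_measurable (borel \<Otimes>\<^sub>M borel)"
    and [measurable]: "f \<in> borel_measurable M" "g \<in> borel_measurable M"
  shows "(\<lambda>z. F (f z) (g z)) \<in> borel_measurable M"
  using measurable_compose[OF _ F, of "\<lambda>z. (f z, g z)" M] by simp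

lemma measurable_subst_coord [measurable (raw)]:
  fixes f :: "'a \<Rightarrow> real^'n::finite"
  assumes [measurable]: "f \<in> borel_measurable M" "g \<in> borel_measurable M"
  shows "(\<lambda>z. subst_coord (f z) i (g z)) \<in> borel_measurable M"
proof -
  have "continuous_on UNIV (\<lambda>z::(real^'n) \<times> real. subst_coord (fst z) i (snd z))"
    unfolding subst_coord_def
  proof (intro continuous_on_vec_lambda)
    fix j
    show "continuous_on UNIV (\<lambda>z::(real^'n) \<times> real. if j = i then snd z else fst z $ j)"
      by (cases "j = i") (auto intro!: continuous_intros)
  qed
  then have "(\<lambda>z::(real^'n) \<times> real. subst_coord (fst z) i (snd z)) \<in> borel_measurable borel"
    by (rule borel_measurable_continuous_onI)
  from measurable_compose[OF _ this, of "\<lambda>z. (f z, g z)" M] show ?thesis by simp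
qed

lemma subst_coord_nth [simp]: "subst_coord x i t $ j = (if j = i then t else x $ j)"
  by (simp add: subst_coord_def)

lemma subst_coord_subst_coord [simp]: "subst_coord (subst_coord x i t) i r = subst_coord x i r"
  by (simp add: vec_eq_iff)

lemma subst_coord_self [simp]: "subst_coord x i (x $ i) = x"
  by (simp add: vec_eq_iff)

lemma open_cube: "open (cube :: (real^'n::finite) set)"
proof -
  have "cube = (\<Inter>i. {x::real^'n. 0 < x $ i} \<inter> {x. x $ i < 1})" by (auto simp: cube_def)
  moreover have "open (\<Inter>i. {x::real^'n. 0 < x $ i} \<inter> {x. x $ i < 1})"
    by (intro open_INT open_Int open_Collect_less continuous_intros ballI) auto
  ultimately show ?thesis by simp
qed

lemma cube_borel [measurable]: "(cube :: (real^'n::finite) set) \<in> sets borel"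
  by (rule borel_open[OF open_cube])

lemma subst_coord_in_cube: "x \<in> cube \<Longrightarrow> 0 < t \<Longrightarrow> t < 1 \<Longrightarrow> subst_coord x i t \<in> cube"
  by (simp add: cube_def)

lemma subst_coord_in_cube_iff:
  "subst_coord x i t \<in> cube \<and> 0 < x $ i \<and> x $ i < 1 \<longleftrightarrow> x \<in> cube \<and> 0 < t \<and> t < 1"
  by (auto simp: cube_def split: if_splits)

definition swap_coord :: "'n \<Rightarrow> (real^'n) \<times> real \<Rightarrow> (real^'n) \<times> real" where
  "swap_coord i z = (subst_coord (fst z) i (snd z), fst z $ i)"

lemma swap_coord_measurable [measurable]:
  "(swap_coord i :: (real^'n::finite) \<times> real \<Rightarrow> _) \<in> (borel \<Otimes>\<^sub>M borel) \<rightarrow>\<^sub>M (borel \<Otimes>\<^sub>M borel)"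
  unfolding swap_coord_def by measurable

lemma swap_coord_borel: "(swap_coord i :: (real^'n::finite) \<times> real \<Rightarrow> _) \<in> borel_measurable borel"
  using swap_coord_measurable[of i] by (simp add: borel_prod)

lemma mem_box_vec_real:
  "z \<in> box l u \<longleftrightarrow> fst z \<in> box (fst l) (fst u) \<and> snd z \<in> box (snd l) (snd u)"
  for z l u :: "(real^'n::finite) \<times> real"
  by (cases l; cases u; cases z) (auto simp: mem_box Basis_prod_def)

lemma emeasure_box_vec_real:
  fixes l u :: "(real^'n::finite) \<times> real"
  assumes "\<And>j. fst l $ j \<le> fst u $ j" "snd l \<le> snd u"
  shows "emeasure lborel (box l u) = ennreal ((\<Prod>j\<in>UNIV. fst u $ j - fst l $ j) * (snd u - snd l))"
proof -
  have "box l u = box (fst l) (fst u) \<times> box (snd l) (snd u)"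
    by (auto simp: mem_box_vec_real)
  then have "emeasure lborel (box l u) = emeasure lborel (box (fst l) (fst u)) * emeasure lborel (box (snd l) (snd u))"
    by (simp add: lborel_prod[symmetric] lborel.emeasure_pair_measure_Times del: lborel_prod)
  also have "emeasure lborel (box (fst l) (fst u)) = ennreal (\<Prod>b\<in>Basis. (fst u - fst l) \<bullet> b)"
    using assms(1) by (intro emeasure_lborel_box) (auto simp: Basis_vec_def inner_axis)
  also have "(\<Prod>b\<in>Basis. (fst u - fst l) \<bullet> b) = (\<Prod>j\<in>UNIV. fst u $ j - fst l $ j)"
  proof -
    have B: "Basis = range (\<lambda>j. axis j (1::real) :: real^'n)" by (auto simp: Basis_vec_def)
    have inj: "inj (\<lambda>j. axis j (1::real) :: real^'n)" by (auto simp: inj_on_def axis_eq_axis)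
    show ?thesis
      unfolding B prod.reindex[OF inj] by (simp add: inner_axis)
  qed
  also have "emeasure lborel (box (snd l) (snd u)) = ennreal (snd u - snd l)"
    using assms(2) by simp
  finally show ?thesis using assms by (simp add: ennreal_mult prod_nonneg)
qed

text \<open>A permutation of the coordinates maps boxes to boxes of the same volume.\<close>

lemma distr_swap_coord: "distr lborel borel (swap_coord i) = (lborel :: ((real^'n::finite) \<times> real) measure)"
proof (rule lborel_eqI[symmetric])
  fix l u :: "(real^'n) \<times> real"
  assume le: "\<And>b. b \<in> Basis \<Longrightarrow> l \<bullet> b \<le> u \<bullet> b"
  have 1: "fst l $ j \<le> fst u $ j" for j
    using le[of "(axis j 1, 0)"] by (cases l; cases u) (auto simp: Basis_prod_def Basis_vec_def inner_axis)
  have 2: "snd l \<le> snd u"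
    using le[of "(0, 1)"] by (cases l; cases u) (auto simp: Basis_prod_def)
  have bx: "z \<in> box l u \<longleftrightarrow> (\<forall>j. fst l $ j < fst z $ j \<and> fst z $ j < fst u $ j) \<and> snd l < snd z \<and> snd z < snd u"
    for z l u :: "(real^'n) \<times> real"
    by (auto simp: mem_box_vec_real mem_box_cart)
  have "swap_coord i -` box l u = box (swap_coord i l) (swap_coord i u)"
  proof (rule set_eqI)
    fix z
    show "z \<in> swap_coord i -` box l u \<longleftrightarrow> z \<in> box (swap_coord i l) (swap_coord i u)"
      by (auto simp: bx swap_coord_def split: if_splits)
  qed
  then have "emeasure (distr lborel borel (swap_coord i)) (box l u) = emeasure lborel (box (swap_coord i l) (swap_coord i u))"
    by (subst emeasure_distr) (auto simp: swap_coord_borel)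
  also have "\<dots> = ennreal ((\<Prod>j\<in>UNIV. fst (swap_coord i u) $ j - fst (swap_coord i l) $ j) * (snd (swap_coord i u) - snd (swap_coord i l)))"
    using 1 2 by (intro emeasure_box_vec_real) (auto simp: swap_coord_def)
  also have "(\<Prod>j\<in>UNIV. fst (swap_coord i u) $ j - fst (swap_coord i l) $ j) * (snd (swap_coord i u) - snd (swap_coord i l))
     = (\<Prod>j\<in>UNIV. fst u $ j - fst l $ j) * (snd u - snd l)"
  proof -
    have "(\<Prod>j\<in>UNIV. fst (swap_coord i u) $ j - fst (swap_coord i l) $ j)
       = (snd u - snd l) * (\<Prod>j\<in>UNIV - {i}. fst u $ j - fst l $ j)"
      by (subst prod.remove[of UNIV i]) (auto simp: swap_coord_def intro!: prod.cong)
    moreover have "(\<Prod>j\<in>UNIV. fst u $ j - fst l $ j) = (fst u $ i - fst l $ i) * (\<Prod>j\<in>UNIV - {i}. fst u $ j - fst l $ j)"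
      by (rule prod.remove) auto
    ultimately show ?thesis by (simp add: swap_coord_def)
  qed
  also have "ennreal \<dots> = emeasure lborel (box l u)"
    using 1 2 by (intro emeasure_box_vec_real[symmetric])
  also have "\<dots> = (\<Prod>b\<in>Basis. (u - l) \<bullet> b)" using le by (rule emeasure_lborel_box)
  finally show "emeasure (distr lborel borel (swap_coord i)) (box l u) = (\<Prod>b\<in>Basis. (u - l) \<bullet> b)" .
qed simp

lemma nn_integral_vec_real:
  fixes F :: "(real^'n::finite) \<times> real \<Rightarrow> ennreal"
  assumes "F \<in> borel_measurable (borel \<Otimes>\<^sub>M borel)"
  shows "(\<integral>\<^sup>+z. F z \<partial>lborel) = (\<integral>\<^sup>+x. \<integral>\<^sup>+t. F (x, t) \<partial>lborel \<partial>lborel)"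
  unfolding lborel_prod[symmetric] using assms by (intro lborel.nn_integral_fst[symmetric]) (simp add: borel_prod lborel_prod)

lemma nn_integral_cube_slab:
  fixes H :: "(real^'n::finite) \<times> real \<Rightarrow> ennreal"
  assumes [measurable]: "H \<in> borel_measurable (borel \<Otimes>\<^sub>M borel)"
  shows "(\<integral>\<^sup>+z. H z * indicator (cube \<times> {0<..<1}) z \<partial>lborel) = (\<integral>\<^sup>+x\<in>cube. (\<integral>\<^sup>+t\<in>{0<..<1}. H (x, t) \<partial>lborel) \<partial>lborel)"
proof -
  have "(\<integral>\<^sup>+z. H z * indicator (cube \<times> {0<..<1}) z \<partial>lborel) = (\<integral>\<^sup>+x. \<integral>\<^sup>+t. H (x, t) * indicator (cube \<times> {0<..<1}) (x, t) \<partial>lborel \<partial>lborel)"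
    by (rule nn_integral_vec_real) measurable
  also have "\<dots> = (\<integral>\<^sup>+x\<in>cube. (\<integral>\<^sup>+t\<in>{0<..<1}. H (x, t) \<partial>lborel) \<partial>lborel)"
    by (intro nn_integral_cong) (auto simp: indicator_def intro!: nn_integral_cong)
  finally show ?thesis .
qed

text \<open>The slab is invariant under the exchange of the two variables, both of which range over
\<open>(0,1)\<close>.\<close>

lemma nn_integral_swap_coord:
  fixes F :: "real^'n::finite \<Rightarrow> real \<Rightarrow> ennreal"
  assumes F: "(\<lambda>z. F (fst z) (snd z)) \<in> borel_measurable (borel \<Otimes>\<^sub>M borel)"
  shows "(\<integral>\<^sup>+x\<in>cube. (\<integral>\<^sup>+t\<in>{0<..<1}. F (subst_coord x i t) (x $ i) \<partial>lborel) \<partial>lborel) =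
    (\<integral>\<^sup>+x\<in>cube. (\<integral>\<^sup>+t\<in>{0<..<1}. F x t \<partial>lborel) \<partial>lborel)"
proof -
  note [measurable] = F and [measurable (raw)] = measurable_curried[OF F]
  let ?F = "\<lambda>z. F (fst z) (snd z) * indicator (cube \<times> {0<..<1}) z"
  have m: "(\<lambda>z. F (fst (swap_coord i z)) (snd (swap_coord i z))) \<in> borel_measurable (borel \<Otimes>\<^sub>M borel)"
    unfolding swap_coord_def by measurable
  have "(\<integral>\<^sup>+x\<in>cube. (\<integral>\<^sup>+t\<in>{0<..<1}. F (subst_coord x i t) (x $ i) \<partial>lborel) \<partial>lborel)
      = (\<integral>\<^sup>+z. F (fst (swap_coord i z)) (snd (swap_coord i z)) * indicator (cube \<times> {0<..<1}) z \<partial>lborel)"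
    using nn_integral_cube_slab[OF m] by (simp add: swap_coord_def)
  also have "\<dots> = (\<integral>\<^sup>+z. ?F (swap_coord i z) \<partial>lborel)"
    using subst_coord_in_cube_iff[of _ i]
    by (intro nn_integral_cong) (auto simp: indicator_def swap_coord_def)
  also have "\<dots> = (\<integral>\<^sup>+z. ?F z \<partial>distr lborel borel (swap_coord i))"
  proof -
    have "?F \<in> borel_measurable (borel \<Otimes>\<^sub>M borel)" by measurable
    then have "?F \<in> borel_measurable borel" by (simp add: borel_prod)
    then show ?thesis by (subst nn_integral_distr) (auto simp: swap_coord_borel)
  qed
  also have "\<dots> = (\<integral>\<^sup>+x\<in>cube. (\<integral>\<^sup>+t\<in>{0<..<1}. F x t \<partial>lborel) \<partial>lborel)"
    unfolding distr_swap_coord using nn_integral_cube_slab[OF F] by simp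
  finally show ?thesis .
qed

lemma nn_integral_lebesgue_on:
  assumes "S \<in> sets borel"
  shows "nn_integral (lebesgue_on S) f = (\<integral>\<^sup>+x\<in>S. f x \<partial>lborel)"
  using assms by (simp add: nn_integral_restrict_space nn_integral_completion)

text \<open>By the exchange of variables, integrating over the whole cube and over the replaced coordinate
amounts to integrating over the cube once.\<close>

lemma seminorm_pow_eq:
  fixes w :: "'n::finite \<Rightarrow> real^'n \<Rightarrow> real \<Rightarrow> real"
  assumes w: "(\<lambda>z. w i (fst z) (snd z)) \<in> borel_measurable (borel \<Otimes>\<^sub>M borel)" and v: "v \<in> borel_measurable borel"
  shows "seminorm_pow p w i v =
    (\<integral>\<^sup>+x\<in>cube. (\<integral>\<^sup>+\<tau>\<in>{0<..<1}. ennreal (w i x \<tau> * \<bar>v x - v (subst_coord x i \<tau>)\<bar> powr p) \<partial>lborel) \<partial>lborel)"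
proof -
  note [measurable] = v and [measurable (raw)] = measurable_curried[OF w]
  let ?F = "\<lambda>x. (\<integral>\<^sup>+\<tau>\<in>{0<..<1}. ennreal (w i x \<tau> * \<bar>v x - v (subst_coord x i \<tau>)\<bar> powr p) \<partial>lborel)"
  have "seminorm_pow p w i v = (\<integral>\<^sup>+x\<in>cube. (\<integral>\<^sup>+t\<in>{0<..<1}. ?F (subst_coord x i t) \<partial>lborel) \<partial>lborel)"
    by (simp add: seminorm_pow_def nn_integral_lebesgue_on)
  also have "\<dots> = (\<integral>\<^sup>+x\<in>cube. (\<integral>\<^sup>+t\<in>{0<..<1::real}. ?F x \<partial>lborel) \<partial>lborel)"
    by (rule nn_integral_swap_coord[of "\<lambda>x t. ?F x"]) measurable
  also have "\<dots> = (\<integral>\<^sup>+x\<in>cube. ?F x \<partial>lborel)"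
    by (simp add: nn_integral_cmult_indicator)
  finally show ?thesis .
qed

lemma seminorm_pow_cong:
  assumes "\<And>x. x \<in> cube \<Longrightarrow> v x = v' x"
  shows "seminorm_pow p w i v = seminorm_pow p w i v'"
  unfolding seminorm_pow_def
  by (intro nn_integral_cong) (auto simp: assms subst_coord_in_cube)

lemma measurable_Phi:
  assumes [measurable]: "s \<in> borel_measurable borel" "G \<in> borel_measurable borel"
  assumes [measurable]: "f \<in> borel_measurable M" "g \<in> borel_measurable M"
  shows "(\<lambda>z. Phi s G i (f z) (g z)) \<in> borel_measurable M"
  unfolding Phi_def by measurable

lemma LINT_lebesgue_eq_lborel:
  fixes f :: "real \<Rightarrow> real"
  assumes [measurable]: "f \<in> borel_measurable borel" "A \<in> sets borel"
  shows "(LINT t:A|lebesgue. f t) = (LINT t:A|lborel. f t)"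
  unfolding set_lebesgue_integral_def by (intro integral_completion) measurable

text \<open>The integration over a variable interval is written with a conditional, which makes the joint
measurability in the parameters visible.\<close>

lemma measurable_direction_weights:
  fixes s G :: "real^'n::finite \<Rightarrow> real"
  assumes sG [measurable]: "s \<in> borel_measurable borel" "G \<in> borel_measurable borel"
  shows "(\<lambda>z. phi_weight p s G i (fst z) (snd z)) \<in> borel_measurable (borel \<Otimes>\<^sub>M borel)"
    and "(\<lambda>z. psi_weight p s G i (fst z) (snd z)) \<in> borel_measurable (borel \<Otimes>\<^sub>M borel)"
proof -
  note [measurable (raw)] = measurable_Phi[OF sG]
  have e: "phi_weight p s G i (fst z) (snd z) = Phi s G i (fst z) (snd z) powr (1 - conj_exp p) *
     (LINT t|lborel. (if min (fst z $ i) (snd z) \<le> t \<and> t \<le> max (fst z $ i) (snd z)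
        then Phi s G i (subst_coord (fst z) i t) (snd z) powr (1 - conj_exp p) else 0)) powr (-p)" for z
    unfolding phi_weight_def
    by (subst LINT_lebesgue_eq_lborel)
       (auto simp: set_lebesgue_integral_def intro!: arg_cong2[where f = "(*)"] arg_cong2[where f = "(powr)"] Bochner_Integration.integral_cong)
  show "(\<lambda>z. phi_weight p s G i (fst z) (snd z)) \<in> borel_measurable (borel \<Otimes>\<^sub>M borel)"
    unfolding e by measurable
  have e: "psi_weight p s G i (fst z) (snd z) = Phi s G i (fst z) (snd z) powr (1 - conj_exp p) *
     (LINT t|lborel. (if min (fst z $ i) (snd z) \<le> t \<and> t \<le> max (fst z $ i) (snd z)
        then Phi s G i (fst z) t powr (1 - conj_exp p) else 0)) powr (-p)" for z
    unfolding psi_weight_def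
    by (subst LINT_lebesgue_eq_lborel)
       (auto simp: set_lebesgue_integral_def intro!: arg_cong2[where f = "(*)"] arg_cong2[where f = "(powr)"] Bochner_Integration.integral_cong)
  show "(\<lambda>z. psi_weight p s G i (fst z) (snd z)) \<in> borel_measurable (borel \<Otimes>\<^sub>M borel)"
    unfolding e by measurable
qed

lemma nn_integral_abs_diff_le:
  fixes g :: "real \<Rightarrow> ennreal"
  assumes [measurable]: "g \<in> borel_measurable borel" and c: "0 < c" "c < 1"
  shows "(\<integral>\<^sup>+t\<in>{0<..<1}. g \<bar>c - t\<bar> \<partial>lborel) \<le> 2 * (\<integral>\<^sup>+y\<in>{0<..<1}. g y \<partial>lborel)"
proof -
  let ?g = "\<lambda>y. g y * indicator {0<..<1} y"
  have "(\<integral>\<^sup>+t\<in>{0<..<1}. g \<bar>c - t\<bar> \<partial>lborel) \<le> (\<integral>\<^sup>+t. ?g (c + (-1) * t) + ?g (- c + 1 * t) \<partial>lborel)"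
  proof (rule nn_integral_mono_AE)
    show "AE t in lborel. g \<bar>c - t\<bar> * indicator {0<..<1} t \<le> ?g (c + (-1) * t) + ?g (- c + 1 * t)"
      using AE_lborel_singleton[of c]
    proof eventually_elim
      case (elim t)
      show ?case
      proof (cases "t < c")
        case True
        then show ?thesis using c by (auto simp: indicator_def)
      next
        case False
        then show ?thesis using c elim by (auto simp: indicator_def)
      qed
    qed
  qed
  also have "\<dots> = (\<integral>\<^sup>+t. ?g (c + (-1) * t) \<partial>lborel) + (\<integral>\<^sup>+t. ?g (- c + 1 * t) \<partial>lborel)"
    by (rule nn_integral_add) measurable
  also have "(\<integral>\<^sup>+t. ?g (c + (-1) * t) \<partial>lborel) = (\<integral>\<^sup>+y. ?g y \<partial>lborel)"
    using nn_integral_real_affine[of ?g "-1" c] by simp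
  also have "(\<integral>\<^sup>+t. ?g (- c + 1 * t) \<partial>lborel) = (\<integral>\<^sup>+y. ?g y \<partial>lborel)"
    using nn_integral_real_affine[of ?g 1 "- c"] by simp
  finally show ?thesis by (simp add: mult_2)
qed

section \<open>The trace estimate for smooth functions\<close>

lemma open_cube_slab: "open ((cube :: (real^'n::finite) set) \<times> {0<..<1::real})"
  by (intro open_Times open_cube) auto

text \<open>Both cylinders of the theorem are instances. The weights are Borel functions that satisfy their
bounds everywhere; the general case is reduced to this one at the end.\<close>

locale slab_domain =
  fixes p :: real and s G :: "real^'n::finite \<Rightarrow> real" and U :: "((real^'n) \<times> real) set"
  assumes p: "2 \<le> p"
    and s_borel [measurable]: "s \<in> borel_measurable borel" and G_borel [measurable]: "G \<in> borel_measurable borel"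
    and G_pos: "\<And>x. 0 < G x" and s_pos: "\<And>x. 0 < s x" and s_le_1: "\<And>x. s x \<le> 1"
    and U_open: "open U" and slab_subset: "cube \<times> {0<..<1} \<subseteq> U" and subset_half: "U \<subseteq> cube \<times> {0<..}"
begin

lemma U_borel: "U \<in> sets borel"
  using U_open by (rule borel_open)

lemma closed_slab_subset: "cube \<times> {0..1} \<subseteq> closure U"
proof -
  have "cube \<times> {0..1} \<subseteq> closure (cube :: (real^'n) set) \<times> closure {0<..<1::real}"
    using closure_subset by (intro Sigma_mono) auto
  also have "\<dots> = closure (cube \<times> {0<..<1})" by (simp add: closure_Times)
  also have "\<dots> \<subseteq> closure U" using slab_subset by (rule closure_mono)
  finally show ?thesis .
qed

text \<open>Cut off to the closed slab, a function that is smooth up to the boundary becomes Borel measurable on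
the whole space.\<close>

definition slab_fun :: "((real^'n) \<times> real \<Rightarrow> real) \<Rightarrow> real^'n \<Rightarrow> real \<Rightarrow> real" where
  "slab_fun f x y = (if (x, y) \<in> cube \<times> {0..1} then f (x, y) else 0)"

definition slab_grad :: "((real^'n) \<times> real \<Rightarrow> real) \<Rightarrow> real^'n \<Rightarrow> real \<Rightarrow> real" where
  "slab_grad f x y = (if (x, y) \<in> cube \<times> {0<..<1} then norm (classical_gradient f (x, y)) else 0)"

definition energy_density :: "((real^'n) \<times> real \<Rightarrow> real) \<Rightarrow> real^'n \<Rightarrow> real \<Rightarrow> real" where
  "energy_density f x y = slab_grad f x y powr p * (G x * y powr (1 - 2 * s x))"

lemma slab_grad_nonneg: "0 \<le> slab_grad f x y" by (simp add: slab_grad_def)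

lemma slab_fun_measurable:
  assumes "smooth_upto U f"
  shows "(\<lambda>z. slab_fun f (fst z) (snd z)) \<in> borel_measurable (borel \<Otimes>\<^sub>M borel)"
proof -
  have "continuous_on (cube \<times> {0..1}) f"
    using assms closed_slab_subset by (auto simp: smooth_upto_def intro: continuous_on_subset)
  moreover have "cube \<times> {0..1} \<in> sets (borel :: ((real^'n) \<times> real) measure)"
    unfolding borel_prod[symmetric] by measurable
  ultimately have "(\<lambda>z. indicator (cube \<times> {0..1}) z *\<^sub>R f z) \<in> borel_measurable borel"
    by (intro borel_measurable_continuous_on_indicator)
  also have "(\<lambda>z. indicator (cube \<times> {0..1}) z *\<^sub>R f z) = (\<lambda>z. slab_fun f (fst z) (snd z))"
    by (auto simp: slab_fun_def fun_eq_iff indicator_def)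
  finally show ?thesis by (simp add: borel_prod)
qed

lemma slab_grad_measurable:
  assumes "smooth_upto U f"
  shows "(\<lambda>z. slab_grad f (fst z) (snd z)) \<in> borel_measurable (borel \<Otimes>\<^sub>M borel)"
proof -
  have "continuous_on (cube \<times> {0<..<1}) (\<lambda>z. norm (classical_gradient f z))"
    using classical_gradient_continuous_on[OF assms] slab_subset
    by (intro continuous_on_norm) (rule continuous_on_subset)
  then have "(\<lambda>z. indicator (cube \<times> {0<..<1}) z *\<^sub>R norm (classical_gradient f z)) \<in> borel_measurable borel"
    by (intro borel_measurable_continuous_on_indicator borel_open open_cube_slab)
  also have "(\<lambda>z. indicator (cube \<times> {0<..<1}) z *\<^sub>R norm (classical_gradient f z)) = (\<lambda>z. slab_grad f (fst z) (snd z))"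
    by (auto simp: slab_grad_def fun_eq_iff indicator_def)
  finally show ?thesis by (simp add: borel_prod)
qed

lemma energy_density_measurable:
  assumes f: "smooth_upto U f"
  shows "(\<lambda>z. energy_density f (fst z) (snd z)) \<in> borel_measurable (borel \<Otimes>\<^sub>M borel)"
proof -
  note [measurable] = slab_grad_measurable[OF f]
  show ?thesis unfolding energy_density_def by measurable
qed

lemma slab_energy_le_Lp_pow:
  fixes q :: "real^'n \<Rightarrow> real \<Rightarrow> real" and g :: "(real^'n) \<times> real \<Rightarrow> 'b::real_normed_vector"
  assumes q: "(\<lambda>z. q (fst z) (snd z)) \<in> borel_measurable (borel \<Otimes>\<^sub>M borel)"
    and eq: "\<And>x y. x \<in> cube \<Longrightarrow> 0 < y \<Longrightarrow> y < 1 \<Longrightarrow> \<bar>q x y\<bar> = norm (g (x, y))"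
  shows "(\<integral>\<^sup>+x\<in>cube. (\<integral>\<^sup>+y\<in>{0<..<1}. ennreal (\<bar>q x y\<bar> powr p * (G x * y powr (1 - 2 * s x))) \<partial>lborel) \<partial>lborel)
    \<le> Lp_pow p U (cyl_weight s G) g"
proof -
  note [measurable] = q
  let ?H = "\<lambda>z. ennreal (\<bar>q (fst z) (snd z)\<bar> powr p * (G (fst z) * snd z powr (1 - 2 * s (fst z))))"
  have "(\<integral>\<^sup>+x\<in>cube. (\<integral>\<^sup>+y\<in>{0<..<1}. ennreal (\<bar>q x y\<bar> powr p * (G x * y powr (1 - 2 * s x))) \<partial>lborel) \<partial>lborel)
    = (\<integral>\<^sup>+z. ?H z * indicator (cube \<times> {0<..<1}) z \<partial>lborel)"
    by (subst nn_integral_cube_slab) auto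
  also have "\<dots> \<le> (\<integral>\<^sup>+z\<in>U. ennreal (norm (g z) powr p * cyl_weight s G z) \<partial>lborel)"
    using slab_subset by (intro nn_integral_mono) (auto simp: indicator_def eq cyl_weight_def)
  also have "\<dots> = Lp_pow p U (cyl_weight s G) g"
    unfolding Lp_pow_def using U_borel by (simp add: nn_integral_lebesgue_on)
  finally show ?thesis .
qed

text \<open>The path runs at unit speed in the vertical direction and with velocity \<open>V\<close>, of norm at most
one, in the horizontal directions, so its speed is at most \<open>2\<close>. The cases needed are
\<open>V = 0\<close> and \<open>V\<close> a coordinate direction.\<close>

lemma path_increment:
  assumes f: "smooth_upto U f" and ab: "a \<le> b" and sg: "\<bar>\<sigma>\<bar> = 1"
    and X: "\<And>t. (X has_vector_derivative V) (at t)" "norm V \<le> 1"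
    and cube: "\<And>t. a \<le> t \<Longrightarrow> t \<le> b \<Longrightarrow> X t \<in> cube"
    and y: "\<And>t. a \<le> t \<Longrightarrow> t \<le> b \<Longrightarrow> 0 \<le> \<sigma> * (t - c) \<and> \<sigma> * (t - c) \<le> 1"
    and y': "\<And>t. a < t \<Longrightarrow> t < b \<Longrightarrow> 0 < \<sigma> * (t - c) \<and> \<sigma> * (t - c) < 1"
  shows "ennreal \<bar>slab_fun f (X b) (\<sigma> * (b - c)) - slab_fun f (X a) (\<sigma> * (a - c))\<bar> \<le>
    (\<integral>\<^sup>+t\<in>{a<..<b}. ennreal (2 * slab_grad f (X t) (\<sigma> * (t - c))) \<partial>lborel)"
proof -
  let ?z = "\<lambda>t. (X t, \<sigma> * (t - c))"
  have Xc: "continuous_on A X" for A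
    using X(1) by (meson continuous_at_imp_continuous_on has_vector_derivative_continuous)
  then have [measurable]: "X \<in> borel_measurable borel" by (intro borel_measurable_continuous_onI)
  note [measurable (raw)] = measurable_curried[OF slab_grad_measurable[OF f]]
  have "ennreal \<bar>f (?z b) - f (?z a)\<bar> \<le> (\<integral>\<^sup>+t\<in>{a<..<b}. ennreal (2 * slab_grad f (X t) (\<sigma> * (t - c))) \<partial>lborel)"
  proof (rule abs_increment_le_nn_integral[OF ab, where h' = "\<lambda>t. frechet_derivative f (at (?z t)) (V, \<sigma>)"])
    have cf: "continuous_on (closure U) f" using f by (simp add: smooth_upto_def)
    have "?z t \<in> closure U" if "t \<in> {a..b}" for t
      using that cube[of t] y[of t] by (intro subsetD[OF closed_slab_subset]) auto
    then show "continuous_on {a..b} (\<lambda>t. f (?z t))"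
      by (intro continuous_on_compose2[OF cf] continuous_intros Xc) auto
    fix t assume t: "a < t" "t < b"
    have zs: "?z t \<in> cube \<times> {0<..<1}" using cube[of t] y'[OF t] t by auto
    then have zU: "?z t \<in> U" using slab_subset by blast
    have df: "f differentiable (at (?z t))" by (rule smooth_upto_differentiable[OF f zU])
    have "(?z has_derivative (\<lambda>h. (h *\<^sub>R V, \<sigma> * h))) (at t)"
      using X(1)[of t] unfolding has_vector_derivative_def
      by (auto intro!: derivative_eq_intros)
    then have "((f \<circ> ?z) has_derivative frechet_derivative f (at (?z t)) \<circ> (\<lambda>h. (h *\<^sub>R V, \<sigma> * h))) (at t)"
      using df by (intro diff_chain_at) (auto simp: frechet_derivative_works)
    moreover have "frechet_derivative f (at (?z t)) \<circ> (\<lambda>h. (h *\<^sub>R V, \<sigma> * h)) = (*) (frechet_derivative f (at (?z t)) (V, \<sigma>))"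
    proof
      fix h
      show "(frechet_derivative f (at (?z t)) \<circ> (\<lambda>h. (h *\<^sub>R V, \<sigma> * h))) h = frechet_derivative f (at (?z t)) (V, \<sigma>) * h"
        using linear_cmul[OF linear_frechet_derivative[OF df], of h "(V, \<sigma>)"] by (simp add: mult.commute)
    qed
    ultimately show "((\<lambda>t. f (?z t)) has_real_derivative frechet_derivative f (at (?z t)) (V, \<sigma>)) (at t)"
      by (simp add: has_field_derivative_def o_def)
    have "\<bar>frechet_derivative f (at (?z t)) (V, \<sigma>)\<bar> \<le> norm (classical_gradient f (?z t)) * norm (V, \<sigma>)"
      unfolding classical_gradient_inner[OF df] by (rule Cauchy_Schwarz_ineq2)
    also have "norm (V, \<sigma>) \<le> 2" using norm_Pair_le[of V \<sigma>] X(2) sg by simp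
    also have "norm (classical_gradient f (?z t)) * 2 = 2 * slab_grad f (X t) (\<sigma> * (t - c))"
      using zs by (simp add: slab_grad_def)
    finally show "\<bar>frechet_derivative f (at (?z t)) (V, \<sigma>)\<bar> \<le> 2 * slab_grad f (X t) (\<sigma> * (t - c))"
      by (simp add: mult_left_mono)
  qed measurable
  moreover have "slab_fun f (X b) (\<sigma> * (b - c)) = f (?z b)" "slab_fun f (X a) (\<sigma> * (a - c)) = f (?z a)"
    using cube y ab by (auto simp: slab_fun_def)
  ultimately show ?thesis by simp
qed

lemma path_increment_abs:
  assumes f: "smooth_upto U f" and c: "0 < c" "c < 1" and r: "0 < r" "r < 1"
    and X: "\<And>t. (X has_vector_derivative V) (at t)" "norm V \<le> 1"
    and cube: "\<And>t. 0 < t \<Longrightarrow> t < 1 \<Longrightarrow> X t \<in> cube"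
  shows "ennreal \<bar>slab_fun f (X c) 0 - slab_fun f (X r) \<bar>r - c\<bar>\<bar> \<le>
    (\<integral>\<^sup>+t\<in>{min c r<..<max c r}. ennreal (2 * slab_grad f (X t) \<bar>t - c\<bar>) \<partial>lborel)"
proof -
  consider "c \<le> r" | "r < c" by linarith
  then show ?thesis
  proof cases
    case 1
    have "ennreal \<bar>slab_fun f (X r) (1 * (r - c)) - slab_fun f (X c) (1 * (c - c))\<bar> \<le>
      (\<integral>\<^sup>+t\<in>{c<..<r}. ennreal (2 * slab_grad f (X t) (1 * (t - c))) \<partial>lborel)"
      using 1 c r cube by (intro path_increment[OF f _ _ X]) auto
    also have "\<dots> = (\<integral>\<^sup>+t\<in>{min c r<..<max c r}. ennreal (2 * slab_grad f (X t) \<bar>t - c\<bar>) \<partial>lborel)"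
      using 1 by (intro nn_integral_cong) (auto simp: indicator_def)
    finally show ?thesis using 1 by (simp add: abs_minus_commute)
  next
    case 2
    have "ennreal \<bar>slab_fun f (X c) (-1 * (c - c)) - slab_fun f (X r) (-1 * (r - c))\<bar> \<le>
      (\<integral>\<^sup>+t\<in>{r<..<c}. ennreal (2 * slab_grad f (X t) (-1 * (t - c))) \<partial>lborel)"
      using 2 c r cube by (intro path_increment[OF f _ _ X]) auto
    also have "\<dots> = (\<integral>\<^sup>+t\<in>{min c r<..<max c r}. ennreal (2 * slab_grad f (X t) \<bar>t - c\<bar>) \<partial>lborel)"
      using 2 by (intro nn_integral_cong) (auto simp: indicator_def)
    finally show ?thesis using 2 by simp
  qed
qed

text \<open>Since \<open>(1-p')(1-p) = 1\<close>, the weight \<open>\<omega>\<^sup>1\<^sup>-\<^sup>p\<close> produced by the Hardy inequality is the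
restriction of the cylinder weight to the path.\<close>

lemma path_Hardy:
  assumes f: "smooth_upto U f" and c: "0 < c" "c < 1"
    and X: "\<And>t. (X has_vector_derivative V) (at t)" "norm V \<le> 1"
    and cube: "\<And>t. 0 < t \<Longrightarrow> t < 1 \<Longrightarrow> X t \<in> cube"
  defines "\<omega> \<equiv> \<lambda>t. (G (X t) * \<bar>t - c\<bar> powr (1 - 2 * s (X t))) powr (1 - conj_exp p)"
  shows "(\<integral>\<^sup>+t\<in>{0<..<1}. ennreal (\<omega> t * (LINT t':{min c t..max c t}|lborel. \<omega> t') powr (- p) *
        \<bar>slab_fun f (X c) 0 - slab_fun f (X t) \<bar>t - c\<bar>\<bar> powr p) \<partial>lborel) \<le>
    ennreal (Hardy_const p * 2 powr p) * (\<integral>\<^sup>+t\<in>{0<..<1}. ennreal (energy_density f (X t) \<bar>t - c\<bar>) \<partial>lborel)"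
proof -
  have "continuous_on UNIV X"
    using X(1) by (meson continuous_at_imp_continuous_on has_vector_derivative_continuous)
  then have [measurable]: "X \<in> borel_measurable borel" by (intro borel_measurable_continuous_onI)
  note [measurable (raw)] = measurable_curried[OF slab_grad_measurable[OF f]]
    measurable_curried[OF slab_fun_measurable[OF f]] measurable_curried[OF energy_density_measurable[OF f]]
  have [measurable]: "\<omega> \<in> borel_measurable borel" unfolding \<omega>_def by measurable
  have p1: "1 < p" using p by simp
  have "(\<integral>\<^sup>+t\<in>{0<..<1}. ennreal (\<omega> t * (LINT t':{min c t..max c t}|lborel. \<omega> t') powr (- p) *
        \<bar>slab_fun f (X c) 0 - slab_fun f (X t) \<bar>t - c\<bar>\<bar> powr p) \<partial>lborel) \<le>
    ennreal (Hardy_const p) * (\<integral>\<^sup>+t\<in>{0<..<1}. ennreal ((2 * slab_grad f (X t) \<bar>t - c\<bar>) powr p * \<omega> t powr (1 - p)) \<partial>lborel)"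
  proof (rule Hardy_inequality[OF p1])
    show "0 < \<omega> t" if "t \<noteq> c" for t
      using that G_pos[of "X t"] by (auto simp: \<omega>_def)
    show "ennreal \<bar>slab_fun f (X c) 0 - slab_fun f (X r) \<bar>r - c\<bar>\<bar> \<le>
        (\<integral>\<^sup>+t\<in>{min c r<..<max c r}. ennreal (2 * slab_grad f (X t) \<bar>t - c\<bar>) \<partial>lborel)" if "0 < r" "r < 1" for r
      by (rule path_increment_abs[OF f c that X cube])
  qed (use c slab_grad_nonneg in auto)
  also have "(\<integral>\<^sup>+t\<in>{0<..<1}. ennreal ((2 * slab_grad f (X t) \<bar>t - c\<bar>) powr p * \<omega> t powr (1 - p)) \<partial>lborel)
    = (\<integral>\<^sup>+t. ennreal (2 powr p) * (ennreal (energy_density f (X t) \<bar>t - c\<bar>) * indicator {0<..<1} t) \<partial>lborel)"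
  proof (rule nn_integral_cong)
    fix t
    have "(1 - conj_exp p) * (1 - p) = 1" using p by (simp add: conj_exp_def field_simps)
    then have "\<omega> t powr (1 - p) = G (X t) * \<bar>t - c\<bar> powr (1 - 2 * s (X t))"
      using G_pos[of "X t"] by (simp add: \<omega>_def powr_powr)
    then have "(2 * slab_grad f (X t) \<bar>t - c\<bar>) powr p * \<omega> t powr (1 - p) = 2 powr p * energy_density f (X t) \<bar>t - c\<bar>"
      using slab_grad_nonneg[of f] by (simp add: energy_density_def powr_mult)
    then show "ennreal ((2 * slab_grad f (X t) \<bar>t - c\<bar>) powr p * \<omega> t powr (1 - p)) * indicator {0<..<1} t
      = ennreal (2 powr p) * (ennreal (energy_density f (X t) \<bar>t - c\<bar>) * indicator {0<..<1} t)"
      by (simp add: ennreal_mult' mult.assoc)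
  qed
  also have "\<dots> = ennreal (2 powr p) * (\<integral>\<^sup>+t\<in>{0<..<1}. ennreal (energy_density f (X t) \<bar>t - c\<bar>) \<partial>lborel)"
    by (rule nn_integral_cmult) measurable
  finally show ?thesis
    using Hardy_const_nonneg[OF p1] by (simp add: ennreal_mult mult.assoc)
qed

abbreviation slab_energy :: "((real^'n) \<times> real \<Rightarrow> real) \<Rightarrow> ennreal" where
  "slab_energy f \<equiv> (\<integral>\<^sup>+x\<in>cube. (\<integral>\<^sup>+y\<in>{0<..<1}. ennreal (energy_density f x y) \<partial>lborel) \<partial>lborel)"

text \<open>For fixed \<open>x\<close> every height below one is attained by \<open>\<bar>x\<^sub>i - t\<bar>\<close> for at most two
\<open>t\<close>.\<close>

lemma folded_energy_le:
  assumes f: "smooth_upto U f"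
  shows "(\<integral>\<^sup>+x\<in>cube. (\<integral>\<^sup>+t\<in>{0<..<1}. ennreal (energy_density f x \<bar>x $ i - t\<bar>) \<partial>lborel) \<partial>lborel) \<le> 2 * slab_energy f"
proof -
  note [measurable (raw)] = measurable_curried[OF energy_density_measurable[OF f]]
  have "(\<integral>\<^sup>+x\<in>cube. (\<integral>\<^sup>+t\<in>{0<..<1}. ennreal (energy_density f x \<bar>x $ i - t\<bar>) \<partial>lborel) \<partial>lborel)
    \<le> (\<integral>\<^sup>+x. 2 * ((\<integral>\<^sup>+y\<in>{0<..<1}. ennreal (energy_density f x y) \<partial>lborel) * indicator cube x) \<partial>lborel)"
  proof (rule nn_integral_mono)
    fix x
    show "(\<integral>\<^sup>+t\<in>{0<..<1}. ennreal (energy_density f x \<bar>x $ i - t\<bar>) \<partial>lborel) * indicator cube x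
      \<le> 2 * ((\<integral>\<^sup>+y\<in>{0<..<1}. ennreal (energy_density f x y) \<partial>lborel) * indicator cube x)"
    proof (cases "x \<in> cube")
      case True
      have "(\<integral>\<^sup>+t\<in>{0<..<1}. ennreal (energy_density f x \<bar>x $ i - t\<bar>) \<partial>lborel) \<le> 2 * (\<integral>\<^sup>+y\<in>{0<..<1}. ennreal (energy_density f x y) \<partial>lborel)"
        using True by (intro nn_integral_abs_diff_le) (auto simp: cube_def)
      then show ?thesis using True by simp
    qed simp
  qed
  also have "\<dots> = 2 * slab_energy f" by (rule nn_integral_cmult) measurable
  finally show ?thesis .
qed

text \<open>The Hardy inequality along the vertical path through \<open>x\<close>.\<close>

lemma vertical_estimate:
  assumes f: "smooth_upto U f"
  shows "(\<integral>\<^sup>+x\<in>cube. (\<integral>\<^sup>+t\<in>{0<..<1}. ennreal (psi_weight p s G i x t * \<bar>slab_fun f x 0 - slab_fun f x \<bar>x $ i - t\<bar>\<bar> powr p) \<partial>lborel) \<partial>lborel)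
    \<le> ennreal (Hardy_const p * 2 powr p) * (2 * slab_energy f)"
proof -
  note [measurable (raw)] = measurable_curried[OF energy_density_measurable[OF f]]
  note [measurable (raw)] = measurable_Phi[OF s_borel G_borel]
  let ?C = "ennreal (Hardy_const p * 2 powr p)"
  have "(\<integral>\<^sup>+x\<in>cube. (\<integral>\<^sup>+t\<in>{0<..<1}. ennreal (psi_weight p s G i x t * \<bar>slab_fun f x 0 - slab_fun f x \<bar>x $ i - t\<bar>\<bar> powr p) \<partial>lborel) \<partial>lborel)
    \<le> (\<integral>\<^sup>+x. ?C * ((\<integral>\<^sup>+t\<in>{0<..<1}. ennreal (energy_density f x \<bar>x $ i - t\<bar>) \<partial>lborel) * indicator cube x) \<partial>lborel)"
  proof (rule nn_integral_mono)
    fix x :: "real^'n"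
    show "(\<integral>\<^sup>+t\<in>{0<..<1}. ennreal (psi_weight p s G i x t * \<bar>slab_fun f x 0 - slab_fun f x \<bar>x $ i - t\<bar>\<bar> powr p) \<partial>lborel) * indicator cube x
      \<le> ?C * ((\<integral>\<^sup>+t\<in>{0<..<1}. ennreal (energy_density f x \<bar>x $ i - t\<bar>) \<partial>lborel) * indicator cube x)"
    proof (cases "x \<in> cube")
      case True
      have psi: "psi_weight p s G i x t = (G x * \<bar>t - x $ i\<bar> powr (1 - 2 * s x)) powr (1 - conj_exp p) *
         (LINT t':{min (x $ i) t..max (x $ i) t}|lborel. (G x * \<bar>t' - x $ i\<bar> powr (1 - 2 * s x)) powr (1 - conj_exp p)) powr (- p)" for t
        unfolding psi_weight_def by (subst LINT_lebesgue_eq_lborel) (auto simp: Phi_def abs_minus_commute)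
      have "(\<integral>\<^sup>+t\<in>{0<..<1}. ennreal (psi_weight p s G i x t * \<bar>slab_fun f x 0 - slab_fun f x \<bar>t - x $ i\<bar>\<bar> powr p) \<partial>lborel)
        \<le> ?C * (\<integral>\<^sup>+t\<in>{0<..<1}. ennreal (energy_density f x \<bar>t - x $ i\<bar>) \<partial>lborel)"
        unfolding psi using True by (intro path_Hardy[OF f, of "x $ i" "\<lambda>_. x" 0]) (auto simp: cube_def)
      then show ?thesis using True by (simp add: abs_minus_commute)
    qed simp
  qed
  also have "\<dots> = ?C * (\<integral>\<^sup>+x\<in>cube. (\<integral>\<^sup>+t\<in>{0<..<1}. ennreal (energy_density f x \<bar>x $ i - t\<bar>) \<partial>lborel) \<partial>lborel)"
    by (rule nn_integral_cmult) measurable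
  also have "\<dots> \<le> ?C * (2 * slab_energy f)" by (intro mult_left_mono folded_energy_le[OF f]) simp
  finally show ?thesis .
qed

lemma has_vector_derivative_subst_coord:
  "((\<lambda>t. subst_coord x i t) has_vector_derivative axis i 1) (at t)"
proof -
  have eq: "(\<lambda>t. subst_coord x i t) = (\<lambda>t. subst_coord x i 0 + t *\<^sub>R axis i (1::real))"
    by (auto simp: fun_eq_iff vec_eq_iff axis_def)
  have "((\<lambda>t. subst_coord x i 0 + t *\<^sub>R axis i (1::real)) has_vector_derivative axis i 1) (at t)"
    by (auto intro!: derivative_eq_intros)
  then show ?thesis by (simp only: eq[symmetric])
qed

text \<open>The exchange of variables makes the end point \<open>(x,0)\<close> of the diagonal path the fixed
parameter, and the Hardy inequality is applied along this path, on both sides of \<open>x\<^sub>i\<close>. A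
second exchange brings the result back to the form of the vertical case.\<close>

lemma diagonal_estimate:
  assumes f: "smooth_upto U f"
  shows "(\<integral>\<^sup>+x\<in>cube. (\<integral>\<^sup>+t\<in>{0<..<1}. ennreal (phi_weight p s G i x t *
      \<bar>slab_fun f (subst_coord x i t) 0 - slab_fun f x \<bar>x $ i - t\<bar>\<bar> powr p) \<partial>lborel) \<partial>lborel)
    \<le> ennreal (Hardy_const p * 2 powr p) * (2 * slab_energy f)"
proof -
  note [measurable (raw)] = measurable_curried[OF energy_density_measurable[OF f]] measurable_curried[OF slab_fun_measurable[OF f]]
  note [measurable (raw)] = measurable_Phi[OF s_borel G_borel]
  note [measurable (raw)] = measurable_curried[OF measurable_direction_weights(1)[OF s_borel G_borel]]
  let ?C = "ennreal (Hardy_const p * 2 powr p)"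
  let ?F = "\<lambda>x t. ennreal (phi_weight p s G i x t * \<bar>slab_fun f (subst_coord x i t) 0 - slab_fun f x \<bar>x $ i - t\<bar>\<bar> powr p)"
  have "(\<integral>\<^sup>+x\<in>cube. (\<integral>\<^sup>+t\<in>{0<..<1}. ?F x t \<partial>lborel) \<partial>lborel)
     = (\<integral>\<^sup>+x\<in>cube. (\<integral>\<^sup>+t\<in>{0<..<1}. ?F (subst_coord x i t) (x $ i) \<partial>lborel) \<partial>lborel)"
    by (rule nn_integral_swap_coord[symmetric]) measurable
  also have "\<dots> \<le> (\<integral>\<^sup>+x. ?C * ((\<integral>\<^sup>+t\<in>{0<..<1}. ennreal (energy_density f (subst_coord x i t) \<bar>t - x $ i\<bar>) \<partial>lborel) * indicator cube x) \<partial>lborel)"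
  proof (rule nn_integral_mono)
    fix x :: "real^'n"
    show "(\<integral>\<^sup>+t\<in>{0<..<1}. ?F (subst_coord x i t) (x $ i) \<partial>lborel) * indicator cube x
      \<le> ?C * ((\<integral>\<^sup>+t\<in>{0<..<1}. ennreal (energy_density f (subst_coord x i t) \<bar>t - x $ i\<bar>) \<partial>lborel) * indicator cube x)"
    proof (cases "x \<in> cube")
      case True
      let ?X = "\<lambda>t. subst_coord x i t"
      have phi: "phi_weight p s G i (?X t) (x $ i) = (G (?X t) * \<bar>t - x $ i\<bar> powr (1 - 2 * s (?X t))) powr (1 - conj_exp p) *
         (LINT t':{min (x $ i) t..max (x $ i) t}|lborel. (G (?X t') * \<bar>t' - x $ i\<bar> powr (1 - 2 * s (?X t'))) powr (1 - conj_exp p)) powr (- p)" for t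
        unfolding phi_weight_def
        by (subst LINT_lebesgue_eq_lborel) (auto simp: Phi_def min.commute max.commute)
      have "(\<integral>\<^sup>+t\<in>{0<..<1}. ennreal (phi_weight p s G i (?X t) (x $ i) * \<bar>slab_fun f (?X (x $ i)) 0 - slab_fun f (?X t) \<bar>t - x $ i\<bar>\<bar> powr p) \<partial>lborel)
        \<le> ?C * (\<integral>\<^sup>+t\<in>{0<..<1}. ennreal (energy_density f (?X t) \<bar>t - x $ i\<bar>) \<partial>lborel)"
        unfolding phi using True
        by (intro path_Hardy[OF f, of "x $ i" ?X "axis i 1"] has_vector_derivative_subst_coord)
           (auto simp: cube_def)
      then show ?thesis using True by simp
    qed simp
  qed
  also have "\<dots> = ?C * (\<integral>\<^sup>+x\<in>cube. (\<integral>\<^sup>+t\<in>{0<..<1}. ennreal (energy_density f (subst_coord x i t) \<bar>t - x $ i\<bar>) \<partial>lborel) \<partial>lborel)"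
    by (rule nn_integral_cmult) measurable
  also have "(\<integral>\<^sup>+x\<in>cube. (\<integral>\<^sup>+t\<in>{0<..<1}. ennreal (energy_density f (subst_coord x i t) \<bar>t - x $ i\<bar>) \<partial>lborel) \<partial>lborel)
     = (\<integral>\<^sup>+x\<in>cube. (\<integral>\<^sup>+t\<in>{0<..<1}. ennreal (energy_density f x \<bar>x $ i - t\<bar>) \<partial>lborel) \<partial>lborel)"
    using nn_integral_swap_coord[of "\<lambda>x t. ennreal (energy_density f x \<bar>x $ i - t\<bar>)" i] by simp
  finally have "(\<integral>\<^sup>+x\<in>cube. (\<integral>\<^sup>+t\<in>{0<..<1}. ?F x t \<partial>lborel) \<partial>lborel) \<le>
      ?C * (\<integral>\<^sup>+x\<in>cube. (\<integral>\<^sup>+t\<in>{0<..<1}. ennreal (energy_density f x \<bar>x $ i - t\<bar>) \<partial>lborel) \<partial>lborel)" .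
  also have "\<dots> \<le> ?C * (2 * slab_energy f)" by (intro mult_left_mono folded_energy_le[OF f]) simp
  finally show ?thesis .
qed

lemma direction_weights_nonneg: "0 \<le> phi_weight p s G i x t" "0 \<le> psi_weight p s G i x t"
  by (auto simp: phi_weight_def psi_weight_def)

lemma dir_weight_measurable:
  "(\<lambda>z. dir_weight p s G i (fst z) (snd z)) \<in> borel_measurable (borel \<Otimes>\<^sub>M borel)"
  unfolding dir_weight_def
  using measurable_direction_weights[OF s_borel G_borel] by (intro borel_measurable_min)

text \<open>The intermediate point \<open>(x, \<bar>x\<^sub>i - t\<bar>)\<close> is common to both paths, and the weight \<open>w\<^sub>i\<close> is
bounded by \<open>\<psi>\<^sub>i\<close> on the vertical part and by \<open>\<phi>\<^sub>i\<close> on the diagonal part.\<close>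

lemma seminorm_estimate:
  assumes f: "smooth_upto U f"
  shows "seminorm_pow p (dir_weight p s G) i (\<lambda>x. f (x, 0)) \<le>
    ennreal (2 powr p * (Hardy_const p * 2 powr p) * 4) * slab_energy f"
proof -
  note [measurable (raw)] = measurable_curried[OF slab_fun_measurable[OF f]]
    measurable_curried[OF measurable_direction_weights(1)[OF s_borel G_borel]]
    measurable_curried[OF measurable_direction_weights(2)[OF s_borel G_borel]]
  let ?A = "\<lambda>x t. ennreal (psi_weight p s G i x t * \<bar>slab_fun f x 0 - slab_fun f x \<bar>x $ i - t\<bar>\<bar> powr p)"
  let ?B = "\<lambda>x t. ennreal (phi_weight p s G i x t * \<bar>slab_fun f (subst_coord x i t) 0 - slab_fun f x \<bar>x $ i - t\<bar>\<bar> powr p)"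
  let ?C = "ennreal (Hardy_const p * 2 powr p)"
  have C0: "0 \<le> Hardy_const p" using p by (intro Hardy_const_nonneg) simp
  have pt: "ennreal (dir_weight p s G i x t * \<bar>slab_fun f x 0 - slab_fun f (subst_coord x i t) 0\<bar> powr p)
      \<le> ennreal (2 powr p) * (?A x t + ?B x t)" for x t
  proof -
    let ?a = "slab_fun f x 0 - slab_fun f x \<bar>x $ i - t\<bar>" and ?b = "slab_fun f (subst_coord x i t) 0 - slab_fun f x \<bar>x $ i - t\<bar>"
    have w: "0 \<le> dir_weight p s G i x t" "dir_weight p s G i x t \<le> psi_weight p s G i x t" "dir_weight p s G i x t \<le> phi_weight p s G i x t"
      using direction_weights_nonneg[of i x t] by (auto simp: dir_weight_def)
    have "\<bar>slab_fun f x 0 - slab_fun f (subst_coord x i t) 0\<bar> powr p = norm (?a + - ?b) powr p" by simp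
    also have "\<dots> \<le> 2 powr p * (norm ?a powr p + norm (- ?b) powr p)" using p by (intro powr_norm_add_le) simp
    also have "norm (- ?b) = \<bar>?b\<bar>" by (simp only: norm_minus_cancel real_norm_def)
    finally have "dir_weight p s G i x t * \<bar>slab_fun f x 0 - slab_fun f (subst_coord x i t) 0\<bar> powr p
      \<le> dir_weight p s G i x t * (2 powr p * (\<bar>?a\<bar> powr p + \<bar>?b\<bar> powr p))"
      using w by (intro mult_left_mono) (simp_all only: real_norm_def)
    also have "\<dots> = 2 powr p * (dir_weight p s G i x t * \<bar>?a\<bar> powr p + dir_weight p s G i x t * \<bar>?b\<bar> powr p)"
      by (simp add: algebra_simps)
    also have "\<dots> \<le> 2 powr p * (psi_weight p s G i x t * \<bar>?a\<bar> powr p + phi_weight p s G i x t * \<bar>?b\<bar> powr p)"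
      using w by (intro mult_left_mono add_mono mult_right_mono) auto
    finally have "ennreal (dir_weight p s G i x t * \<bar>slab_fun f x 0 - slab_fun f (subst_coord x i t) 0\<bar> powr p)
      \<le> ennreal (2 powr p * (psi_weight p s G i x t * \<bar>?a\<bar> powr p + phi_weight p s G i x t * \<bar>?b\<bar> powr p))"
      by (rule ennreal_leI)
    also have "\<dots> = ennreal (2 powr p) * (?A x t + ?B x t)"
      using direction_weights_nonneg[of i x t] by (simp add: ennreal_mult ennreal_plus)
    finally show ?thesis .
  qed
  have "seminorm_pow p (dir_weight p s G) i (\<lambda>x. f (x, 0)) = seminorm_pow p (dir_weight p s G) i (\<lambda>x. slab_fun f x 0)"
    by (rule seminorm_pow_cong) (simp add: slab_fun_def)
  also have "\<dots> = (\<integral>\<^sup>+x\<in>cube. (\<integral>\<^sup>+t\<in>{0<..<1}. ennreal (dir_weight p s G i x t * \<bar>slab_fun f x 0 - slab_fun f (subst_coord x i t) 0\<bar> powr p) \<partial>lborel) \<partial>lborel)"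
    by (rule seminorm_pow_eq[of "dir_weight p s G" i, OF dir_weight_measurable]) measurable
  also have "\<dots> \<le> (\<integral>\<^sup>+x\<in>cube. (\<integral>\<^sup>+t. ennreal (2 powr p) * (?A x t * indicator {0<..<1} t + ?B x t * indicator {0<..<1} t) \<partial>lborel) \<partial>lborel)"
  proof (intro nn_integral_mono mult_right_mono)
    fix x t
    show "ennreal (dir_weight p s G i x t * \<bar>slab_fun f x 0 - slab_fun f (subst_coord x i t) 0\<bar> powr p) * indicator {0<..<1} t
      \<le> ennreal (2 powr p) * (?A x t * indicator {0<..<1} t + ?B x t * indicator {0<..<1} t)"
      using mult_right_mono[OF pt[of x t], of "indicator {0<..<1} t"] by (simp add: distrib_right mult.assoc)
  qed simp
  also have "\<dots> = (\<integral>\<^sup>+x. ennreal (2 powr p) * ((\<integral>\<^sup>+t\<in>{0<..<1}. ?A x t \<partial>lborel) * indicator cube x + (\<integral>\<^sup>+t\<in>{0<..<1}. ?B x t \<partial>lborel) * indicator cube x) \<partial>lborel)"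
    by (intro nn_integral_cong) (simp add: nn_integral_cmult nn_integral_add distrib_right mult.assoc)
  also have "\<dots> = ennreal (2 powr p) * ((\<integral>\<^sup>+x\<in>cube. (\<integral>\<^sup>+t\<in>{0<..<1}. ?A x t \<partial>lborel) \<partial>lborel) + (\<integral>\<^sup>+x\<in>cube. (\<integral>\<^sup>+t\<in>{0<..<1}. ?B x t \<partial>lborel) \<partial>lborel))"
    by (simp add: nn_integral_cmult nn_integral_add)
  also have "\<dots> \<le> ennreal (2 powr p) * (?C * (2 * slab_energy f) + ?C * (2 * slab_energy f))"
    by (intro mult_left_mono add_mono vertical_estimate[OF f] diagonal_estimate[OF f]) simp
  also have "\<dots> = ennreal (2 powr p) * ?C * 4 * slab_energy f"
  proof -
    have "?C * (2 * slab_energy f) + ?C * (2 * slab_energy f) = 2 * (?C * (2 * slab_energy f))"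
      by (rule mult_2[symmetric])
    also have "\<dots> = ?C * ((2 * 2) * slab_energy f)" by (simp only: mult_ac)
    finally show ?thesis by (simp add: mult.assoc)
  qed
  also have "ennreal (2 powr p) * ?C * 4 = ennreal (2 powr p * (Hardy_const p * 2 powr p) * 4)"
    using C0 by (simp add: ennreal_mult)
  finally show ?thesis .
qed

lemma boundary_estimate:
  assumes f: "smooth_upto U f"
  shows "Lp_pow p cube (base_weight p s G) (\<lambda>x. f (x, 0)) \<le> ennreal (boundary_const p) *
    ((\<integral>\<^sup>+x\<in>cube. (\<integral>\<^sup>+y\<in>{0<..<1}. ennreal (\<bar>slab_fun f x y\<bar> powr p * (G x * y powr (1 - 2 * s x))) \<partial>lborel) \<partial>lborel) + slab_energy f)"
proof -
  note [measurable (raw)] = measurable_curried[OF slab_fun_measurable[OF f]] measurable_curried[OF slab_grad_measurable[OF f]]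
    measurable_curried[OF energy_density_measurable[OF f]]
  let ?E = "\<lambda>x. \<integral>\<^sup>+y\<in>{0<..<1}. ennreal (\<bar>slab_fun f x y\<bar> powr p * (G x * y powr (1 - 2 * s x))) \<partial>lborel"
  let ?D = "\<lambda>x. \<integral>\<^sup>+y\<in>{0<..<1}. ennreal (energy_density f x y) \<partial>lborel"
  have "Lp_pow p cube (base_weight p s G) (\<lambda>x. f (x, 0)) = (\<integral>\<^sup>+x\<in>cube. ennreal (\<bar>f (x, 0)\<bar> powr p * base_weight p s G x) \<partial>lborel)"
    by (simp add: Lp_pow_def nn_integral_lebesgue_on)
  also have "\<dots> \<le> (\<integral>\<^sup>+x. ennreal (boundary_const p) * (?E x * indicator cube x + ?D x * indicator cube x) \<partial>lborel)"
  proof (rule nn_integral_mono)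
    fix x :: "real^'n"
    show "ennreal (\<bar>f (x, 0)\<bar> powr p * base_weight p s G x) * indicator cube x \<le> ennreal (boundary_const p) * (?E x * indicator cube x + ?D x * indicator cube x)"
    proof (cases "x \<in> cube")
      case True
      let ?a = "\<lambda>y. \<bar>slab_fun f x y\<bar> powr p * y powr (1 - 2 * s x)"
      let ?b = "\<lambda>y. slab_grad f x y powr p * y powr (1 - 2 * s x)"
      have "ennreal ((p - 2 + 2 * s x) powr p * \<bar>f (x, 0)\<bar> powr p) \<le> ennreal (boundary_const p) *
        ((\<integral>\<^sup>+y\<in>{0<..<1}. ennreal (?a y) \<partial>lborel) + (\<integral>\<^sup>+y\<in>{0<..<1}. ennreal (?b y) \<partial>lborel))"
      proof (rule boundary_value_estimate[OF p s_pos s_le_1, where g = "\<lambda>y. f (x, y)" and g' = "\<lambda>y. frechet_derivative f (at (x, y)) (0, 1)"])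
        have cf: "continuous_on (closure U) f" using f by (simp add: smooth_upto_def)
        have "Pair x ` {0..1} \<subseteq> closure U" using closed_slab_subset True by auto
        then show "continuous_on {0..1} (\<lambda>y. f (x, y))"
          by (intro continuous_on_compose2[OF cf] continuous_intros) auto
        fix y :: real assume y: "0 < y" "y < 1"
        have "(x, y) \<in> U" using slab_subset True y by auto
        then have df: "f differentiable (at (x, y))" by (rule smooth_upto_differentiable[OF f])
        have "((f \<circ> Pair x) has_derivative frechet_derivative f (at (x, y)) \<circ> (\<lambda>h. (0, h))) (at y)"
          using df by (intro diff_chain_at) (auto simp: frechet_derivative_works intro!: derivative_eq_intros)
        moreover have "frechet_derivative f (at (x, y)) \<circ> (\<lambda>h. (0, h)) = (*) (frechet_derivative f (at (x, y)) (0, 1))"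
        proof
          fix h
          show "(frechet_derivative f (at (x, y)) \<circ> (\<lambda>h. (0, h))) h = frechet_derivative f (at (x, y)) (0, 1) * h"
            using linear_cmul[OF linear_frechet_derivative[OF df], of h "(0, 1)"] by (simp add: mult.commute)
        qed
        ultimately show "((\<lambda>y. f (x, y)) has_real_derivative frechet_derivative f (at (x, y)) (0, 1)) (at y)"
          by (simp add: has_field_derivative_def o_def)
        have "\<bar>frechet_derivative f (at (x, y)) (0, 1)\<bar> \<le> norm (classical_gradient f (x, y)) * norm (0 :: real^'n, 1 :: real)"
          unfolding classical_gradient_inner[OF df] by (rule Cauchy_Schwarz_ineq2)
        then show "\<bar>frechet_derivative f (at (x, y)) (0, 1)\<bar> \<le> slab_grad f x y"
          using True y by (simp add: slab_grad_def norm_Pair)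
        show "slab_fun f x y = f (x, y)" using True y by (simp add: slab_fun_def)
      qed (auto simp: slab_grad_nonneg)
      then have "ennreal (G x) * ennreal ((p - 2 + 2 * s x) powr p * \<bar>f (x, 0)\<bar> powr p) \<le> ennreal (G x) * (ennreal (boundary_const p) *
        ((\<integral>\<^sup>+y\<in>{0<..<1}. ennreal (?a y) \<partial>lborel) + (\<integral>\<^sup>+y\<in>{0<..<1}. ennreal (?b y) \<partial>lborel)))"
        by (rule mult_left_mono) simp
      also have "\<dots> = ennreal (boundary_const p) * (ennreal (G x) * (\<integral>\<^sup>+y\<in>{0<..<1}. ennreal (?a y) \<partial>lborel) + ennreal (G x) * (\<integral>\<^sup>+y\<in>{0<..<1}. ennreal (?b y) \<partial>lborel))"
        by (simp only: distrib_left mult.left_commute)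
      also have "ennreal (G x) * (\<integral>\<^sup>+y\<in>{0<..<1}. ennreal (?a y) \<partial>lborel) = ?E x"
        using G_pos[of x] by (subst nn_integral_cmult[symmetric]) (auto intro!: nn_integral_cong simp: ennreal_mult''[symmetric] mult_ac indicator_def)
      also have "ennreal (G x) * (\<integral>\<^sup>+y\<in>{0<..<1}. ennreal (?b y) \<partial>lborel) = ?D x"
        using G_pos[of x] by (subst nn_integral_cmult[symmetric]) (auto intro!: nn_integral_cong simp: ennreal_mult''[symmetric] mult_ac indicator_def energy_density_def)
      also have "ennreal (G x) * ennreal ((p - 2 + 2 * s x) powr p * \<bar>f (x, 0)\<bar> powr p) = ennreal (\<bar>f (x, 0)\<bar> powr p * base_weight p s G x)"
        using G_pos[of x] by (simp add: ennreal_mult''[symmetric] base_weight_def mult_ac)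
      finally show ?thesis using True by simp
    qed simp
  qed
  also have "\<dots> = ennreal (boundary_const p) * ((\<integral>\<^sup>+x\<in>cube. ?E x \<partial>lborel) + slab_energy f)"
    by (simp add: nn_integral_cmult nn_integral_add)
  finally show ?thesis .
qed

definition trace_pow :: "(real^'n \<Rightarrow> real) \<Rightarrow> ennreal" where
  "trace_pow v = Lp_pow p cube (base_weight p s G) v + (\<Sum>i\<in>UNIV. seminorm_pow p (dir_weight p s G) i v)"

lemma trace_estimate:
  obtains C where "0 < C" "\<And>f. smooth_upto U f \<Longrightarrow>
    trace_pow (\<lambda>x. f (x, 0)) \<le> ennreal C * W1p_pow p U (cyl_weight s G) f"
proof
  let ?c = "2 powr p * (Hardy_const p * 2 powr p) * 4"
  let ?C = "1 + boundary_const p + real CARD('n) * ?c"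
  have nn: "0 \<le> Hardy_const p" "0 \<le> boundary_const p"
    using p by (auto simp: boundary_const_def intro!: Hardy_const_nonneg)
  show "0 < ?C" using nn by (simp add: add_pos_nonneg)
  fix f assume f: "smooth_upto U f"
  note [measurable (raw)] = measurable_curried[OF slab_fun_measurable[OF f]] measurable_curried[OF slab_grad_measurable[OF f]]
  let ?w = "cyl_weight s G"
  have 1: "(\<integral>\<^sup>+x\<in>cube. (\<integral>\<^sup>+y\<in>{0<..<1}. ennreal (\<bar>slab_fun f x y\<bar> powr p * (G x * y powr (1 - 2 * s x))) \<partial>lborel) \<partial>lborel) \<le> Lp_pow p U ?w f"
    by (rule slab_energy_le_Lp_pow[OF slab_fun_measurable[OF f]]) (simp add: slab_fun_def)
  have 2: "slab_energy f \<le> Lp_pow p U ?w (classical_gradient f)"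
    using slab_energy_le_Lp_pow[OF slab_grad_measurable[OF f], of "classical_gradient f"]
    by (simp add: slab_grad_def energy_density_def)
  have W: "W1p_pow p U ?w f = Lp_pow p U ?w f + Lp_pow p U ?w (classical_gradient f)"
    by (rule W1p_pow_eq[OF U_open is_weak_gradient_classical[OF U_open f]])
  have "Lp_pow p cube (base_weight p s G) (\<lambda>x. f (x, 0)) \<le> ennreal (boundary_const p) * W1p_pow p U ?w f"
    unfolding W by (rule order_trans[OF boundary_estimate[OF f]]) (intro mult_left_mono add_mono 1 2, simp)
  moreover have "seminorm_pow p (dir_weight p s G) i (\<lambda>x. f (x, 0)) \<le> ennreal ?c * W1p_pow p U ?w f" for i
    unfolding W using 2 by (intro order_trans[OF seminorm_estimate[OF f]] mult_left_mono) (auto intro: add_increasing)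
  then have "(\<Sum>i\<in>UNIV. seminorm_pow p (dir_weight p s G) i (\<lambda>x. f (x, 0))) \<le> (\<Sum>i\<in>(UNIV::'n set). ennreal ?c * W1p_pow p U ?w f)"
    by (intro sum_mono)
  then have "(\<Sum>i\<in>UNIV. seminorm_pow p (dir_weight p s G) i (\<lambda>x. f (x, 0))) \<le> ennreal (real CARD('n) * ?c) * W1p_pow p U ?w f"
    using nn by (simp add: ennreal_mult mult.assoc ennreal_of_nat_eq_real_of_nat)
  ultimately have "trace_pow (\<lambda>x. f (x, 0)) \<le> ennreal (boundary_const p) * W1p_pow p U ?w f + ennreal (real CARD('n) * ?c) * W1p_pow p U ?w f"
    unfolding trace_pow_def by (rule add_mono)
  also have "\<dots> = ennreal (boundary_const p + real CARD('n) * ?c) * W1p_pow p U ?w f"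
    using nn by (simp add: ennreal_plus distrib_right)
  also have "\<dots> \<le> ennreal ?C * W1p_pow p U ?w f"
    by (intro mult_right_mono ennreal_leI) auto
  finally show "trace_pow (\<lambda>x. f (x, 0)) \<le> ennreal ?C * W1p_pow p U ?w f" .
qed

end

section \<open>The trace of a Sobolev function\<close>

text \<open>Fatou's lemma in the form in which it is applied to the trace norms.\<close>

lemma nn_integral_le_of_AE_limit:
  assumes "\<And>n. F n \<in> borel_measurable M" and lim: "AE x in M. (\<lambda>n. F n x) \<longlonglongrightarrow> F' x"
    and le: "\<And>n. (\<integral>\<^sup>+x. F n x \<partial>M) \<le> B + ennreal (e n)" and e: "e \<longlonglongrightarrow> 0"
  shows "(\<integral>\<^sup>+x. F' x \<partial>M) \<le> B"
proof -
  have "(\<integral>\<^sup>+x. F' x \<partial>M) = (\<integral>\<^sup>+x. liminf (\<lambda>n. F n x) \<partial>M)"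
    using lim by (intro nn_integral_cong_AE) (auto elim!: eventually_mono simp: lim_imp_Liminf)
  also have "\<dots> \<le> liminf (\<lambda>n. \<integral>\<^sup>+x. F n x \<partial>M)" by (rule nn_integral_liminf) fact
  also have "\<dots> \<le> liminf (\<lambda>n. B + ennreal (e n))" by (intro Liminf_mono always_eventually allI le)
  also have "\<dots> = B"
  proof (rule lim_imp_Liminf)
    have "(\<lambda>n. B + ennreal (e n)) \<longlonglongrightarrow> B + ennreal 0" by (intro tendsto_intros e)
    then show "(\<lambda>n. B + ennreal (e n)) \<longlonglongrightarrow> B" by simp
  qed simp
  finally show ?thesis .
qed

lemma slab_indicator_measurable:
  "(indicator (cube \<times> {0<..<1}) :: (real^'n::finite) \<times> real \<Rightarrow> ennreal) \<in> borel_measurable lborel"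
  using borel_open[OF open_cube_slab] by (intro borel_measurable_indicator) simp

text \<open>The second projection is the first one composed with the measure-preserving exchange of variables.\<close>

lemma AE_slab_not_null:
  fixes N :: "(real^'n::finite) set"
  assumes N: "N \<in> null_sets lborel"
  shows "AE z in lborel. z \<in> cube \<times> {0<..<1::real} \<longrightarrow> fst z \<notin> N \<and> subst_coord (fst z) i (snd z) \<notin> N"
proof -
  have [measurable]: "N \<in> sets borel" using N by auto
  have z: "(\<integral>\<^sup>+x\<in>cube. (\<integral>\<^sup>+t\<in>{0<..<1::real}. indicator N x \<partial>lborel) \<partial>lborel) = 0"
  proof -
    have "(\<integral>\<^sup>+x\<in>cube. (\<integral>\<^sup>+t\<in>{0<..<1::real}. indicator N x \<partial>lborel) \<partial>lborel) \<le> (\<integral>\<^sup>+x. indicator N x \<partial>lborel)"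
      by (intro nn_integral_mono) (simp add: nn_integral_cmult_indicator, simp add: indicator_def)
    also have "\<dots> = 0" using N by (simp add: null_setsD1)
    finally show ?thesis by simp
  qed
  have *: "AE z in lborel. z \<in> cube \<times> {0<..<1::real} \<longrightarrow> g z \<notin> N"
    if [measurable]: "g \<in> borel_measurable (borel \<Otimes>\<^sub>M borel)"
      and 0: "(\<integral>\<^sup>+x\<in>cube. (\<integral>\<^sup>+t\<in>{0<..<1::real}. indicator N (g (x, t)) \<partial>lborel) \<partial>lborel) = 0" for g
  proof -
    have m: "(\<lambda>z. indicator N (g z) :: ennreal) \<in> borel_measurable (borel \<Otimes>\<^sub>M borel)" by measurable
    have "(\<integral>\<^sup>+z. indicator N (g z) * indicator (cube \<times> {0<..<1}) z \<partial>lborel) = 0"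
      using nn_integral_cube_slab[OF m] 0 by simp
    moreover have "(\<lambda>z. indicator N (g z) * indicator (cube \<times> {0<..<1}) z :: ennreal) \<in> borel_measurable lborel"
      using m by (intro borel_measurable_times_ennreal slab_indicator_measurable) (simp add: borel_prod)
    ultimately have "AE z in lborel. indicator N (g z) * indicator (cube \<times> {0<..<1}) z = (0 :: ennreal)"
      by (subst (asm) nn_integral_0_iff_AE)
    then show ?thesis by eventually_elim (auto simp: indicator_def split: if_splits)
  qed
  have "AE z in lborel. z \<in> cube \<times> {0<..<1::real} \<longrightarrow> fst z \<notin> N"
    by (rule *) (use z in auto)
  moreover have "AE z in lborel. z \<in> cube \<times> {0<..<1::real} \<longrightarrow> subst_coord (fst z) i (snd z) \<notin> N"
  proof (rule *)
    have "(\<integral>\<^sup>+x\<in>cube. (\<integral>\<^sup>+t\<in>{0<..<1::real}. indicator N (subst_coord x i t) \<partial>lborel) \<partial>lborel)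
      = (\<integral>\<^sup>+x\<in>cube. (\<integral>\<^sup>+t\<in>{0<..<1::real}. indicator N x \<partial>lborel) \<partial>lborel)"
      by (rule nn_integral_swap_coord[of "\<lambda>x t. indicator N x"]) measurable
    then show "(\<integral>\<^sup>+x\<in>cube. (\<integral>\<^sup>+t\<in>{0<..<1::real}. indicator N (subst_coord (fst (x, t)) i (snd (x, t))) \<partial>lborel) \<partial>lborel) = 0"
      using z by simp
  qed measurable
  ultimately show ?thesis by eventually_elim blast
qed

text \<open>The exceptional set becomes a Borel set, to which Tonelli's theorem applies.\<close>

lemma AE_lebesgue_on_iff_null:
  assumes "S \<in> sets borel"
  shows "(AE x in lebesgue_on S. P x) \<longleftrightarrow> (\<exists>N\<in>null_sets lborel. \<forall>x\<in>S. x \<notin> N \<longrightarrow> P x)"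
proof
  assume "AE x in lebesgue_on S. P x"
  then have "AE x in lebesgue. x \<in> S \<longrightarrow> P x" using assms by (subst (asm) AE_restrict_space_iff) auto
  then have "AE x in lborel. x \<in> S \<longrightarrow> P x" by (simp add: AE_completion_iff)
  then obtain N where "{x \<in> space lborel. \<not> (x \<in> S \<longrightarrow> P x)} \<subseteq> N" "emeasure lborel N = 0" "N \<in> sets lborel"
    by (rule AE_E)
  then show "\<exists>N\<in>null_sets lborel. \<forall>x\<in>S. x \<notin> N \<longrightarrow> P x"
    by (intro bexI[of _ N]) (auto simp: null_sets_def)
next
  assume "\<exists>N\<in>null_sets lborel. \<forall>x\<in>S. x \<notin> N \<longrightarrow> P x"
  then obtain N where N: "N \<in> null_sets lborel" "\<And>x. x \<in> S \<Longrightarrow> x \<notin> N \<Longrightarrow> P x" by blast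
  have "AE x in lborel. x \<in> S \<longrightarrow> P x" using AE_not_in[OF N(1)] by eventually_elim (use N(2) in blast)
  then have "AE x in lebesgue. x \<in> S \<longrightarrow> P x" by (rule AE_completion)
  then show "AE x in lebesgue_on S. P x" using assms by (subst AE_restrict_space_iff) auto
qed

lemma borel_imp_measurable_lebesgue_on:
  "f \<in> borel_measurable borel \<Longrightarrow> f \<in> borel_measurable (lebesgue_on S)"
  by (intro measurable_restrict_space1 measurable_completion) simp

lemma W1p_pow_cong_AE:
  assumes U: "open U" and u: "u \<in> W1p p U \<rho>" and v: "v \<in> W1p p U \<rho>" and eq: "AE x in lebesgue_on U. u x = v x"
  shows "W1p_pow p U \<rho> u = W1p_pow p U \<rho> v"
proof -
  obtain g h where g: "is_weak_gradient U u g" and h: "is_weak_gradient U v h" using u v by (auto simp: W1p_def)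
  have "L1_loc U v" using h by (simp add: is_weak_gradient_def)
  then have "is_weak_gradient U v g" by (rule is_weak_gradient_cong_AE[OF _ eq g U])
  then show ?thesis by (simp add: W1p_pow_eq[OF U g] W1p_pow_eq[OF U, of v g] Lp_pow_cong_AE[OF eq])
qed

context slab_domain
begin

lemma p_pos: "0 < p" using p by simp

lemma cyl_weight_measurable: "cyl_weight s G \<in> borel_measurable (lebesgue_on U)"
proof -
  have "(\<lambda>z. cyl_weight s G z) \<in> borel_measurable (borel \<Otimes>\<^sub>M borel)"
    unfolding cyl_weight_def by measurable
  then show ?thesis by (intro borel_imp_measurable_lebesgue_on) (simp add: borel_prod)
qed

lemma base_weight_borel [measurable]: "base_weight p s G \<in> borel_measurable borel"
  unfolding base_weight_def by measurable

lemma base_weight_pos: "0 < base_weight p s G x"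
  using G_pos[of x] s_pos[of x] p by (simp add: base_weight_def)

abbreviation Npow :: "(real^'n \<Rightarrow> real) \<Rightarrow> ennreal" where
  "Npow \<equiv> Lp_pow p cube (base_weight p s G)"

abbreviation Wpow :: "((real^'n) \<times> real \<Rightarrow> real) \<Rightarrow> ennreal" where
  "Wpow \<equiv> W1p_pow p U (cyl_weight s G)"

lemma Npow_lincomb_le:
  assumes "v \<in> borel_measurable (lebesgue_on cube)" "v' \<in> borel_measurable (lebesgue_on cube)"
  shows "Npow (\<lambda>x. v x + c * v' x) \<le> ennreal (2 powr p) * (Npow v + ennreal (\<bar>c\<bar> powr p) * Npow v')"
  using Lp_pow_lincomb_le[OF p_pos borel_imp_measurable_lebesgue_on[OF base_weight_borel] assms, of c] by simp

lemma Npow_le_trace_pow: "Npow v \<le> trace_pow v"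
  by (simp add: trace_pow_def)

text \<open>The base weight is positive everywhere, so a function whose weighted norm vanishes is zero almost
everywhere.\<close>

lemma AE_eq_of_common_approximation:
  assumes v: "v \<in> borel_measurable (lebesgue_on cube)" "v' \<in> borel_measurable (lebesgue_on cube)"
    and C: "0 \<le> C"
    and approx: "\<And>e. 0 < e \<Longrightarrow> \<exists>a \<in> borel_measurable (lebesgue_on cube).
      Npow (\<lambda>x. v x - a x) \<le> ennreal (C * e) \<and> Npow (\<lambda>x. v' x - a x) \<le> ennreal (C * e)"
  shows "AE x in lebesgue_on cube. v x = v' x"
proof -
  have le: "Npow (\<lambda>x. v x - v' x) \<le> 0 + ennreal e" if e: "0 < e" for e
  proof -
    define d where "d = e / (2 powr p * 2 * (C + 1))"
    have d: "0 < d" using e C by (simp add: d_def)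
    obtain a where a: "a \<in> borel_measurable (lebesgue_on cube)"
      "Npow (\<lambda>x. v x - a x) \<le> ennreal (C * d)" "Npow (\<lambda>x. v' x - a x) \<le> ennreal (C * d)"
      using approx[OF d] by blast
    have "Npow (\<lambda>x. (v x - a x) + (-1) * (v' x - a x)) \<le> ennreal (2 powr p) * (Npow (\<lambda>x. v x - a x) + ennreal (\<bar>-1\<bar> powr p) * Npow (\<lambda>x. v' x - a x))"
      using v a(1) by (intro Npow_lincomb_le) auto
    also have "\<dots> \<le> ennreal (2 powr p) * (ennreal (C * d) + ennreal (C * d))"
      using a(2,3) by (intro mult_left_mono add_mono) auto
    also have "\<dots> = ennreal (2 powr p * 2 * C * d)"
      using C d by (simp add: ennreal_mult[symmetric] ennreal_plus[symmetric] del: ennreal_plus)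
    also have "\<dots> \<le> ennreal (2 powr p * 2 * (C + 1) * d)"
      using d by (intro ennreal_leI mult_right_mono mult_left_mono) auto
    also have "2 powr p * 2 * (C + 1) * d = e" using C by (simp add: d_def)
    finally show ?thesis by simp
  qed
  have "Npow (\<lambda>x. v x - v' x) \<le> 0"
    by (rule ennreal_le_epsilon) (rule le)
  then have "(\<integral>\<^sup>+x. ennreal (norm (v x - v' x) powr p * base_weight p s G x) \<partial>lebesgue_on cube) = 0"
    by (simp add: Lp_pow_def)
  moreover have "(\<lambda>x. ennreal (norm (v x - v' x) powr p * base_weight p s G x)) \<in> borel_measurable (lebesgue_on cube)"
    using v borel_imp_measurable_lebesgue_on[OF base_weight_borel, of cube] by measurable
  ultimately have "AE x in lebesgue_on cube. ennreal (norm (v x - v' x) powr p * base_weight p s G x) = 0"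
    by (subst (asm) nn_integral_0_iff_AE)
  then show ?thesis
  proof eventually_elim
    case (elim x)
    then have "norm (v x - v' x) powr p * base_weight p s G x \<le> 0" by (simp add: ennreal_eq_0_iff)
    then have "norm (v x - v' x) powr p \<le> 0" using base_weight_pos[of x] by (simp add: mult_le_0_iff not_less)
    then show ?case by simp
  qed
qed

text \<open>Each of the \<open>N + 1\<close> terms of the trace norm is separately lower semicontinuous, whence the
factor.\<close>

lemma trace_pow_le_of_limit:
  assumes v [measurable]: "\<And>n. v n \<in> borel_measurable borel" "v' \<in> borel_measurable borel"
    and N: "N \<in> null_sets lborel" and lim: "\<And>x. x \<in> cube \<Longrightarrow> x \<notin> N \<Longrightarrow> (\<lambda>n. v n x) \<longlonglongrightarrow> v' x"
    and le: "\<And>n. trace_pow (v n) \<le> B + ennreal (e n)" and e: "e \<longlonglongrightarrow> 0"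
  shows "trace_pow v' \<le> ennreal (1 + real CARD('n)) * B"
proof -
  note [measurable (raw)] = measurable_curried[OF dir_weight_measurable]
  have "Npow v' \<le> B"
  proof -
    have eq: "Npow v = (\<integral>\<^sup>+x. ennreal (\<bar>v x\<bar> powr p * base_weight p s G x) * indicator cube x \<partial>lborel)" for v
      by (simp add: Lp_pow_def nn_integral_lebesgue_on)
    show ?thesis
      unfolding eq
    proof (rule nn_integral_le_of_AE_limit[OF _ _ _ e])
      show "AE x in lborel. (\<lambda>n. ennreal (\<bar>v n x\<bar> powr p * base_weight p s G x) * indicator cube x)
          \<longlonglongrightarrow> ennreal (\<bar>v' x\<bar> powr p * base_weight p s G x) * indicator cube x"
        using AE_not_in[OF N]
      proof eventually_elim
        case (elim x)
        show ?case
        proof (cases "x \<in> cube")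
          case True
          have "(\<lambda>n. ennreal (\<bar>v n x\<bar> powr p * base_weight p s G x)) \<longlonglongrightarrow> ennreal (\<bar>v' x\<bar> powr p * base_weight p s G x)"
            using lim[OF True elim] p by (intro tendsto_ennrealI tendsto_mult tendsto_powr2 tendsto_rabs) auto
          then show ?thesis using True by simp
        qed simp
      qed
      show "(\<integral>\<^sup>+x. ennreal (\<bar>v n x\<bar> powr p * base_weight p s G x) * indicator cube x \<partial>lborel) \<le> B + ennreal (e n)" for n
        using order_trans[OF Npow_le_trace_pow le[of n]] by (simp add: eq)
    qed measurable
  qed
  moreover have "seminorm_pow p (dir_weight p s G) i v' \<le> B" for i
  proof -
    let ?H = "\<lambda>v z. ennreal (dir_weight p s G i (fst z) (snd z) * \<bar>v (fst z) - v (subst_coord (fst z) i (snd z))\<bar> powr p)"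
    have m: "?H v \<in> borel_measurable (borel \<Otimes>\<^sub>M borel)" if [measurable]: "v \<in> borel_measurable borel" for v
      by measurable
    have eq: "seminorm_pow p (dir_weight p s G) i v = (\<integral>\<^sup>+z. ?H v z * indicator (cube \<times> {0<..<1}) z \<partial>lborel)"
      if v: "v \<in> borel_measurable borel" for v
      using nn_integral_cube_slab[OF m[OF v]] seminorm_pow_eq[of "dir_weight p s G" i, OF dir_weight_measurable v] by simp
    show ?thesis
      unfolding eq[OF v(2)]
    proof (rule nn_integral_le_of_AE_limit[OF _ _ _ e])
      show "(\<lambda>z. ?H (v n) z * indicator (cube \<times> {0<..<1}) z) \<in> borel_measurable lborel" for n
        using m[OF v(1)[of n]] by (intro borel_measurable_times_ennreal slab_indicator_measurable) (simp add: borel_prod)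
      show "AE z in lborel. (\<lambda>n. ?H (v n) z * indicator (cube \<times> {0<..<1}) z) \<longlonglongrightarrow> ?H v' z * indicator (cube \<times> {0<..<1}) z"
        using AE_slab_not_null[OF N, of i]
      proof eventually_elim
        case (elim z)
        show ?case
        proof (cases "z \<in> cube \<times> {0<..<1}")
          case True
          then have c: "fst z \<in> cube" "subst_coord (fst z) i (snd z) \<in> cube"
            by (auto intro: subst_coord_in_cube)
          have "(\<lambda>n. ?H (v n) z) \<longlonglongrightarrow> ?H v' z"
            using lim[OF c(1)] lim[OF c(2)] elim True p
            by (intro tendsto_ennrealI tendsto_mult tendsto_powr2 tendsto_rabs tendsto_diff) auto
          then show ?thesis using True by simp
        qed simp
      qed
      show "(\<integral>\<^sup>+z. ?H (v n) z * indicator (cube \<times> {0<..<1}) z \<partial>lborel) \<le> B + ennreal (e n)" for n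
      proof -
        have "seminorm_pow p (dir_weight p s G) i (v n) \<le> (\<Sum>i\<in>UNIV. seminorm_pow p (dir_weight p s G) i (v n))"
          by (rule member_le_sum) auto
        also have "\<dots> \<le> trace_pow (v n)" by (simp add: trace_pow_def add_increasing)
        also have "\<dots> \<le> B + ennreal (e n)" by (rule le)
        finally show ?thesis using eq[OF v(1)[of n]] by simp
      qed
    qed
  qed
  then have "(\<Sum>i\<in>UNIV. seminorm_pow p (dir_weight p s G) i v') \<le> (\<Sum>i\<in>(UNIV::'n set). B)"
    by (intro sum_mono)
  ultimately have "trace_pow v' \<le> B + of_nat CARD('n) * B"
    unfolding trace_pow_def by (intro add_mono) simp_all
  also have "\<dots> = ennreal (1 + real CARD('n)) * B"
    by (simp add: ennreal_plus distrib_right ennreal_of_nat_eq_real_of_nat)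
  finally show ?thesis .
qed

definition tests :: "((real^'n) \<times> real) set \<Rightarrow> ((real^'n) \<times> real \<Rightarrow> real) set" where
  "tests V = Cc_smooth U V \<inter> W1p p U (cyl_weight s G)"

lemma tests_smooth: "f \<in> tests V \<Longrightarrow> smooth_upto U f"
  by (simp add: tests_def Cc_smooth_def)

lemma tests_diff: "f \<in> tests V \<Longrightarrow> g \<in> tests V \<Longrightarrow> (\<lambda>z. f z - g z) \<in> tests V"
  using Cc_smooth_lincomb[OF U_open, of f V g "-1"] W1p_pow_diff_le(1)[OF U_open p_pos cyl_weight_measurable, of f g]
  by (simp add: tests_def)

lemma slab_fun_0_borel: "f \<in> tests V \<Longrightarrow> (\<lambda>x. slab_fun f x 0) \<in> borel_measurable borel"
  using measurable_curried[OF slab_fun_measurable[OF tests_smooth], of f V "\<lambda>x. x" borel "\<lambda>x. 0"] by simp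

lemma slab_fun_0: "x \<in> cube \<Longrightarrow> slab_fun f x 0 = f (x, 0)"
  by (simp add: slab_fun_def)

lemma tests_base_measurable: "f \<in> tests V \<Longrightarrow> (\<lambda>x. f (x, 0)) \<in> borel_measurable (lebesgue_on cube)"
  using borel_imp_measurable_lebesgue_on[OF slab_fun_0_borel, of f V cube]
  by (subst measurable_cong[of _ _ "\<lambda>x. slab_fun f x 0"]) (auto simp: slab_fun_0)

lemma trace_pow_cong: "(\<And>x. x \<in> cube \<Longrightarrow> v x = v' x) \<Longrightarrow> trace_pow v = trace_pow v'"
  unfolding trace_pow_def Lp_pow_def
  by (intro arg_cong2[where f = "(+)"] nn_integral_cong sum.cong seminorm_pow_cong) auto

lemma H1p_tests_iff:
  "u \<in> H1p p U V (cyl_weight s G) \<longleftrightarrow> u \<in> W1p p U (cyl_weight s G) \<and> (\<forall>e>0. \<exists>f\<in>tests V. Wpow (\<lambda>z. u z - f z) < ennreal e)"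
  unfolding tests_def by (rule H1p_iff[OF U_open p_pos cyl_weight_measurable])

text \<open>The estimate against all test functions characterises the trace of \<open>u\<close> up to a null set, and it
contains the boundedness of the trace operator, the case \<open>g = 0\<close>.\<close>

definition is_trace :: "real \<Rightarrow> ((real^'n) \<times> real) set \<Rightarrow> ((real^'n) \<times> real \<Rightarrow> real) \<Rightarrow> (real^'n \<Rightarrow> real) \<Rightarrow> bool" where
  "is_trace C V u v \<longleftrightarrow> v \<in> borel_measurable borel \<and>
    (\<forall>g\<in>tests V. trace_pow (\<lambda>x. v x - g (x, 0)) \<le> ennreal C * Wpow (\<lambda>z. u z - g z))"

text \<open>The hypothesis gives \<open>\<bar>d\<^sub>n\<bar> \<le> (M/w)\<^sup>1\<^sup>/\<^sup>p 2\<^sup>-\<^sup>n\<close>.\<close>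

lemma summable_of_weighted_powers:
  fixes d :: "nat \<Rightarrow> real"
  assumes w: "0 < w" and M: "\<And>n. 2 powr (real n * p) * (\<bar>d n\<bar> powr p * w) \<le> M"
  shows "summable d"
proof (rule summable_comparison_test')
  have M0: "0 \<le> M" using M[of 0] w by (smt (verit) mult_nonneg_nonneg powr_ge_zero)
  show "summable (\<lambda>n. (M / w) powr (1 / p) * (1 / 2) ^ n)" by (intro summable_mult summable_geometric) simp
  fix n :: nat
  have "\<bar>d n\<bar> powr p \<le> M / w * 2 powr - (real n * p)"
    using M[of n] w by (simp add: powr_minus field_simps)
  then have "(\<bar>d n\<bar> powr p) powr (1 / p) \<le> (M / w * 2 powr - (real n * p)) powr (1 / p)"
    using p by (intro powr_mono2) auto
  also have "(\<bar>d n\<bar> powr p) powr (1 / p) = \<bar>d n\<bar>" using p by (simp add: powr_powr)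
  also have "(M / w * 2 powr - (real n * p)) powr (1 / p) = (M / w) powr (1 / p) * 2 powr - real n"
    using p M0 w by (subst powr_mult) (auto simp: powr_powr)
  also have "2 powr - real n = (1 / 2) ^ n" by (simp add: powr_minus powr_realpow power_one_over inverse_eq_divide)
  finally show "norm (d n) \<le> (M / w) powr (1 / p) * (1 / 2) ^ n" by simp
qed

text \<open>Choose test functions with \<open>\<parallel>u - f\<^sub>n\<parallel>\<^sup>p < 4\<^sup>-\<^sup>n\<^sup>p\<close>. By the trace estimate the series
\<open>\<Sum>\<^sub>n 2\<^sup>n\<^sup>p \<bar>f\<^sub>n\<^sub>+\<^sub>1(x,0) - f\<^sub>n(x,0)\<bar>\<^sup>p\<close> has finite integral against the base weight, so
\<open>f\<^sub>n(x,0)\<close> converges for almost all \<open>x\<close>. For a test function \<open>g\<close>, the trace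
estimate for \<open>f\<^sub>n - g\<close> passes to the limit.\<close>

lemma is_trace_exists:
  obtains C where "0 < C" "\<And>V u. u \<in> H1p p U V (cyl_weight s G) \<Longrightarrow> \<exists>v. is_trace C V u v"
proof -
  obtain C0 where C0: "0 < C0" "\<And>f. smooth_upto U f \<Longrightarrow> trace_pow (\<lambda>x. f (x, 0)) \<le> ennreal C0 * Wpow f"
    using trace_estimate by blast
  define C where "C = (1 + real CARD('n)) * (C0 * 2 powr p)"
  have "\<exists>v. is_trace C V u v" if u: "u \<in> H1p p U V (cyl_weight s G)" for V u
  proof -
    have uW: "u \<in> W1p p U (cyl_weight s G)" using u by (simp add: H1p_def)
    \<comment> \<open>fast enough for the weights \<open>2\<^sup>n\<^sup>p\<close> below to leave a convergent series\<close>
    define \<delta> where "\<delta> n = (1 / 4) powr (real n * p)" for n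
    have \<delta>: "0 < \<delta> n" for n by (simp add: \<delta>_def)
    have "\<forall>n. \<exists>f\<in>tests V. Wpow (\<lambda>z. u z - f z) < ennreal (\<delta> n)"
      using u \<delta> unfolding H1p_tests_iff by blast
    then obtain f where f: "\<And>n. f n \<in> tests V" "\<And>n. Wpow (\<lambda>z. u z - f n z) < ennreal (\<delta> n)" by metis
    have \<delta>_mono: "\<delta> (Suc n) \<le> \<delta> n" for n unfolding \<delta>_def using p by (intro powr_mono') auto
    have \<delta>_lim: "\<delta> \<longlonglongrightarrow> 0"
    proof -
      have "\<delta> = (\<lambda>n. ((1 / 4) powr p) ^ n)"
        by (rule ext) (simp add: \<delta>_def powr_realpow[symmetric] powr_powr mult.commute)
      moreover have "(1 / 4 :: real) powr p < 1 powr p" using p by (intro powr_less_mono2) auto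
      ultimately show ?thesis by (simp add: LIMSEQ_power_zero)
    qed
    have uf: "(\<lambda>z. u z - f n z) \<in> W1p p U (cyl_weight s G)" for n
      using f(1)[of n] by (intro W1p_pow_diff_le(1)[OF U_open p_pos cyl_weight_measurable uW]) (simp add: tests_def)
    have step: "Npow (\<lambda>x. f (Suc n) (x, 0) - f n (x, 0)) \<le> ennreal (C0 * (2 powr p * (2 * \<delta> n)))" for n
    proof -
      have t: "(\<lambda>z. f (Suc n) z - f n z) \<in> tests V" by (intro tests_diff f)
      have "Npow (\<lambda>x. f (Suc n) (x, 0) - f n (x, 0)) \<le> trace_pow (\<lambda>x. f (Suc n) (x, 0) - f n (x, 0))"
        by (rule Npow_le_trace_pow)
      also have "\<dots> \<le> ennreal C0 * Wpow (\<lambda>z. f (Suc n) z - f n z)" by (rule C0(2)[OF tests_smooth[OF t]])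
      also have "(\<lambda>z. f (Suc n) z - f n z) = (\<lambda>z. (u z - f n z) - (u z - f (Suc n) z))" by auto
      also have "Wpow \<dots> \<le> ennreal (2 powr p) * (Wpow (\<lambda>z. u z - f n z) + Wpow (\<lambda>z. u z - f (Suc n) z))"
        by (rule W1p_pow_diff_le(2)[OF U_open p_pos cyl_weight_measurable uf uf])
      also have "\<dots> \<le> ennreal (2 powr p) * (ennreal (\<delta> n) + ennreal (\<delta> n))"
        using f(2)[of n] f(2)[of "Suc n"] ennreal_leI[OF \<delta>_mono[of n]]
        by (intro mult_left_mono add_mono) (auto intro: less_imp_le order_trans)
      also have "\<dots> = ennreal (2 powr p * (2 * \<delta> n))"
        using \<delta>[of n] by (simp add: ennreal_mult[symmetric] ennreal_plus[symmetric] del: ennreal_plus)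
      finally show ?thesis using C0(1) \<delta>[of n] by (simp add: ennreal_mult mult_left_mono)
    qed
    define a where "a n x = slab_fun (f n) x 0" for n x
    have a_borel [measurable]: "a n \<in> borel_measurable borel" for n
      unfolding a_def[abs_def] by (rule slab_fun_0_borel[OF f(1)])
    \<comment> \<open>terms of a series with finite integral\<close>
    define D where "D n x = 2 powr (real n * p) * (\<bar>a (Suc n) x - a n x\<bar> powr p * base_weight p s G x)" for n x
    have D_borel [measurable]: "D n \<in> borel_measurable borel" for n unfolding D_def[abs_def] by measurable
    have D0: "0 \<le> D n x" for n x using base_weight_pos[of x] by (simp add: D_def)
    have intD: "(\<integral>\<^sup>+x\<in>cube. ennreal (D n x) \<partial>lborel) \<le> ennreal (C0 * 2 powr p * 2 * (1 / 2) ^ n)" for n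
    proof -
      have "(\<integral>\<^sup>+x\<in>cube. ennreal (D n x) \<partial>lborel) =
         (\<integral>\<^sup>+x. ennreal (2 powr (real n * p)) * (ennreal (norm (f (Suc n) (x, 0) - f n (x, 0)) powr p * base_weight p s G x) * indicator cube x) \<partial>lborel)"
        using base_weight_pos
        by (intro nn_integral_cong) (auto simp: D_def a_def slab_fun_0 indicator_def ennreal_mult' less_imp_le)
      also have "\<dots> = (\<integral>\<^sup>+x. ennreal (2 powr (real n * p)) * (ennreal (\<bar>a (Suc n) x - a n x\<bar> powr p * base_weight p s G x) * indicator cube x) \<partial>lborel)"
        by (intro nn_integral_cong) (auto simp: a_def slab_fun_0 indicator_def)
      also have "\<dots> = ennreal (2 powr (real n * p)) * (\<integral>\<^sup>+x. ennreal (\<bar>a (Suc n) x - a n x\<bar> powr p * base_weight p s G x) * indicator cube x \<partial>lborel)"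
        by (rule nn_integral_cmult) measurable
      also have "(\<integral>\<^sup>+x. ennreal (\<bar>a (Suc n) x - a n x\<bar> powr p * base_weight p s G x) * indicator cube x \<partial>lborel) = Npow (\<lambda>x. f (Suc n) (x, 0) - f n (x, 0))"
        unfolding Lp_pow_def by (subst nn_integral_lebesgue_on) (auto intro!: nn_integral_cong simp: a_def slab_fun_0 indicator_def)
      also have "ennreal (2 powr (real n * p)) * \<dots> \<le> ennreal (2 powr (real n * p)) * ennreal (C0 * (2 powr p * (2 * \<delta> n)))"
        by (intro mult_left_mono step) simp
      also have "\<dots> = ennreal (C0 * 2 powr p * 2 * (2 powr (real n * p) * \<delta> n))"
        using C0(1) \<delta>[of n] by (subst ennreal_mult[symmetric]) (auto simp: mult_ac)
      also have "\<dots> \<le> ennreal (C0 * 2 powr p * 2 * (1 / 2) ^ n)"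
      proof (intro ennreal_leI mult_left_mono)
        have "2 powr (real n * p) * \<delta> n = (2 * (1 / 4)) powr (real n * p)" unfolding \<delta>_def by (simp only: powr_mult)
        also have "\<dots> = (1 / 2) powr (real n * p)" by simp
        also have "\<dots> \<le> (1 / 2) powr (real n)" using p by (intro powr_mono') (auto simp: mult_le_cancel_left1)
        also have "\<dots> = (1 / 2) ^ n" by (simp add: powr_realpow)
        finally show "2 powr (real n * p) * \<delta> n \<le> (1 / 2) ^ n" .
      qed (use C0(1) in auto)
      finally show ?thesis .
    qed
    have "(\<integral>\<^sup>+x. (\<Sum>n. ennreal (D n x) * indicator cube x) \<partial>lborel) = (\<Sum>n. \<integral>\<^sup>+x\<in>cube. ennreal (D n x) \<partial>lborel)"
      by (rule nn_integral_suminf) measurable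
    also have "\<dots> \<le> (\<Sum>n. ennreal (C0 * 2 powr p * 2 * (1 / 2) ^ n))"
      by (intro suminf_le intD) auto
    also have "\<dots> < \<infinity>"
    proof -
      have "summable (\<lambda>n. C0 * 2 powr p * 2 * (1 / 2) ^ n :: real)" by (intro summable_mult summable_geometric) simp
      then show ?thesis using C0(1) by (subst suminf_ennreal_eq[OF _ summable_sums]) auto
    qed
    finally have "AE x in lborel. (\<Sum>n. ennreal (D n x) * indicator cube x) \<noteq> \<infinity>"
      by (intro nn_integral_noteq_infinite) auto
    then have "AE x in lborel. x \<in> cube \<longrightarrow> convergent (\<lambda>n. a n x)"
    proof eventually_elim
      case (elim x)
      show ?case
      proof
        assume x: "x \<in> cube"
        then obtain M where M: "(\<Sum>n. ennreal (D n x)) = ennreal M" "0 \<le> M"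
          using elim by (cases "\<Sum>n. ennreal (D n x)") auto
        have "ennreal (D n x) \<le> ennreal M" for n
          unfolding M(1)[symmetric] using sum_le_suminf[of "\<lambda>n. ennreal (D n x)" "{n}"] by simp
        then have "D n x \<le> M" for n using M(2) by simp
        then have "summable (\<lambda>n. a (Suc n) x - a n x)"
          unfolding D_def by (rule summable_of_weighted_powers[OF base_weight_pos])
        then have "convergent (\<lambda>n. \<Sum>k<n. a (Suc k) x - a k x)" by (simp add: summable_iff_convergent)
        then have "convergent (\<lambda>n. a n x - a 0 x)" by (simp add: sum_lessThan_telescope[of "\<lambda>n. a n x"])
        then show "convergent (\<lambda>n. a n x)" by (simp add: convergent_diff_const_right_iff)
      qed
    qed
    then obtain N where "{x \<in> space lborel. \<not> (x \<in> cube \<longrightarrow> convergent (\<lambda>n. a n x))} \<subseteq> N" "emeasure lborel N = 0" "N \<in> sets lborel"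
      by (rule AE_E)
    then have N: "N \<in> null_sets lborel" "\<And>x. x \<in> cube \<Longrightarrow> x \<notin> N \<Longrightarrow> convergent (\<lambda>n. a n x)"
      by (auto simp: null_sets_def)
    define v where "v x = lim (\<lambda>n. a n x)" for x
    have v_borel [measurable]: "v \<in> borel_measurable borel"
      unfolding v_def[abs_def] by (rule borel_measurable_lim_metric) measurable
    have "is_trace C V u v"
      unfolding is_trace_def
    proof (intro conjI ballI v_borel)
      fix g assume g: "g \<in> tests V"
      define b where "b x = slab_fun g x 0" for x
      have b [measurable]: "b \<in> borel_measurable borel" unfolding b_def[abs_def] by (rule slab_fun_0_borel[OF g])
      have ug: "(\<lambda>z. u z - g z) \<in> W1p p U (cyl_weight s G)"
        using g by (intro W1p_pow_diff_le(1)[OF U_open p_pos cyl_weight_measurable uW]) (simp add: tests_def)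
      have "trace_pow (\<lambda>x. v x - b x) \<le> ennreal (1 + real CARD('n)) * (ennreal (C0 * 2 powr p) * Wpow (\<lambda>z. u z - g z))"
      proof (rule trace_pow_le_of_limit[OF _ _ N(1)])
        show "(\<lambda>n. a n x - b x) \<longlonglongrightarrow> v x - b x" if "x \<in> cube" "x \<notin> N" for x
          using N(2)[OF that] by (intro tendsto_diff tendsto_const) (simp add: convergent_LIMSEQ_iff v_def)
        show "trace_pow (\<lambda>x. a n x - b x) \<le> ennreal (C0 * 2 powr p) * Wpow (\<lambda>z. u z - g z) + ennreal (C0 * 2 powr p * \<delta> n)" for n
        proof -
          have "trace_pow (\<lambda>x. a n x - b x) = trace_pow (\<lambda>x. f n (x, 0) - g (x, 0))"
            by (rule trace_pow_cong) (simp add: a_def b_def slab_fun_0)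
          also have "\<dots> \<le> ennreal C0 * Wpow (\<lambda>z. f n z - g z)"
            by (rule C0(2)[OF tests_smooth[OF tests_diff[OF f(1) g]]])
          also have "(\<lambda>z. f n z - g z) = (\<lambda>z. (u z - g z) - (u z - f n z))" by auto
          also have "Wpow \<dots> \<le> ennreal (2 powr p) * (Wpow (\<lambda>z. u z - g z) + Wpow (\<lambda>z. u z - f n z))"
            by (rule W1p_pow_diff_le(2)[OF U_open p_pos cyl_weight_measurable ug uf])
          also have "\<dots> \<le> ennreal (2 powr p) * (Wpow (\<lambda>z. u z - g z) + ennreal (\<delta> n))"
            using f(2)[of n] by (intro mult_left_mono add_mono) auto
          finally have "trace_pow (\<lambda>x. a n x - b x) \<le> ennreal C0 * (ennreal (2 powr p) * (Wpow (\<lambda>z. u z - g z) + ennreal (\<delta> n)))"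
            by (simp add: mult_left_mono)
          also have "\<dots> = ennreal (C0 * 2 powr p) * Wpow (\<lambda>z. u z - g z) + ennreal (C0 * 2 powr p * \<delta> n)"
            using C0(1) \<delta>[of n] by (simp add: ennreal_mult distrib_left mult.assoc)
          finally show ?thesis .
        qed
        have "(\<lambda>n. C0 * 2 powr p * \<delta> n) \<longlonglongrightarrow> C0 * 2 powr p * 0" by (intro tendsto_intros \<delta>_lim)
        then show "(\<lambda>n. C0 * 2 powr p * \<delta> n) \<longlonglongrightarrow> 0" by simp
      qed measurable
      also have "\<dots> = ennreal C * Wpow (\<lambda>z. u z - g z)"
        using C0(1) by (simp add: C_def ennreal_mult mult.assoc)
      also have "trace_pow (\<lambda>x. v x - b x) = trace_pow (\<lambda>x. v x - g (x, 0))"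
        by (rule trace_pow_cong) (simp add: b_def slab_fun_0)
      finally show "trace_pow (\<lambda>x. v x - g (x, 0)) \<le> ennreal C * Wpow (\<lambda>z. u z - g z)" .
    qed
    then show ?thesis by blast
  qed
  moreover have "0 < C" using C0(1) by (simp add: C_def add_pos_nonneg)
  ultimately show ?thesis using that by blast
qed

end

section \<open>The trace operator\<close>

context slab_domain
begin

lemma is_traceD:
  assumes "is_trace C V u v"
  shows "v \<in> borel_measurable (lebesgue_on cube)"
    and "g \<in> tests V \<Longrightarrow> trace_pow (\<lambda>x. v x - g (x, 0)) \<le> ennreal C * Wpow (\<lambda>z. u z - g z)"
    and "g \<in> tests V \<Longrightarrow> Npow (\<lambda>x. v x - g (x, 0)) \<le> ennreal C * Wpow (\<lambda>z. u z - g z)"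
  using assms borel_imp_measurable_lebesgue_on[of v cube] order_trans[OF Npow_le_trace_pow]
  unfolding is_trace_def by blast+

lemma zero_in_tests: "(\<lambda>z. 0) \<in> tests V"
  using zero_in_Cc_smooth W1p_pow_zero(1)[OF U_open] by (simp add: tests_def)

text \<open>Both functions are approximated by the boundary values of the same test functions.\<close>

lemma trace_unique_AE:
  assumes u: "u \<in> H1p p U V (cyl_weight s G)" and t: "is_trace C V u t" and C: "0 \<le> C"
    and v: "v \<in> borel_measurable (lebesgue_on cube)" and K: "0 \<le> K"
    and le: "\<And>g. g \<in> tests V \<Longrightarrow> Npow (\<lambda>x. v x - g (x, 0)) \<le> ennreal K * Wpow (\<lambda>z. u z - g z)"
  shows "AE x in lebesgue_on cube. v x = t x"
proof (rule AE_eq_of_common_approximation[OF v is_traceD(1)[OF t], of "K + C"])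
  fix e :: real assume e: "0 < e"
  obtain g where g: "g \<in> tests V" "Wpow (\<lambda>z. u z - g z) < ennreal e"
    using u e unfolding H1p_tests_iff by blast
  have *: "ennreal L * Wpow (\<lambda>z. u z - g z) \<le> ennreal ((K + C) * e)" if "0 \<le> L" "L \<le> K + C" for L
  proof -
    have "ennreal L * Wpow (\<lambda>z. u z - g z) \<le> ennreal (K + C) * ennreal e"
      using g(2) that by (intro mult_mono ennreal_leI) auto
    then show ?thesis using K C e by (simp add: ennreal_mult)
  qed
  show "\<exists>a\<in>borel_measurable (lebesgue_on cube). Npow (\<lambda>x. v x - a x) \<le> ennreal ((K + C) * e) \<and> Npow (\<lambda>x. t x - a x) \<le> ennreal ((K + C) * e)"
    using order_trans[OF le[OF g(1)] *] order_trans[OF is_traceD(3)[OF t g(1)] *] K C tests_base_measurable[OF g(1)]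
    by (intro bexI[of _ "\<lambda>x. g (x, 0)"]) auto
qed (use K C in auto)

lemma trace_lincomb_AE:
  assumes u: "u \<in> H1p p U V (cyl_weight s G)" and v: "v \<in> H1p p U V (cyl_weight s G)"
    and t: "is_trace C V u t" and r: "is_trace C V v r" and q: "is_trace C V (\<lambda>z. u z + c * v z) q" and C: "0 \<le> C"
  shows "AE x in lebesgue_on cube. q x = t x + c * r x"
proof (rule AE_eq_of_common_approximation[of _ _ "C * (2 powr p * (1 + \<bar>c\<bar> powr p))"])
  show "q \<in> borel_measurable (lebesgue_on cube)" "(\<lambda>x. t x + c * r x) \<in> borel_measurable (lebesgue_on cube)"
    using is_traceD(1)[OF t] is_traceD(1)[OF r] is_traceD(1)[OF q] by auto
  show "0 \<le> C * (2 powr p * (1 + \<bar>c\<bar> powr p))" using C by simp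
  fix e :: real assume e: "0 < e"
  obtain g h where g: "g \<in> tests V" "Wpow (\<lambda>z. u z - g z) < ennreal e"
    and h: "h \<in> tests V" "Wpow (\<lambda>z. v z - h z) < ennreal e"
    using u v e unfolding H1p_tests_iff by meson
  have W: "u \<in> W1p p U (cyl_weight s G)" "v \<in> W1p p U (cyl_weight s G)" using u v by (auto simp: H1p_def)
  have W': "(\<lambda>z. u z - g z) \<in> W1p p U (cyl_weight s G)" "(\<lambda>z. v z - h z) \<in> W1p p U (cyl_weight s G)"
    using g h by (auto intro!: W1p_pow_diff_le(1)[OF U_open p_pos cyl_weight_measurable] W simp: tests_def)
  have gh: "(\<lambda>z. g z + c * h z) \<in> tests V"
    using g h Cc_smooth_lincomb[OF U_open] W1p_lincomb(1)[OF U_open p_pos cyl_weight_measurable] by (simp add: tests_def)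
  let ?a = "\<lambda>x. g (x, 0) + c * h (x, 0)"
  have comb: "ennreal (2 powr p) * (ennreal (L * e) + ennreal (\<bar>c\<bar> powr p) * ennreal (L * e)) = ennreal (L * (2 powr p * (1 + \<bar>c\<bar> powr p)) * e)"
    if "0 \<le> L" for L
  proof -
    have "ennreal (2 powr p) * (ennreal (L * e) + ennreal (\<bar>c\<bar> powr p) * ennreal (L * e)) = ennreal (2 powr p * (L * e + \<bar>c\<bar> powr p * (L * e)))"
      using that e by (simp add: ennreal_mult ennreal_plus)
    also have "2 powr p * (L * e + \<bar>c\<bar> powr p * (L * e)) = L * (2 powr p * (1 + \<bar>c\<bar> powr p)) * e" by (simp add: algebra_simps)
    finally show ?thesis .
  qed
  have 1: "Npow (\<lambda>x. q x - ?a x) \<le> ennreal (C * (2 powr p * (1 + \<bar>c\<bar> powr p)) * e)"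
  proof -
    have "Npow (\<lambda>x. q x - ?a x) \<le> ennreal C * Wpow (\<lambda>z. (u z + c * v z) - (g z + c * h z))"
      using is_traceD(3)[OF q gh] by simp
    also have "(\<lambda>z. (u z + c * v z) - (g z + c * h z)) = (\<lambda>z. (u z - g z) + c * (v z - h z))"
      by (auto simp: algebra_simps)
    also have "Wpow \<dots> \<le> ennreal (2 powr p) * (Wpow (\<lambda>z. u z - g z) + ennreal (\<bar>c\<bar> powr p) * Wpow (\<lambda>z. v z - h z))"
      by (rule W1p_lincomb(2)[OF U_open p_pos cyl_weight_measurable W'])
    also have "\<dots> \<le> ennreal (2 powr p) * (ennreal (1 * e) + ennreal (\<bar>c\<bar> powr p) * ennreal (1 * e))"
      using g(2) h(2) by (intro mult_left_mono add_mono) auto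
    also have "\<dots> = ennreal (1 * (2 powr p * (1 + \<bar>c\<bar> powr p)) * e)" by (rule comb) simp
    finally have "Npow (\<lambda>x. q x - ?a x) \<le> ennreal C * ennreal (1 * (2 powr p * (1 + \<bar>c\<bar> powr p)) * e)"
      by (simp add: mult_left_mono)
    also have "\<dots> = ennreal (C * (2 powr p * (1 + \<bar>c\<bar> powr p)) * e)"
      using C e by (subst ennreal_mult[symmetric]) (auto simp: mult_ac)
    finally show ?thesis .
  qed
  have NCe: "Npow (\<lambda>x. t x - g (x, 0)) \<le> ennreal (C * e)" "Npow (\<lambda>x. r x - h (x, 0)) \<le> ennreal (C * e)"
  proof -
    have "ennreal C * Wpow (\<lambda>z. u z - g z) \<le> ennreal C * ennreal e" "ennreal C * Wpow (\<lambda>z. v z - h z) \<le> ennreal C * ennreal e"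
      using g(2) h(2) by (auto intro!: mult_left_mono)
    then show "Npow (\<lambda>x. t x - g (x, 0)) \<le> ennreal (C * e)" "Npow (\<lambda>x. r x - h (x, 0)) \<le> ennreal (C * e)"
      using is_traceD(3)[OF t g(1)] is_traceD(3)[OF r h(1)] C e by (auto simp: ennreal_mult intro: order_trans)
  qed
  have 2: "Npow (\<lambda>x. (t x + c * r x) - ?a x) \<le> ennreal (C * (2 powr p * (1 + \<bar>c\<bar> powr p)) * e)"
  proof -
    have "Npow (\<lambda>x. (t x + c * r x) - ?a x) = Npow (\<lambda>x. (t x - g (x, 0)) + c * (r x - h (x, 0)))"
      by (rule arg_cong[where f = Npow]) (auto simp: algebra_simps)
    also have "\<dots> \<le> ennreal (2 powr p) * (Npow (\<lambda>x. t x - g (x, 0)) + ennreal (\<bar>c\<bar> powr p) * Npow (\<lambda>x. r x - h (x, 0)))"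
      using is_traceD(1)[OF t] is_traceD(1)[OF r] tests_base_measurable[OF g(1)] tests_base_measurable[OF h(1)]
      by (intro Npow_lincomb_le) auto
    also have "\<dots> \<le> ennreal (2 powr p) * (ennreal (C * e) + ennreal (\<bar>c\<bar> powr p) * ennreal (C * e))"
      using NCe by (intro mult_left_mono add_mono) auto
    also have "\<dots> = ennreal (C * (2 powr p * (1 + \<bar>c\<bar> powr p)) * e)" by (rule comb[OF C])
    finally show ?thesis .
  qed
  show "\<exists>a\<in>borel_measurable (lebesgue_on cube). Npow (\<lambda>x. q x - a x) \<le> ennreal (C * (2 powr p * (1 + \<bar>c\<bar> powr p)) * e) \<and>
      Npow (\<lambda>x. (t x + c * r x) - a x) \<le> ennreal (C * (2 powr p * (1 + \<bar>c\<bar> powr p)) * e)"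
    using 1 2 tests_base_measurable[OF g(1)] tests_base_measurable[OF h(1)] by (intro bexI[of _ ?a]) auto
qed

lemma trace_of_test_AE:
  assumes f: "f \<in> tests V" and t: "is_trace C V f t"
  shows "AE x in lebesgue_on cube. t x = f (x, 0)"
proof (rule AE_eq_of_common_approximation[OF is_traceD(1)[OF t] tests_base_measurable[OF f], of 0])
  have "Npow (\<lambda>x. t x - f (x, 0)) \<le> 0"
    using is_traceD(3)[OF t f] W1p_pow_zero(2)[OF U_open] by simp
  moreover have "Npow (\<lambda>x. f (x, 0) - f (x, 0)) = 0" by (simp add: Lp_pow_def)
  ultimately show "\<exists>a\<in>borel_measurable (lebesgue_on cube). Npow (\<lambda>x. t x - a x) \<le> ennreal (0 * e) \<and> Npow (\<lambda>x. f (x, 0) - a x) \<le> ennreal (0 * e)" for e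
    using tests_base_measurable[OF f] by (intro bexI[of _ "\<lambda>x. f (x, 0)"]) auto
qed simp

lemma trace_space_iff:
  "v \<in> trace_space p (base_weight p s G) (dir_weight p s G) \<longleftrightarrow> v \<in> borel_measurable (lebesgue_on cube) \<and> trace_pow v < \<infinity>"
  by (auto simp: trace_space_def weighted_Lp_def trace_pow_def less_top)

lemma trace_space_norm_eq:
  "trace_space_norm p (base_weight p s G) (dir_weight p s G) v = enn2real (trace_pow v) powr (1 / p)"
  by (simp add: trace_space_norm_def trace_pow_def)

lemma W1p_norm_eq: "W1p_norm p U (cyl_weight s G) u = enn2real (Wpow u) powr (1 / p)"
  by (simp add: W1p_norm_def W1p_pow_def)

lemma H1p_finite: "u \<in> H1p p U V (cyl_weight s G) \<Longrightarrow> Wpow u < \<infinity>"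
  using W1p_pow_finite[OF U_open] by (auto simp: H1p_def)

lemma trace_bound:
  assumes u: "u \<in> H1p p U V (cyl_weight s G)" and t: "is_trace C V u t" and C: "0 \<le> C"
  shows "t \<in> trace_space p (base_weight p s G) (dir_weight p s G)"
    and "trace_space_norm p (base_weight p s G) (dir_weight p s G) t \<le> C powr (1 / p) * W1p_norm p U (cyl_weight s G) u"
proof -
  have le: "trace_pow t \<le> ennreal C * Wpow u"
    using is_traceD(2)[OF t zero_in_tests] by simp
  then have "trace_pow t < \<infinity>"
    using H1p_finite[OF u] by (auto simp: ennreal_mult_less_top intro: le_less_trans)
  then show "t \<in> trace_space p (base_weight p s G) (dir_weight p s G)"
    using is_traceD(1)[OF t] by (simp add: trace_space_iff)
  have "enn2real (trace_pow t) \<le> enn2real (ennreal C * Wpow u)"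
    using le H1p_finite[OF u] by (intro enn2real_mono) (auto simp: ennreal_mult_less_top)
  also have "\<dots> = C * enn2real (Wpow u)" using C by (simp add: enn2real_mult)
  finally have "enn2real (trace_pow t) powr (1 / p) \<le> (C * enn2real (Wpow u)) powr (1 / p)"
    using p by (intro powr_mono2) auto
  then show "trace_space_norm p (base_weight p s G) (dir_weight p s G) t \<le> C powr (1 / p) * W1p_norm p U (cyl_weight s G) u"
    using C by (simp add: trace_space_norm_eq W1p_norm_eq powr_mult)
qed

text \<open>Translates boundedness of an arbitrary competitor, which is stated for norms, into \<open>p\<close>-th powers.\<close>

lemma trace_pow_le_of_norm_le:
  assumes "trace_pow v < \<infinity>" and "Wpow u < \<infinity>"
    and le: "trace_space_norm p (base_weight p s G) (dir_weight p s G) v \<le> K * W1p_norm p U (cyl_weight s G) u"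
  shows "trace_pow v \<le> ennreal (\<bar>K\<bar> powr p) * Wpow u"
proof -
  obtain a b where a: "trace_pow v = ennreal a" "0 \<le> a" and b: "Wpow u = ennreal b" "0 \<le> b"
    using assms(1,2) by (cases "trace_pow v"; cases "Wpow u") auto
  have "a powr (1 / p) \<le> K * b powr (1 / p)" using le a b by (simp add: trace_space_norm_eq W1p_norm_eq)
  also have "\<dots> \<le> \<bar>K\<bar> * b powr (1 / p)" by (intro mult_right_mono) auto
  finally have "(a powr (1 / p)) powr p \<le> (\<bar>K\<bar> * b powr (1 / p)) powr p"
    using p by (intro powr_mono2) auto
  then have "a \<le> \<bar>K\<bar> powr p * b" using p a b by (simp add: powr_powr powr_mult)
  then have "ennreal a \<le> ennreal (\<bar>K\<bar> powr p * b)" by (rule ennreal_leI)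
  then show ?thesis using a b by (simp add: ennreal_mult)
qed

text \<open>A competitor \<open>T'\<close> maps \<open>u - g\<close> to \<open>T' u - g(\<cdot>,0)\<close> for each test function
\<open>g\<close>. Its boundedness therefore is the estimate that characterises the trace.\<close>

lemma trace_operator_exists_unique: "exists_unique_trace p s G U V"
proof -
  let ?X = "H1p p U V (cyl_weight s G)"
  obtain C where C: "0 < C" "\<And>V u. u \<in> H1p p U V (cyl_weight s G) \<Longrightarrow> \<exists>v. is_trace C V u v"
    using is_trace_exists by blast
  then have C0: "0 \<le> C" by simp
  define T where "T u = (SOME v. is_trace C V u v)" for u
  have T: "is_trace C V u (T u)" if "u \<in> ?X" for u
    unfolding T_def using C(2)[OF that] by (rule someI_ex)
  have lin: "(\<lambda>z. u z + c * v z) \<in> ?X" if "u \<in> ?X" "v \<in> ?X" for u v c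
    by (rule H1p_lincomb[OF U_open p_pos cyl_weight_measurable that])
  have test_X: "f \<in> ?X" if "f \<in> tests V" for f
    using that by (intro Cc_smooth_W1p_subset_H1p[OF U_open p_pos cyl_weight_measurable]) (auto simp: tests_def)
  have X_test: "f \<in> tests V" if "f \<in> ?X \<inter> Cc_smooth U V" for f
    using that by (auto simp: tests_def H1p_def)
  have zX: "(\<lambda>z. 0) \<in> ?X" by (rule test_X[OF zero_in_tests])
  have T_tr: "is_trace_operator p s G U V T"
    unfolding is_trace_operator_def bounded_linear_op_def
  proof (intro conjI ballI allI impI)
    fix u assume u: "u \<in> ?X"
    show "T u \<in> trace_space p (base_weight p s G) (dir_weight p s G)"
      by (rule trace_bound(1)[OF u T[OF u] C0])
  next
    fix u v assume u: "u \<in> ?X" and v: "v \<in> ?X" and eq: "AE z in lebesgue_on U. u z = v z"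
    have "Npow (\<lambda>x. T u x - g (x, 0)) \<le> ennreal C * Wpow (\<lambda>z. v z - g z)" if g: "g \<in> tests V" for g
    proof -
      have "Wpow (\<lambda>z. u z - g z) = Wpow (\<lambda>z. v z - g z)"
        using eq u v g
        by (intro W1p_pow_cong_AE[OF U_open] W1p_pow_diff_le(1)[OF U_open p_pos cyl_weight_measurable])
           (auto simp: H1p_def tests_def elim: eventually_mono)
      then show ?thesis using is_traceD(3)[OF T[OF u] g] by simp
    qed
    then show "AE x in lebesgue_on cube. T u x = T v x"
      by (rule trace_unique_AE[OF v T[OF v] C0 is_traceD(1)[OF T[OF u]] C0])
  next
    fix u v assume u: "u \<in> ?X" and v: "v \<in> ?X"
    have "AE x in lebesgue_on cube. T (\<lambda>z. u z + 1 * v z) x = T u x + 1 * T v x"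
      by (rule trace_lincomb_AE[OF u v T[OF u] T[OF v] T[OF lin[OF u v]] C0])
    then show "AE x in lebesgue_on cube. T (\<lambda>z. u z + v z) x = T u x + T v x" by simp
  next
    fix c u assume u: "u \<in> ?X"
    have "AE x in lebesgue_on cube. T (\<lambda>z. 0 + c * u z) x = T (\<lambda>z. 0) x + c * T u x"
      by (rule trace_lincomb_AE[OF zX u T[OF zX] T[OF u] T[OF lin[OF zX u]] C0])
    moreover have "AE x in lebesgue_on cube. T (\<lambda>z. 0) x = 0"
      by (rule trace_of_test_AE[OF zero_in_tests T[OF zX]])
    ultimately show "AE x in lebesgue_on cube. T (\<lambda>z. c * u z) x = c * T u x"
      by eventually_elim simp
  next
    show "\<exists>K. \<forall>u\<in>?X. trace_space_norm p (base_weight p s G) (dir_weight p s G) (T u) \<le> K * W1p_norm p U (cyl_weight s G) u"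
      using trace_bound(2)[OF _ T C0] by blast
  next
    fix u assume "u \<in> ?X \<inter> Cc_smooth U V"
    then show "AE x in lebesgue_on cube. T u x = u (x, 0)"
      using trace_of_test_AE[OF X_test T] by blast
  qed
  moreover have "AE x in lebesgue_on cube. T' u x = T u x" if T': "is_trace_operator p s G U V T'" and u: "u \<in> ?X" for T' u
  proof -
    note T' = T'[unfolded is_trace_operator_def bounded_linear_op_def]
    obtain K where K: "\<And>u. u \<in> ?X \<Longrightarrow> trace_space_norm p (base_weight p s G) (dir_weight p s G) (T' u) \<le> K * W1p_norm p U (cyl_weight s G) u"
      using T' by blast
    have add: "AE x in lebesgue_on cube. T' (\<lambda>z. a z + b z) x = T' a x + T' b x" if "a \<in> ?X" "b \<in> ?X" for a b
      using T'[THEN conjunct1, THEN conjunct2, THEN conjunct2, THEN conjunct1] that by simp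
    have scale: "AE x in lebesgue_on cube. T' (\<lambda>z. c * a z) x = c * T' a x" if "a \<in> ?X" for c a
      using T'[THEN conjunct1, THEN conjunct2, THEN conjunct2, THEN conjunct2, THEN conjunct1] that by simp
    have test: "AE x in lebesgue_on cube. T' a x = a (x, 0)" if "a \<in> ?X" "a \<in> Cc_smooth U V" for a
      using T'[THEN conjunct2] that by simp
    have sp: "T' z \<in> trace_space p (base_weight p s G) (dir_weight p s G)" if "z \<in> ?X" for z
      using T' that by blast
    have "Npow (\<lambda>x. T' u x - g (x, 0)) \<le> ennreal (\<bar>K\<bar> powr p) * Wpow (\<lambda>z. u z - g z)" if g: "g \<in> tests V" for g
    proof -
      have gX: "g \<in> ?X" by (rule test_X[OF g])
      have ngX: "(\<lambda>z. -1 * g z) \<in> ?X" using lin[OF zX gX, of "-1"] by simp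
      have dX: "(\<lambda>z. u z + -1 * g z) \<in> ?X" by (rule lin[OF u gX])
      have "AE x in lebesgue_on cube. T' (\<lambda>z. u z + -1 * g z) x = T' u x + T' (\<lambda>z. -1 * g z) x"
        by (rule add[OF u ngX])
      moreover have "AE x in lebesgue_on cube. T' (\<lambda>z. -1 * g z) x = -1 * T' g x"
        by (rule scale[OF gX])
      moreover have "AE x in lebesgue_on cube. T' g x = g (x, 0)"
        using g by (intro test gX) (simp add: tests_def)
      ultimately have "AE x in lebesgue_on cube. T' u x - g (x, 0) = T' (\<lambda>z. u z + -1 * g z) x"
        by eventually_elim simp
      then have "Npow (\<lambda>x. T' u x - g (x, 0)) = Npow (T' (\<lambda>z. u z + -1 * g z))" by (rule Lp_pow_cong_AE)
      also have "\<dots> \<le> trace_pow (T' (\<lambda>z. u z + -1 * g z))" by (rule Npow_le_trace_pow)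
      also have "\<dots> \<le> ennreal (\<bar>K\<bar> powr p) * Wpow (\<lambda>z. u z + -1 * g z)"
        using sp[OF dX] H1p_finite[OF dX] K[OF dX] by (intro trace_pow_le_of_norm_le) (auto simp: trace_space_iff)
      finally show ?thesis by simp
    qed
    moreover have "T' u \<in> borel_measurable (lebesgue_on cube)" using sp[OF u] by (simp add: trace_space_iff)
    ultimately show ?thesis
      by (intro trace_unique_AE[OF u T[OF u] C0, of _ "\<bar>K\<bar> powr p"]) auto
  qed
  ultimately show ?thesis unfolding exists_unique_trace_def by blast
qed

end

section \<open>Measurable representatives of the weights\<close>

text \<open>Almost every line in direction \<open>i\<close> meets the exceptional set in a null set. On such a line the
inner integrals of the weights do not change.\<close>

lemma seminorm_pow_cong_weights:
  fixes s s' G G' :: "real^'n::finite \<Rightarrow> real"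
  assumes s' [measurable]: "s' \<in> borel_measurable borel" "G' \<in> borel_measurable borel"
    and N: "N \<in> null_sets lborel" and eq: "\<And>x. x \<in> cube \<Longrightarrow> x \<notin> N \<Longrightarrow> s x = s' x \<and> G x = G' x"
  shows "seminorm_pow p (dir_weight p s G) i v = seminorm_pow p (dir_weight p s' G') i v"
proof -
  note [measurable (raw)] = measurable_Phi[OF s']
  have "AE z in (lborel :: (real^'n) measure) \<Otimes>\<^sub>M (lborel :: real measure). z \<in> cube \<times> {0<..<1} \<longrightarrow> subst_coord (fst z) i (snd z) \<notin> N"
    using AE_slab_not_null[OF N, of i] unfolding lborel_prod by eventually_elim blast
  then have ae: "AE x in lborel. AE t in lborel. x \<in> cube \<and> t \<in> {0<..<1} \<longrightarrow> subst_coord x i t \<notin> N"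
    by (auto dest!: lborel_pair.AE_pair)
  have w: "dir_weight p s G i (subst_coord x i t) \<tau> = dir_weight p s' G' i (subst_coord x i t) \<tau>"
    if x: "x \<in> cube" and line: "AE t in lborel. x \<in> cube \<and> t \<in> {0<..<1} \<longrightarrow> subst_coord x i t \<notin> N"
      and t: "t \<in> {0<..<1}" "subst_coord x i t \<notin> N" and tau: "\<tau> \<in> {0<..<1}" for x t \<tau>
  proof -
    have e: "s (subst_coord x i t) = s' (subst_coord x i t)" "G (subst_coord x i t) = G' (subst_coord x i t)"
      using eq[OF subst_coord_in_cube[OF x] t(2)] t(1) by auto
    have Phi_eq: "Phi s G i (subst_coord x i t) r = Phi s' G' i (subst_coord x i t) r" for r
      by (simp add: Phi_def e)
    let ?A = "{min t \<tau>..max t \<tau>}"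
    let ?f = "\<lambda>s G r. indicator ?A r *\<^sub>R (Phi s G i (subst_coord x i r) \<tau> powr (1 - conj_exp p))"
    have ae': "AE r in lebesgue. ?f s' G' r = ?f s G r"
    proof (rule AE_completion)
      show "AE r in lborel. ?f s' G' r = ?f s G r"
        using line
      proof eventually_elim
        case (elim r)
        show ?case
        proof (cases "r \<in> ?A")
          case True
          then have "r \<in> {0<..<1}" using t(1) tau by auto
          then have "s (subst_coord x i r) = s' (subst_coord x i r)" "G (subst_coord x i r) = G' (subst_coord x i r)"
            using elim x eq[OF subst_coord_in_cube[OF x, of r i]] by auto
          then show ?thesis by (simp add: Phi_def)
        qed simp
      qed
    qed
    have m: "?f s' G' \<in> borel_measurable lebesgue"
      by (intro measurable_completion) measurable
    have "(LINT r|lebesgue. ?f s G r) = (LINT r|lebesgue. ?f s' G' r)"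
      using ae' by (intro integral_cong_AE m borel_measurable_AE[OF m]) (auto elim: eventually_mono)
    then have "phi_weight p s G i (subst_coord x i t) \<tau> = phi_weight p s' G' i (subst_coord x i t) \<tau>"
      by (simp add: phi_weight_def set_lebesgue_integral_def Phi_eq)
    moreover have "psi_weight p s G i (subst_coord x i t) \<tau> = psi_weight p s' G' i (subst_coord x i t) \<tau>"
      by (simp add: psi_weight_def Phi_eq)
    ultimately show ?thesis by (simp add: dir_weight_def)
  qed
  show ?thesis
    unfolding seminorm_pow_def
  proof (simp add: nn_integral_lebesgue_on, rule nn_integral_cong_AE)
    let ?I = "\<lambda>s G x t. \<integral>\<^sup>+\<tau>\<in>{0<..<1}. ennreal (dir_weight p s G i (subst_coord x i t) \<tau> * \<bar>v (subst_coord x i t) - v (subst_coord x i \<tau>)\<bar> powr p) \<partial>lborel"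
    show "AE x in lborel. (\<integral>\<^sup>+t\<in>{0<..<1}. ?I s G x t \<partial>lborel) * indicator cube x = (\<integral>\<^sup>+t\<in>{0<..<1}. ?I s' G' x t \<partial>lborel) * indicator cube x"
      using ae
    proof eventually_elim
      case line: (elim x)
      show ?case
      proof (cases "x \<in> cube")
        case x: True
        have "(\<integral>\<^sup>+t\<in>{0<..<1}. ?I s G x t \<partial>lborel) = (\<integral>\<^sup>+t\<in>{0<..<1}. ?I s' G' x t \<partial>lborel)"
        proof (rule nn_integral_cong_AE)
          show "AE t in lborel. ?I s G x t * indicator {0<..<1} t = ?I s' G' x t * indicator {0<..<1} t"
            using line
          proof eventually_elim
            case (elim t)
            show ?case
            proof (cases "t \<in> {0<..<1}")
              case True
              have "?I s G x t = ?I s' G' x t"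
                using w[OF x line True] elim x True by (intro nn_integral_cong) (auto simp: indicator_def)
              then show ?thesis by simp
            qed simp
          qed
        qed
        then show ?thesis by simp
      qed simp
    qed
  qed
qed

text \<open>The set \<open>N \<times> \<real>\<close> is null in the cylinder, so all norms keep their values, for arbitrary
functions.\<close>

lemma exists_unique_trace_cong_weights:
  fixes s s' G G' :: "real^'n::finite \<Rightarrow> real"
  assumes s': "s' \<in> borel_measurable borel" "G' \<in> borel_measurable borel"
    and ae: "AE x in lebesgue_on cube. s x = s' x \<and> G x = G' x"
    and U: "open U" "U \<subseteq> cube \<times> UNIV"
  shows "exists_unique_trace p s G U V \<longleftrightarrow> exists_unique_trace p s' G' U V"
proof -
  obtain N where N: "N \<in> null_sets lborel" and eq: "\<And>x. x \<in> cube \<Longrightarrow> x \<notin> N \<Longrightarrow> s x = s' x \<and> G x = G' x"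
    using ae unfolding AE_lebesgue_on_iff_null[OF cube_borel] by blast
  have semi: "seminorm_pow p (dir_weight p s G) = seminorm_pow p (dir_weight p s' G')"
    by (intro ext seminorm_pow_cong_weights[OF s' N eq])
  have ae_z: "AE z in (lborel :: ((real^'n) \<times> real) measure). fst z \<notin> N"
  proof -
    have "N \<times> (UNIV :: real set) \<in> null_sets (lborel \<Otimes>\<^sub>M lborel)"
      using N by (auto simp: null_sets_def lborel.emeasure_pair_measure_Times)
    then have "N \<times> (UNIV :: real set) \<in> null_sets lborel" by (simp only: lborel_prod)
    from AE_not_in[OF this] show ?thesis by eventually_elim auto
  qed
  have cyl: "Lp_pow p U (cyl_weight s G) u = Lp_pow p U (cyl_weight s' G') u" for u :: "(real^'n) \<times> real \<Rightarrow> 'z::real_normed_vector"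
    unfolding Lp_pow_def nn_integral_lebesgue_on[OF borel_open[OF U(1)]]
  proof (rule nn_integral_cong_AE)
    show "AE z in lborel. ennreal (norm (u z) powr p * cyl_weight s G z) * indicator U z = ennreal (norm (u z) powr p * cyl_weight s' G' z) * indicator U z"
      using ae_z
    proof eventually_elim
      case (elim z)
      then show ?case using eq[of "fst z"] U(2) by (cases z) (auto simp: cyl_weight_def indicator_def)
    qed
  qed
  have base: "Lp_pow p cube (base_weight p s G) u = Lp_pow p cube (base_weight p s' G') u" for u :: "real^'n \<Rightarrow> real"
    unfolding Lp_pow_def using ae by (intro nn_integral_cong_AE) (auto simp: base_weight_def elim: eventually_mono)
  have W: "weighted_Lp p U (cyl_weight s G) = (weighted_Lp p U (cyl_weight s' G') :: ((real^'n) \<times> real \<Rightarrow> real) set)"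
    "weighted_Lp p U (cyl_weight s G) = (weighted_Lp p U (cyl_weight s' G') :: ((real^'n) \<times> real \<Rightarrow> (real^'n) \<times> real) set)"
    by (simp_all add: weighted_Lp_def cyl)
  have W1: "W1p p U (cyl_weight s G) = W1p p U (cyl_weight s' G')" by (simp add: W1p_def W)
  have Wn: "W1p_norm p U (cyl_weight s G) = W1p_norm p U (cyl_weight s' G')"
    by (rule ext) (simp add: W1p_norm_def cyl)
  have H: "H1p p U V (cyl_weight s G) = H1p p U V (cyl_weight s' G')" by (simp add: H1p_def W1 Wn)
  have ts: "trace_space p (base_weight p s G) (dir_weight p s G) = trace_space p (base_weight p s' G') (dir_weight p s' G')"
    by (simp add: trace_space_def weighted_Lp_def base semi)
  have tn: "trace_space_norm p (base_weight p s G) (dir_weight p s G) = trace_space_norm p (base_weight p s' G') (dir_weight p s' G')"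
    by (rule ext) (simp add: trace_space_norm_def base semi)
  show ?thesis unfolding exists_unique_trace_def is_trace_operator_def H Wn ts tn ..
qed

lemma lebesgue_on_ex_borel_measurable_real:
  fixes f :: "'a::euclidean_space \<Rightarrow> real"
  assumes f: "f \<in> borel_measurable (lebesgue_on S)" and S: "S \<in> sets borel"
  obtains g where "g \<in> borel_measurable borel" "AE x in lebesgue_on S. f x = g x"
proof -
  have "(\<lambda>x. if x \<in> S then f x else 0) \<in> borel_measurable (completion lborel)"
    using borel_measurable_if_I[OF f] S by auto
  from completion_ex_borel_measurable_real[OF this] obtain g where
    g: "g \<in> borel_measurable lborel" and ae: "AE x in lborel. (if x \<in> S then f x else 0) = g x" by blast
  have "AE x in lebesgue. x \<in> S \<longrightarrow> f x = g x"
    using AE_completion[OF ae] by eventually_elim (auto split: if_splits)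
  then have "AE x in lebesgue_on S. f x = g x" using S by (subst AE_restrict_space_iff) auto
  then show ?thesis using that g by simp
qed

theorem theorem5p9:
  fixes p :: real and s G :: "real^'n \<Rightarrow> real"
  assumes p: "2 \<le> p"
    and s_meas: "s \<in> borel_measurable (lebesgue_on cube)"
    and s_range: "AE x in lebesgue_on cube. 0 \<le> s x \<and> s x \<le> 1"
    and s_nonzero: "{x \<in> cube. s x = 0} \<in> null_sets lebesgue"
    and G_weight: "is_weight cube G"
    and G_loc: "L1_loc cube (\<lambda>x. G x powr (- 1 / (p - 1)))"
    and G_const: "\<And>c. 0 < c \<Longrightarrow> c < 1 \<Longrightarrow> (\<forall>x\<in>cube. s x = c) \<Longrightarrow>
      (\<forall>x\<in>cube. G x = 2 powr (2 * c - 1) * Gamma c / Gamma (1 - c))"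
    and Phi_int: "\<And>i. AE x in lebesgue_on cube. AE z in lebesgue_on {0<..<1}.
      (\<integral>\<^sup>+ t. ennreal (Phi s G i (subst_coord x i t) z powr (1 - conj_exp p))
        \<partial>lebesgue_on {0<..<1}) < \<infinity>"
  shows "exists_unique_trace p s G cyl cyl_base \<and>
    (\<forall>\<tau>\<ge>1. exists_unique_trace p s G (tcyl \<tau>) (tcyl_base \<tau>))"
proof -
  obtain s1 where s1 [measurable]: "s1 \<in> borel_measurable borel" and s1_eq: "AE x in lebesgue_on cube. s x = s1 x"
    using lebesgue_on_ex_borel_measurable_real[OF s_meas cube_borel] .
  have Gm: "G \<in> borel_measurable (lebesgue_on cube)" and Gpos: "AE x in lebesgue_on cube. 0 < G x"
    using G_weight by (auto simp: is_weight_def)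
  obtain G1 where G1 [measurable]: "G1 \<in> borel_measurable borel" and G1_eq: "AE x in lebesgue_on cube. G x = G1 x"
    using lebesgue_on_ex_borel_measurable_real[OF Gm cube_borel] .
  \<comment> \<open>the value \<open>1\<close> is used only on a null set\<close>
  define s' where "s' x = (if 0 < s1 x \<and> s1 x \<le> 1 then s1 x else 1)" for x
  define G' where "G' x = (if 0 < G1 x then G1 x else 1)" for x
  have s'_m: "s' \<in> borel_measurable borel" and G'_m: "G' \<in> borel_measurable borel"
    unfolding s'_def[abs_def] G'_def[abs_def] by measurable
  have "AE x in lebesgue. x \<in> cube \<longrightarrow> s x \<noteq> 0"
    using AE_not_in[OF s_nonzero] by eventually_elim auto
  then have nz: "AE x in lebesgue_on cube. s x \<noteq> 0"
    by (subst AE_restrict_space_iff) auto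
  have ae: "AE x in lebesgue_on cube. s x = s' x \<and> G x = G' x"
    using s1_eq G1_eq nz s_range Gpos by eventually_elim (auto simp: s'_def G'_def)
  have main: "exists_unique_trace p s G U V"
    if U: "open U" "cube \<times> {0<..<1} \<subseteq> U" "U \<subseteq> cube \<times> {0<..}" for U V
  proof -
    interpret slab_domain p s' G' U
      by unfold_locales (use p s'_m G'_m U in \<open>auto simp: s'_def G'_def\<close>)
    have "U \<subseteq> cube \<times> UNIV" using U(3) by blast
    then show ?thesis
      using trace_operator_exists_unique exists_unique_trace_cong_weights[OF s'_m G'_m ae U(1)] by blast
  qed
  show ?thesis
  proof (intro conjI allI impI)
    show "exists_unique_trace p s G cyl cyl_base"
      by (rule main) (auto simp: cyl_def intro: open_Times open_cube)
    show "exists_unique_trace p s G (tcyl \<tau>) (tcyl_base \<tau>)" if "1 \<le> \<tau>" for \<tau>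
      using that by (intro main) (auto simp: tcyl_def intro!: open_Times open_cube)
  qed
qed

end
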